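(* Let $M$ be a compact complex manifold of complex dimension $n$ which is balanced, and let $f_1, f_2 \in \operatorname{Aut}(M)$ be two commuting holomorphic automorphisms preserving a volume form $V$ on $M$ (i.e. $f_1^*V=V$ and $f_2^*V=V$). Let $\Lambda\subset\mathbb{C}$ be a lattice generated by $\xi_1,\xi_2$, let $E=\mathbb{C}/\Lambda$ be the corresponding elliptic curve, and let $\pi: S\to E$ be the toric suspension of $(M,f_1,f_2)$ over $E$. Then $S$ is also balanced.
   Context: A Hermitian metric $h$ on a complex manifold of complex dimension $m$ with fundamental $(1,1)$-form $\omega$ is called balanced if $\omega^{m-1}$ is closed. A complex manifold is called balanced if it admits a balanced Hermitian metric. Toric suspension: given a complex manifold $M$, commuting holomorphic automorphisms $f_1,f_2$ of $M$, and a rank 2 lattice $\Lambda\subset\mathbb{C}$ generated by $\xi_1,\xi_2$, let $\mathbb{Z}^2=\langle\varphi_1,\varphi_2\rangle$ act on $M\times\mathbb{C}$ by $\varphi_j(m,z)=(f_j(m),z+\xi_j)$, $j=1,2$. The toric suspension of $(M,f_1,f_2)$ is the complex manifold $(M\times\mathbb{C})/\mathbb{Z}^2$; it is holomorphically fibered over $E=\mathbb{C}/\Lambda$ with fiber $M$. *)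

theory Defs
  imports "HOL-Analysis.Analysis" "HOL-Combinatorics.Permutations"
begin

section \<open>Calculus on open subsets of complex Euclidean space\<close>

text \<open>\<open>C\<^sup>k\<close> and \<open>C\<^sup>\<infinity>\<close> in the real sense; only used for open \<open>S\<close>.\<close>

primrec Ck_on :: "nat \<Rightarrow> 'v::real_normed_vector set \<Rightarrow> ('v \<Rightarrow> 'w::real_normed_vector) \<Rightarrow> bool" where
  "Ck_on 0 S f \<longleftrightarrow> continuous_on S f"
| "Ck_on (Suc k) S f \<longleftrightarrow>
     (\<forall>x\<in>S. f differentiable (at x)) \<and> (\<forall>v. Ck_on k S (\<lambda>x. frechet_derivative f (at x) v))"

definition smooth_on :: "'v::real_normed_vector set \<Rightarrow> ('v \<Rightarrow> 'w::real_normed_vector) \<Rightarrow> bool" where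
  "smooth_on S f \<longleftrightarrow> (\<forall>k. Ck_on k S f)"

text \<open>Holomorphy in several variables: real differentiable with complex-linear derivative.\<close>

definition holomorphic_vec_on ::
    "(complex ^ 'n \<Rightarrow> complex ^ 'm) \<Rightarrow> (complex ^ 'n) set \<Rightarrow> bool" where
  "holomorphic_vec_on f S \<longleftrightarrow>
     (\<forall>x\<in>S. \<exists>D. (f has_derivative D) (at x) \<and> Vector_Spaces.linear (*s) (*s) D)"

section \<open>Complex manifolds\<close>

text \<open>
  A chart is a pair \<open>(U, \<phi>)\<close>, where only the values of \<open>\<phi>\<close> on \<open>U\<close> matter. The complex
  dimension of a \<open>('a, 'n) cmanifold\<close> is \<open>CARD('n)\<close>. Neither connectedness nor maximality of the
  atlas is required.
\<close>

type_synonym ('a, 'n) chart = "'a set \<times> ('a \<Rightarrow> complex ^ 'n)"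

record ('a, 'n::finite) cmanifold =
  mtop :: "'a topology"
  atlas :: "('a, 'n) chart set"

text \<open>The expression of \<open>f\<close> in the chart \<open>c\<close> of the source and the chart \<open>d\<close> of the target.
  For \<open>f = id\<close> this is the transition map from \<open>c\<close> to \<open>d\<close>.\<close>

definition local_rep ::
    "('a, 'n) chart \<Rightarrow> ('b, 'm) chart \<Rightarrow> ('a \<Rightarrow> 'b) \<Rightarrow> complex ^ 'n \<Rightarrow> complex ^ 'm" where
  "local_rep c d f = snd d \<circ> f \<circ> inv_into (fst c) (snd c)"

definition complex_manifold :: "('a, 'n::finite) cmanifold \<Rightarrow> bool" where
  "complex_manifold M \<longleftrightarrow>
     Hausdorff_space (mtop M) \<and> second_countable (mtop M) \<and>
     (\<Union>c\<in>atlas M. fst c) = topspace (mtop M) \<and>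
     (\<forall>c\<in>atlas M. openin (mtop M) (fst c) \<and> open (snd c ` fst c) \<and>
        homeomorphic_map (subtopology (mtop M) (fst c)) (top_of_set (snd c ` fst c)) (snd c)) \<and>
     (\<forall>c\<in>atlas M. \<forall>d\<in>atlas M. holomorphic_vec_on (local_rep c d id) (snd c ` (fst c \<inter> fst d)))"

definition holomorphic_map ::
    "('a, 'n::finite) cmanifold \<Rightarrow> ('b, 'm::finite) cmanifold \<Rightarrow> ('a \<Rightarrow> 'b) \<Rightarrow> bool" where
  "holomorphic_map M N f \<longleftrightarrow>
     continuous_map (mtop M) (mtop N) f \<and>
     (\<forall>c\<in>atlas M. \<forall>d\<in>atlas N.
        holomorphic_vec_on (local_rep c d f) (snd c ` {p \<in> fst c. f p \<in> fst d}))"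

definition holomorphic_automorphism :: "('a, 'n::finite) cmanifold \<Rightarrow> ('a \<Rightarrow> 'a) \<Rightarrow> bool" where
  "holomorphic_automorphism M f \<longleftrightarrow>
     bij_betw f (topspace (mtop M)) (topspace (mtop M)) \<and>
     holomorphic_map M M f \<and> holomorphic_map M M (inv_into (topspace (mtop M)) f)"

section \<open>Alternating forms\<close>

text \<open>
  A \<open>k\<close>-linear form takes its arguments as a sequence \<open>v\<close> and depends on
  \<open>v 0, \<dots>, v (k - 1)\<close> only.
\<close>

definition alternating_form :: "nat \<Rightarrow> ((nat \<Rightarrow> 'v::real_vector) \<Rightarrow> real) \<Rightarrow> bool" where
  "alternating_form k \<alpha> \<longleftrightarrow>
     (\<forall>v w. (\<forall>i<k. v i = w i) \<longrightarrow> \<alpha> v = \<alpha> w) \<and>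
     (\<forall>v. \<forall>i<k. linear (\<lambda>x. \<alpha> (v(i := x)))) \<and>
     (\<forall>v i j. i < j \<longrightarrow> j < k \<longrightarrow> v i = v j \<longrightarrow> \<alpha> v = 0)"

text \<open>Wedge product of a \<open>p\<close>-form and a \<open>q\<close>-form, normalised so that
  \<open>(\<alpha> \<and> \<beta>)(u, v) = \<alpha>(u) \<beta>(v) - \<alpha>(v) \<beta>(u)\<close> for 1-forms.\<close>

definition wedge :: "nat \<Rightarrow> nat \<Rightarrow> ((nat \<Rightarrow> 'v) \<Rightarrow> real) \<Rightarrow> ((nat \<Rightarrow> 'v) \<Rightarrow> real) \<Rightarrow> (nat \<Rightarrow> 'v) \<Rightarrow> real" where
  "wedge p q \<alpha> \<beta> v =
     (\<Sum>\<sigma> | \<sigma> permutes {..<p + q}.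
        of_int (sign \<sigma>) * \<alpha> (\<lambda>i. v (\<sigma> i)) * \<beta> (\<lambda>i. v (\<sigma> (p + i)))) / (fact p * fact q)"

primrec two_form_power :: "((nat \<Rightarrow> 'v) \<Rightarrow> real) \<Rightarrow> nat \<Rightarrow> (nat \<Rightarrow> 'v) \<Rightarrow> real" where
  "two_form_power \<omega> 0 = (\<lambda>v. 1)"
| "two_form_power \<omega> (Suc k) = wedge 2 (2 * k) \<omega> (two_form_power \<omega> k)"

text \<open>The exterior derivative of a \<open>k\<close>-form \<open>\<alpha>\<close> (point first, then vectors):
  \<open>(d\<alpha>)\<^sub>x(v\<^sub>0, \<dots>, v\<^sub>k)\<close> is the sum over \<open>i\<close> of \<open>(-1)\<^sup>i\<close> times the derivative at \<open>x\<close> in the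
  direction \<open>v\<^sub>i\<close> of \<open>y \<mapsto> \<alpha>\<^sub>y(v\<^sub>0, \<dots>, v\<^sub>k)\<close> with \<open>v\<^sub>i\<close> omitted.\<close>

definition ext_deriv ::
    "nat \<Rightarrow> ('v::real_normed_vector \<Rightarrow> (nat \<Rightarrow> 'v) \<Rightarrow> real) \<Rightarrow> 'v \<Rightarrow> (nat \<Rightarrow> 'v) \<Rightarrow> real" where
  "ext_deriv k \<alpha> x v =
     (\<Sum>i\<le>k. (-1) ^ i *
        frechet_derivative (\<lambda>y. \<alpha> y (\<lambda>j. if j < i then v j else v (Suc j))) (at x) (v i))"

section \<open>Differential forms and Hermitian metrics on manifolds\<close>

text \<open>
  Tensor fields on \<open>M\<close> are given by their local expressions: one field on the image \<open>\<phi>(U)\<close> of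
  every chart \<open>(U, \<phi>)\<close> of the atlas, compatible with the transition maps.
\<close>

type_synonym ('a, 'n) form_field =
  "('a, 'n) chart \<Rightarrow> complex ^ 'n \<Rightarrow> (nat \<Rightarrow> complex ^ 'n) \<Rightarrow> real"

definition pullback_eq ::
    "('a, 'n::finite) cmanifold \<Rightarrow> ('b, 'm::finite) cmanifold \<Rightarrow> ('a \<Rightarrow> 'b) \<Rightarrow>
     ('b, 'm) form_field \<Rightarrow> ('a, 'n) form_field \<Rightarrow> bool" \<comment> \<open>\<open>f\<^sup>*\<beta> = \<alpha>\<close>\<close> where
  "pullback_eq M N f \<beta> \<alpha> \<longleftrightarrow>
     (\<forall>c\<in>atlas M. \<forall>d\<in>atlas N. \<forall>p\<in>fst c. f p \<in> fst d \<longrightarrow>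
        (\<forall>v. \<beta> d (snd d (f p)) (\<lambda>i. frechet_derivative (local_rep c d f) (at (snd c p)) (v i)) =
             \<alpha> c (snd c p) v))"

definition differential_form ::
    "('a, 'n::finite) cmanifold \<Rightarrow> nat \<Rightarrow> ('a, 'n) form_field \<Rightarrow> bool" where
  "differential_form M k \<alpha> \<longleftrightarrow>
     (\<forall>c\<in>atlas M. (\<forall>x\<in>snd c ` fst c. alternating_form k (\<alpha> c x)) \<and>
                   (\<forall>v. smooth_on (snd c ` fst c) (\<lambda>x. \<alpha> c x v))) \<and>
     pullback_eq M M id \<alpha> \<alpha>"

definition closed_form ::
    "('a, 'n::finite) cmanifold \<Rightarrow> nat \<Rightarrow> ('a, 'n) form_field \<Rightarrow> bool" where
  "closed_form M k \<alpha> \<longleftrightarrow>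
     differential_form M k \<alpha> \<and>
     (\<forall>c\<in>atlas M. \<forall>x\<in>snd c ` fst c. \<forall>v. ext_deriv k (\<alpha> c) x v = 0)"

definition volume_form :: "('a, 'n::finite) cmanifold \<Rightarrow> ('a, 'n) form_field \<Rightarrow> bool" where
  "volume_form M V \<longleftrightarrow>
     differential_form M (2 * CARD('n)) V \<and>
     (\<forall>c\<in>atlas M. \<forall>x\<in>snd c ` fst c. \<exists>v. V c x v \<noteq> 0)"

type_synonym ('a, 'n) sesqui_field =
  "('a, 'n) chart \<Rightarrow> complex ^ 'n \<Rightarrow> complex ^ 'n \<Rightarrow> complex ^ 'n \<Rightarrow> complex"

text \<open>Complex-linear in the first argument, hence conjugate-linear in the second.\<close>

definition hermitian_metric :: "('a, 'n::finite) cmanifold \<Rightarrow> ('a, 'n) sesqui_field \<Rightarrow> bool" where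
  "hermitian_metric M h \<longleftrightarrow>
     (\<forall>c\<in>atlas M. \<forall>x\<in>snd c ` fst c.
        (\<forall>v. Vector_Spaces.linear (*s) (*) (\<lambda>u. h c x u v)) \<and>
        (\<forall>u v. h c x v u = cnj (h c x u v)) \<and>
        (\<forall>u. u \<noteq> 0 \<longrightarrow> 0 < Re (h c x u u))) \<and>
     (\<forall>c\<in>atlas M. \<forall>u v. smooth_on (snd c ` fst c) (\<lambda>x. h c x u v)) \<and>
     (\<forall>c\<in>atlas M. \<forall>d\<in>atlas M. \<forall>p\<in>fst c \<inter> fst d. \<forall>u v.
        let D = frechet_derivative (local_rep c d id) (at (snd c p))
        in h d (snd d p) (D u) (D v) = h c (snd c p) u v)"

text \<open>\<open>\<omega> = - Im h\<close>, that is, \<open>\<omega> = (\<i>/2) \<Sum> h\<^sub>j\<^sub>k dz\<^sub>j \<and> d\<bar>z\<^sub>k\<close> for \<open>h = \<Sum> h\<^sub>j\<^sub>k dz\<^sub>j \<otimes> d\<bar>z\<^sub>k\<close>,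
  so that \<open>\<omega>(u, \<i>u) = h(u, u)\<close>.\<close>

definition fundamental_form :: "('a, 'n::finite) sesqui_field \<Rightarrow> ('a, 'n) form_field" where
  "fundamental_form h c x v = - Im (h c x (v 0) (v 1))"

definition balanced_metric :: "('a, 'n::finite) cmanifold \<Rightarrow> ('a, 'n) sesqui_field \<Rightarrow> bool" where
  "balanced_metric M h \<longleftrightarrow>
     hermitian_metric M h \<and>
     closed_form M (2 * (CARD('n) - 1))
       (\<lambda>c x. two_form_power (fundamental_form h c x) (CARD('n) - 1))"

definition balanced_manifold :: "('a, 'n::finite) cmanifold \<Rightarrow> bool" where
  "balanced_manifold M \<longleftrightarrow> complex_manifold M \<and> (\<exists>h. balanced_metric M h)"

section \<open>Toric suspensions\<close>

text \<open>The product manifold of \<open>M\<close> and the complex plane. The coordinate of the second factor has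
  index \<open>None\<close>, so the dimension is \<open>CARD('n option) = CARD('n) + 1\<close>.\<close>

definition times_plane :: "('a, 'n::finite) cmanifold \<Rightarrow> ('a \<times> complex, 'n option) cmanifold" where
  "times_plane M =
     \<lparr>mtop = prod_topology (mtop M) euclidean,
      atlas = (\<lambda>(U, \<phi>). (U \<times> UNIV,
                 \<lambda>(p, z). \<chi> i. case i of None \<Rightarrow> z | Some j \<Rightarrow> \<phi> p $ j)) ` atlas M\<rparr>"

definition quotient_topology :: "'a topology \<Rightarrow> ('a \<Rightarrow> 'b) \<Rightarrow> 'b topology" where
  "quotient_topology X q =
     topology (\<lambda>U. U \<subseteq> q ` topspace X \<and> openin X {x \<in> topspace X. q x \<in> U})"

text \<open>The charts of the quotient are the charts of \<open>N\<close> restricted to open sets \<open>W\<close> on which \<open>q\<close>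
  is injective, composed with the inverse of \<open>q\<close> on \<open>W\<close>.\<close>

definition quotient_manifold ::
    "('a, 'n::finite) cmanifold \<Rightarrow> ('a \<Rightarrow> 'b) \<Rightarrow> ('b, 'n) cmanifold" where
  "quotient_manifold N q =
     \<lparr>mtop = quotient_topology (mtop N) q,
      atlas = {(q ` W, snd c \<circ> inv_into W q) | c W.
                 c \<in> atlas N \<and> openin (mtop N) W \<and> W \<subseteq> fst c \<and> inj_on q W}\<rparr>"

text \<open>Integer iterates of a bijection \<open>f\<close> of the set \<open>A\<close>.\<close>

definition int_iterate :: "'a set \<Rightarrow> ('a \<Rightarrow> 'a) \<Rightarrow> int \<Rightarrow> 'a \<Rightarrow> 'a" where
  "int_iterate A f a = (if 0 \<le> a then f ^^ nat a else inv_into A f ^^ nat (- a))"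

definition suspension_action ::
    "'a set \<Rightarrow> ('a \<Rightarrow> 'a) \<Rightarrow> ('a \<Rightarrow> 'a) \<Rightarrow> complex \<Rightarrow> complex \<Rightarrow> int \<times> int \<Rightarrow> 'a \<times> complex \<Rightarrow> 'a \<times> complex"
  where
  "suspension_action A f1 f2 \<xi>1 \<xi>2 = (\<lambda>(a, b) (p, z).
     (int_iterate A f1 a (int_iterate A f2 b p), z + of_int a * \<xi>1 + of_int b * \<xi>2))"

definition toric_suspension ::
    "('a, 'n::finite) cmanifold \<Rightarrow> ('a \<Rightarrow> 'a) \<Rightarrow> ('a \<Rightarrow> 'a) \<Rightarrow> complex \<Rightarrow> complex \<Rightarrow>
     (('a \<times> complex) set, 'n option) cmanifold" where
  "toric_suspension M f1 f2 \<xi>1 \<xi>2 =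
     quotient_manifold (times_plane M)
       (\<lambda>x. range (\<lambda>g. suspension_action (topspace (mtop M)) f1 f2 \<xi>1 \<xi>2 g x))"

end

theory Submission
  imports Defs "HOL-Complex_Analysis.Complex_Analysis"
begin

text \<open>
  Up to a constant, \<open>\<omega>\<^sup>N\<^sup>-\<^sup>1\<close> is the contraction of the volume form of the metric \<open>H\<close> with a bivector
  given by a positive Hermitian matrix \<open>L\<close>, the inverse metric matrix times the volume density.
  Hence a metric is balanced if and only if \<open>L\<close>, a linear object, is divergence free, and by
  Michelsohn's algebraic argument every positive \<open>L\<close> comes from a metric (for \<open>N \<ge> 2\<close>).

  On \<open>M \<times> \<complex>\<close> take the block matrix with blocks \<open>\<Sum>\<^sub>g \<chi>(z + \<tau>\<^sub>g) L(g\<^sup>*H)\<close> and \<open>\<bar>V\<bar>\<close>, where \<open>\<chi>\<close> is a cut-off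
  whose translates are locally finite and cover the plane. The sum over the group makes the first
  block equivariant, and the second one is equivariant because \<open>V\<close> is preserved. Both are divergence free, because
  \<open>\<chi>\<close> does not depend on \<open>M\<close> and \<open>\<bar>V\<bar>\<close> does not depend on \<open>z\<close>. So the resulting balanced metric descends.
\<close>

text \<open>The maps \<open>f1\<close> and \<open>f2\<close> need not preserve the given balanced
  metric, and averaging metrics over the group is useless, because \<omega>^(N-1) is not linear in
  the metric. Positivity and vanishing divergence of L do survive sums, and a weight depending on z
  alone is harmless: its derivative points in the plane direction, which the first block
  annihilates. The entry in the plane direction has to be a positive density on M, independent of z,
  that every group element preserves. The volume element of H obeys the right law under changes of
  charts but need not be invariant; a preserved volume form supplies exactly what is missing.
  Recovering the metric A from L means solving det(A) A^(-1) = L, that is A = t L^(-1) with t^(N-1)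
  fixed. The product has N = n + 1, so the root exists even when M is a curve. The divergence is a
  coordinate expression. That a pulled back metric is again balanced is therefore proved for forms,
  by naturality of d; this requires symmetric second derivatives and hence smoothness of holomorphic
  maps.\<close>

section \<open>Antisymmetrisation of multilinear forms\<close>

definition omit :: "nat \<Rightarrow> (nat \<Rightarrow> 'v) \<Rightarrow> nat \<Rightarrow> 'v" where
  "omit i v = (\<lambda>j. if j < i then v j else v (Suc j))"

text \<open>\<open>omit\<close> is the argument list that occurs in \<open>ext_deriv\<close>;
  \<open>insert_at\<close> undoes it, and describes the stages through which an entry travels to the
  front by adjacent swaps.\<close>

definition insert_at :: "nat \<Rightarrow> 'v \<Rightarrow> (nat \<Rightarrow> 'v) \<Rightarrow> nat \<Rightarrow> 'v" where
  "insert_at l q v = (\<lambda>j. if j < l then v j else if j = l then q else v (j - 1))"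

text \<open>Antisymmetrisation without the factorial. A wedge product is an \<open>altsum\<close> of
  a product divided by factorials, so identities between wedge products are proved for
  \<open>altsum\<close> and normalised at the end.\<close>

definition altsum :: "nat \<Rightarrow> ((nat \<Rightarrow> 'v) \<Rightarrow> real) \<Rightarrow> (nat \<Rightarrow> 'v) \<Rightarrow> real" where
  "altsum n F v = (\<Sum>\<sigma> | \<sigma> permutes {..<n}. of_int (sign \<sigma>) * F (v \<circ> \<sigma>))"

text \<open>The integrand of an \<open>altsum\<close> is typically a product of forms, linear in
  each slot but not alternating; hence this weaker notion.\<close>

definition multilinear_form :: "nat \<Rightarrow> ((nat \<Rightarrow> 'v::real_vector) \<Rightarrow> real) \<Rightarrow> bool" where
  "multilinear_form k \<alpha> \<longleftrightarrow> (\<forall>v w. (\<forall>i<k. v i = w i) \<longrightarrow> \<alpha> v = \<alpha> w) \<and>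
     (\<forall>v. \<forall>i<k. linear (\<lambda>x. \<alpha> (v(i := x))))"

lemma omit_0: "omit 0 v = v \<circ> Suc"
  by (auto simp: omit_def)

lemma omit_Suc: "omit (Suc i) v = case_nat (v 0) (omit i (v \<circ> Suc))"
  by (auto simp: omit_def fun_eq_iff split: nat.split)

lemma case_nat_comp_Suc [simp]: "case_nat a v \<circ> Suc = v"
  by auto

lemma insert_at_0: "insert_at 0 q v = case_nat q v"
  by (auto simp: insert_at_def fun_eq_iff split: nat.split)

lemma altsum_0 [simp]: "altsum 0 F v = F v"
  by (simp add: altsum_def)

lemma altsum_cmult: "altsum n (\<lambda>w. c * F w) v = c * altsum n F v"
  by (simp add: altsum_def sum_distrib_left mult_ac)

text \<open>Left translation by \<open>\<tau>\<close> reindexes the permutations. Here the vectors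
  are permuted; in \<open>altsum_permute_arg\<close> right translation permutes the slots of
  \<open>F\<close>.\<close>

lemma altsum_permute:
  assumes "\<tau> permutes {..<n}"
  shows "altsum n F (v \<circ> \<tau>) = of_int (sign \<tau>) * altsum n F v"
proof -
  have "altsum n F v = (\<Sum>\<sigma> | \<sigma> permutes {..<n}. of_int (sign (\<tau> \<circ> \<sigma>)) * F (v \<circ> (\<tau> \<circ> \<sigma>)))"
    unfolding altsum_def by (rule setum_permutations_compose_left[OF assms])
  also have "\<dots> = (\<Sum>\<sigma> | \<sigma> permutes {..<n}. of_int (sign \<tau>) * (of_int (sign \<sigma>) * F (v \<circ> \<tau> \<circ> \<sigma>)))"
    by (intro sum.cong refl) (use assms in \<open>simp add: sign_compose
        permutes_imp_permutation[of "{..<n}"] comp_assoc\<close>)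
  finally have "altsum n F v = of_int (sign \<tau>) * altsum n F (v \<circ> \<tau>)"
    by (simp add: altsum_def sum_distrib_left)
  then show ?thesis by (simp flip: of_int_mult mult.assoc)
qed

lemma altsum_permute_arg:
  assumes "\<tau> permutes {..<n}"
  shows "altsum n (\<lambda>w. F (w \<circ> \<tau>)) v = of_int (sign \<tau>) * altsum n F v"
proof -
  have "altsum n F v = (\<Sum>\<sigma> | \<sigma> permutes {..<n}. of_int (sign (\<sigma> \<circ> \<tau>)) * F (v \<circ> (\<sigma> \<circ> \<tau>)))"
    unfolding altsum_def by (rule sum_permutations_compose_right[OF assms])
  also have "\<dots> = (\<Sum>\<sigma> | \<sigma> permutes {..<n}. of_int (sign \<tau>) * (of_int (sign \<sigma>) * F (v \<circ> \<sigma> \<circ> \<tau>)))"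
    by (intro sum.cong refl) (use assms in \<open>simp add: sign_compose
        permutes_imp_permutation[of "{..<n}"] comp_assoc\<close>)
  finally have "altsum n F v = of_int (sign \<tau>) * altsum n (\<lambda>w. F (w \<circ> \<tau>)) v"
    by (simp add: altsum_def sum_distrib_left)
  then show ?thesis by (simp flip: of_int_mult mult.assoc)
qed

lemma altsum_swap:
  assumes "i < n" "j < n" "i \<noteq> j"
  shows "altsum n F (v \<circ> Transposition.transpose i j) = - altsum n F v"
  using altsum_permute[OF permutes_swap_id[of i "{..<n}" j], of F v] assms
  by (simp add: sign_swap_id)

lemma insert_at_Suc:
  "insert_at (Suc l) q v = insert_at l q v \<circ> Transposition.transpose l (Suc l)"
proof
  fix j
  consider "j < l" | "j = l" | "j = Suc l" | "j > Suc l" by linarith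
  then show "insert_at (Suc l) q v j = (insert_at l q v \<circ> Transposition.transpose l (Suc l)) j"
    by cases (auto simp: insert_at_def Transposition.transpose_def)
qed

text \<open>Each increase of the position \<open>l\<close> is one adjacent transposition. Only the
  swap rule is assumed, so that alternating forms and \<open>altsum\<close> both qualify.\<close>

lemma insert_at_sign:
  fixes \<alpha> :: "(nat \<Rightarrow> 'v) \<Rightarrow> real"
  assumes "\<And>v i j. i < n \<Longrightarrow> j < n \<Longrightarrow> i \<noteq> j \<Longrightarrow> \<alpha> (v \<circ> Transposition.transpose i j) = - \<alpha> v"
    and "l < n"
  shows "\<alpha> (insert_at l q v) = (-1) ^ l * \<alpha> (case_nat q v)"
  using assms(2)
proof (induction l)
  case 0
  then show ?case by (simp add: insert_at_0)
next
  case (Suc l)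
  then show ?case
    using assms(1)[of l "Suc l" "insert_at l q v"] by (simp add: insert_at_Suc del: comp_apply)
qed

lemma insert_at_omit: "insert_at i (v i) (omit i v) = v"
  by (auto simp: insert_at_def omit_def fun_eq_iff)

text \<open>Laplace expansion according to the vector that fills slot 0. Every permutation of n + 1
  letters is uniquely a transposition of 0 and b composed with a permutation fixing 0, and the
  latter are the permutations of n letters shifted by one.\<close>

lemma altsum_Suc:
  "altsum (Suc n) F v =
     (\<Sum>i\<le>n. (-1) ^ i * altsum n (\<lambda>w. F (case_nat (v i) w)) (omit i v))"
proof -
  have ins: "{..<Suc n} = insert 0 (Suc ` {..<n})"
    by (simp add: lessThan_Suc_eq_insert_0)
  have bij: "bij_betw (map_permutation {..<n} Suc) {\<tau>. \<tau> permutes {..<n}} {q. q permutes Suc ` {..<n}}"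
  proof (rule bij_betw_byWitness[where f' = "map_permutation (Suc ` {..<n}) (\<lambda>k. k - 1)"])
    have b1: "bij_betw Suc {..<n} (Suc ` {..<n})" by (auto simp: bij_betw_def)
    have b2: "bij_betw (\<lambda>k. k - 1) (Suc ` {..<n}) {..<n}"
      by (rule bij_betw_byWitness[where f' = Suc]) auto
    show "\<forall>a\<in>{\<tau>. \<tau> permutes {..<n}}. map_permutation (Suc ` {..<n}) (\<lambda>k. k - 1) (map_permutation {..<n} Suc a) = a"
      using map_permutation_compose_inv[OF b1] by auto
    show "\<forall>a'\<in>{q. q permutes Suc ` {..<n}}. map_permutation {..<n} Suc (map_permutation (Suc ` {..<n}) (\<lambda>k. k - 1) a') = a'"
      using map_permutation_compose_inv[OF b2, where g = Suc] by fastforce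
    show "map_permutation {..<n} Suc ` {\<tau>. \<tau> permutes {..<n}} \<subseteq> {q. q permutes Suc ` {..<n}}"
      using map_permutation_permutes[OF b1] by auto
    show "map_permutation (Suc ` {..<n}) (\<lambda>k. k - 1) ` {q. q permutes Suc ` {..<n}} \<subseteq> {\<tau>. \<tau> permutes {..<n}}"
      using map_permutation_permutes[OF b2] by auto
  qed
  have lift: "(v \<circ> (Transposition.transpose 0 b \<circ> map_permutation {..<n} Suc \<tau>))
      = case_nat (v b) ((\<lambda>j. (v \<circ> Transposition.transpose 0 b) (Suc j)) \<circ> \<tau>)" if "\<tau> permutes {..<n}" for b \<tau>
  proof
    fix j
    have "map_permutation {..<n} Suc \<tau> 0 = 0"
      by (simp add: map_permutation_def restrict_id_def)
    moreover have "map_permutation {..<n} Suc \<tau> (Suc m) = Suc (\<tau> m)" for m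
      using that by (cases "m < n")
        (auto simp: map_permutation_apply map_permutation_def restrict_id_def permutes_not_in)
    ultimately show "(v \<circ> (Transposition.transpose 0 b \<circ> map_permutation {..<n} Suc \<tau>)) j
      = case_nat (v b) ((\<lambda>j. (v \<circ> Transposition.transpose 0 b) (Suc j)) \<circ> \<tau>) j"
      by (cases j) auto
  qed
  have inner: "(\<Sum>q | q permutes Suc ` {..<n}. of_int (sign (Transposition.transpose 0 b \<circ> q)) * F (v \<circ> (Transposition.transpose 0 b \<circ> q)))
      = of_int (sign (Transposition.transpose 0 b)) * altsum n (\<lambda>w. F (case_nat (v b) w)) (\<lambda>j. (v \<circ> Transposition.transpose 0 b) (Suc j))"
    for b
  proof -
    have "(\<Sum>q | q permutes Suc ` {..<n}. of_int (sign (Transposition.transpose 0 b \<circ> q)) * F (v \<circ> (Transposition.transpose 0 b \<circ> q)))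
      = (\<Sum>\<tau> | \<tau> permutes {..<n}. of_int (sign (Transposition.transpose 0 b \<circ> map_permutation {..<n} Suc \<tau>))
            * F (v \<circ> (Transposition.transpose 0 b \<circ> map_permutation {..<n} Suc \<tau>)))"
      using sum.reindex_bij_betw[OF bij, of "\<lambda>q. of_int (sign (Transposition.transpose 0 b \<circ> q)) * F (v \<circ> (Transposition.transpose 0 b \<circ> q))"]
      by simp
    also have "\<dots> = (\<Sum>\<tau> | \<tau> permutes {..<n}. of_int (sign (Transposition.transpose 0 b)) *
        (of_int (sign \<tau>) * F (case_nat (v b) ((\<lambda>j. (v \<circ> Transposition.transpose 0 b) (Suc j)) \<circ> \<tau>))))"
    proof (intro sum.cong refl)
      fix \<tau> assume "\<tau> \<in> {\<tau>. \<tau> permutes {..<n}}"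
      then have t: "\<tau> permutes {..<n}" by simp
      have "map_permutation {..<n} Suc \<tau> permutes Suc ` {..<n}"
        by (rule map_permutation_permutes[OF _ t]) (auto simp: bij_betw_def)
      then have "permutation (map_permutation {..<n} Suc \<tau>)"
        by (rule permutes_imp_permutation[rotated]) auto
      then have "sign (Transposition.transpose 0 b \<circ> map_permutation {..<n} Suc \<tau>) = sign (Transposition.transpose 0 b) * sign \<tau>"
        using t by (simp add: sign_compose permutation_swap_id sign_map_permutation)
      then show "of_int (sign (Transposition.transpose 0 b \<circ> map_permutation {..<n} Suc \<tau>))
            * F (v \<circ> (Transposition.transpose 0 b \<circ> map_permutation {..<n} Suc \<tau>)) = of_int (sign (Transposition.transpose 0 b)) *
        (of_int (sign \<tau>) * F (case_nat (v b) ((\<lambda>j. (v \<circ> Transposition.transpose 0 b) (Suc j)) \<circ> \<tau>)))"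
        by (simp add: lift[OF t])
    qed
    finally show ?thesis by (simp add: altsum_def sum_distrib_left)
  qed
  \<comment> \<open>After the transposition \<open>v 0\<close> stands at position b - 1 of the
    remaining list and has to return to its front. These b - 1 swaps and the sign of the
    transposition itself give (-1)^b.\<close>
  have fin: "of_int (sign (Transposition.transpose 0 b)) * altsum n G (\<lambda>j. (v \<circ> Transposition.transpose 0 b) (Suc j))
      = (-1) ^ b * altsum n G (omit b v)" if "b \<in> {..<Suc n}" for b and G :: "(nat \<Rightarrow> 'a) \<Rightarrow> real"
  proof (cases b)
    case 0
    then show ?thesis by (simp add: omit_0 comp_def sign_swap_id)
  next
    case (Suc l)
    then have l: "l < n" using that by simp
    have "(\<lambda>j. (v \<circ> Transposition.transpose 0 b) (Suc j)) = insert_at l (v 0) (\<lambda>j. omit l (v \<circ> Suc) j)"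
      by (auto simp: Suc fun_eq_iff insert_at_def omit_def Transposition.transpose_def)
    moreover have "altsum n G (insert_at l (v 0) (omit l (v \<circ> Suc)))
        = (-1) ^ l * altsum n G (case_nat (v 0) (omit l (v \<circ> Suc)))"
      by (rule insert_at_sign[OF altsum_swap l])
    ultimately show ?thesis
      by (simp add: Suc omit_Suc sign_swap_id)
  qed
  have "altsum (Suc n) F v = (\<Sum>b\<in>{..<Suc n}. \<Sum>q | q permutes Suc ` {..<n}.
      of_int (sign (Transposition.transpose 0 b \<circ> q)) * F (v \<circ> (Transposition.transpose 0 b \<circ> q)))"
    unfolding altsum_def ins by (subst sum_over_permutations_insert) auto
  also have "\<dots> = (\<Sum>b\<in>{..<Suc n}. (-1) ^ b * altsum n (\<lambda>w. F (case_nat (v b) w)) (omit b v))"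
    by (intro sum.cong refl) (simp only: inner fin)
  finally show ?thesis by (simp add: lessThan_Suc_atMost)
qed

lemma alternating_imp_multilinear: "alternating_form k \<alpha> \<Longrightarrow> multilinear_form k \<alpha>"
  by (simp add: alternating_form_def multilinear_form_def)

lemma multilinear_form_cong: "multilinear_form k \<alpha> \<Longrightarrow> (\<And>i. i < k \<Longrightarrow> v i = w i) \<Longrightarrow> \<alpha> v = \<alpha> w"
  by (simp add: multilinear_form_def)

lemma multilinear_form_linear: "multilinear_form k \<alpha> \<Longrightarrow> i < k \<Longrightarrow> linear (\<lambda>x. \<alpha> (v(i := x)))"
  by (simp add: multilinear_form_def)

lemma alternating_form_eq_0:
  "alternating_form k \<alpha> \<Longrightarrow> i < k \<Longrightarrow> j < k \<Longrightarrow> i \<noteq> j \<Longrightarrow> v i = v j \<Longrightarrow> \<alpha> v = 0"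
  unfolding alternating_form_def by (metis linorder_neqE_nat)

lemma alternating_form_altsum:
  assumes "multilinear_form n F"
  shows "alternating_form n (altsum n F)"
  unfolding alternating_form_def
proof (intro conjI allI impI)
  fix v w :: "nat \<Rightarrow> 'a" assume "\<forall>i<n. v i = w i"
  then show "altsum n F v = altsum n F w"
    unfolding altsum_def
    by (intro sum.cong refl arg_cong2[where f = "(*)"] multilinear_form_cong[OF assms])
      (metis comp_apply lessThan_iff mem_Collect_eq permutes_in_image)
next
  fix v :: "nat \<Rightarrow> 'a" and i assume i: "i < n"
  \<comment> \<open>The vector in place \<open>i\<close> is read by \<open>F\<close> in slot
    \<open>inv \<sigma> i\<close>.\<close>
  have "linear (\<lambda>x. of_int (sign \<sigma>) * F (v(i := x) \<circ> \<sigma>))" if "\<sigma> permutes {..<n}" for \<sigma>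
  proof -
    have "v(i := x) \<circ> \<sigma> = (v \<circ> \<sigma>)(inv \<sigma> i := x)" for x
      using that by (auto simp: fun_eq_iff permutes_inverses)
    moreover have "inv \<sigma> i < n"
      using that i permutes_inv[OF that] by (metis lessThan_iff permutes_in_image)
    ultimately show ?thesis
      using multilinear_form_linear[OF assms, of "inv \<sigma> i" "v \<circ> \<sigma>"]
      by (simp add: linear_iff algebra_simps)
  qed
  then show "linear (\<lambda>x. altsum n F (v(i := x)))"
    unfolding altsum_def by (intro linear_compose_sum) auto
next
  fix v :: "nat \<Rightarrow> 'a" and i j assume "i < j" "j < n" "v i = v j"
  then have "v \<circ> Transposition.transpose i j = v" by (auto simp: Transposition.transpose_def fun_eq_iff)
  then show "altsum n F v = 0"
    using altsum_swap[of i n j F v] \<open>i < j\<close> \<open>j < n\<close> by simp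
qed

text \<open>Polarisation: \<open>alternating_form\<close> only asks for vanishing on equal
  arguments, and evaluating at the sum of two vectors in both slots yields the sign.\<close>

lemma alternating_form_swap:
  assumes a: "alternating_form k \<alpha>" and ij: "i < k" "j < k" "i \<noteq> j"
  shows "\<alpha> (v \<circ> Transposition.transpose i j) = - \<alpha> v"
proof -
  define B where "B x y = \<alpha> (v(i := x, j := y))" for x y
  have m: "multilinear_form k \<alpha>" by (rule alternating_imp_multilinear[OF a])
  have l1: "linear (\<lambda>x. B x y)" for y
    using multilinear_form_linear[OF m ij(1), of "v(j := y)"] ij(3) by (simp add: B_def fun_upd_twist)
  have l2: "linear (\<lambda>y. B x y)" for x
    using multilinear_form_linear[OF m ij(2), of "v(i := x)"] by (simp add: B_def)
  have z: "B x x = 0" for x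
    unfolding B_def by (rule alternating_form_eq_0[OF a ij]) (use ij in auto)
  have "B (v i + v j) (v i + v j) = B (v i) (v j) + B (v j) (v i)"
    using linear_add[OF l1] linear_add[OF l2] z[of "v i"] z[of "v j"] by simp
  then have "B (v j) (v i) = - B (v i) (v j)" using z[of "v i + v j"] by linarith
  moreover have "v \<circ> Transposition.transpose i j = v(i := v j, j := v i)" "v = v(i := v i, j := v j)"
    using ij by (auto simp: fun_eq_iff Transposition.transpose_def)
  ultimately show ?thesis by (metis B_def)
qed

lemma alternating_form_permute:
  assumes a: "alternating_form k \<alpha>" and "\<sigma> permutes {..<k}"
  shows "\<alpha> (v \<circ> \<sigma>) = of_int (sign \<sigma>) * \<alpha> v"
  using finite_lessThan assms(2)
proof (induction rule: permutes_rev_induct)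
  case id
  then show ?case by simp
next
  case (swap i j p)
  then have "sign (p \<circ> Transposition.transpose i j) = - sign p"
    by (simp add: sign_compose permutation_swap_id permutes_imp_permutation[of "{..<k}"] sign_swap_id)
  moreover have "\<alpha> (v \<circ> p \<circ> Transposition.transpose i j) = - \<alpha> (v \<circ> p)"
    using swap by (intro alternating_form_swap[OF a]) auto
  ultimately show ?case using swap.IH by (simp add: comp_assoc del: comp_apply)
qed

lemma altsum_alternating:
  assumes "alternating_form k \<alpha>"
  shows "altsum k \<alpha> v = fact k * \<alpha> v"
proof -
  have "altsum k \<alpha> v = (\<Sum>\<sigma> | \<sigma> permutes {..<k}. \<alpha> v)"
    unfolding altsum_def
    by (intro sum.cong refl) (simp add: alternating_form_permute[OF assms] flip: mult.assoc of_int_mult)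
  then show ?thesis by (simp add: card_permutations[OF refl])
qed

lemma alternating_form_move:
  assumes "alternating_form k \<alpha>" "i < k"
  shows "\<alpha> (case_nat (v i) (omit i v)) = (-1) ^ i * \<alpha> v"
  using insert_at_sign[of k \<alpha> i "v i" "omit i v", OF alternating_form_swap[OF assms(1)] assms(2)]
  by (simp add: insert_at_omit flip: power_add mult.assoc mult_2)

section \<open>Powers of a two-form\<close>

abbreviation om_power :: "('v::real_vector \<Rightarrow> 'v \<Rightarrow> real) \<Rightarrow> nat \<Rightarrow> (nat \<Rightarrow> 'v) \<Rightarrow> real" where
  "om_power om k \<equiv> two_form_power (\<lambda>v. om (v 0) (v 1)) k"

text \<open>The denominator is \<open>fact 2 * fact (2 * k)\<close> from the normalisation of
  \<open>wedge\<close>.\<close>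

lemma om_power_Suc_altsum:
  "om_power om (Suc k) v =
     altsum (2 * k + 2) (\<lambda>w. om (w 0) (w 1) * om_power om k (\<lambda>i. w (Suc (Suc i)))) v / (2 * fact (2 * k))"
  by (simp add: wedge_def altsum_def mult_ac numeral_2_eq_2)

lemma multilinear_om_shift:
  assumes "bilinear om" "multilinear_form n T"
  shows "multilinear_form (n + 2) (\<lambda>w. om (w 0) (w 1) * T (\<lambda>i. w (Suc (Suc i))))"
  unfolding multilinear_form_def
proof (intro conjI allI impI)
  fix v w :: "nat \<Rightarrow> 'a" assume "\<forall>i<n + 2. v i = w i"
  then show "om (v 0) (v 1) * T (\<lambda>i. v (Suc (Suc i))) = om (w 0) (w 1) * T (\<lambda>i. w (Suc (Suc i)))"
    using multilinear_form_cong[OF assms(2), of "\<lambda>i. v (Suc (Suc i))" "\<lambda>i. w (Suc (Suc i))"] by simp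
next
  fix v :: "nat \<Rightarrow> 'a" and i assume "i < n + 2"
  then consider "i = 0" | "i = 1" | m where "i = Suc (Suc m)" "m < n"
    by (metis One_nat_def Suc_1 add_2_eq_Suc' less_Suc_eq_0_disj not0_implies_Suc Suc_less_SucD)
  then show "linear (\<lambda>x. om ((v(i := x)) 0) ((v(i := x)) 1) * T (\<lambda>j. (v(i := x)) (Suc (Suc j))))"
  proof cases
    case 1
    then show ?thesis using assms(1) by (auto simp: bilinear_def linear_iff algebra_simps)
  next
    case 2
    then show ?thesis using assms(1) by (auto simp: bilinear_def linear_iff algebra_simps)
  next
    case 3
    have "(\<lambda>j. (v(i := x)) (Suc (Suc j))) = (\<lambda>j. v (Suc (Suc j)))(m := x)" for x
      using 3 by auto
    then show ?thesis
      using 3 multilinear_form_linear[OF assms(2) \<open>m < n\<close>, of "\<lambda>j. v (Suc (Suc j))"]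
      by (auto simp: linear_iff algebra_simps)
  qed
qed

lemma alternating_om_power:
  assumes "bilinear om"
  shows "alternating_form (2 * k) (om_power om k)"
proof (induction k)
  case 0
  then show ?case by (simp add: alternating_form_def)
next
  case (Suc k)
  have a: "alternating_form (2 * k + 2) (altsum (2 * k + 2) (\<lambda>w. om (w 0) (w 1) * om_power om k (\<lambda>i. w (Suc (Suc i)))))"
    by (intro alternating_form_altsum multilinear_om_shift assms alternating_imp_multilinear Suc)
  have "om_power om (Suc k) = (\<lambda>v. altsum (2 * k + 2)
      (\<lambda>w. om (w 0) (w 1) * om_power om k (\<lambda>i. w (Suc (Suc i)))) v / (2 * fact (2 * k)))"
    by (intro ext om_power_Suc_altsum)
  moreover have "alternating_form (2 * k + 2) (\<lambda>v. altsum (2 * k + 2)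
      (\<lambda>w. om (w 0) (w 1) * om_power om k (\<lambda>i. w (Suc (Suc i)))) v / (2 * fact (2 * k)))"
    using a unfolding alternating_form_def by (auto simp: linear_iff add_divide_distrib)
  ultimately show ?case by simp
qed

lemma altsum_shift:
  assumes "alternating_form n T"
  shows "altsum (Suc n) (\<lambda>w. f (w 0) * T (w \<circ> Suc)) v =
    fact n * (\<Sum>i\<le>n. (-1) ^ i * f (v i) * T (omit i v))"
  by (simp add: altsum_Suc altsum_cmult altsum_alternating[OF assms] sum_distrib_left)
    (simp add: mult_ac)

text \<open>Contraction with \<open>v 0\<close> is a derivation: it sends \<omega>^(k+1) to (k+1)
  times the contraction of \<omega>, wedge \<omega>^k. In the recursive definition of the power
  \<open>v 0\<close> may land anywhere, so the induction separates the terms where it meets the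
  first factor from those where it enters the remaining power.\<close>

lemma om_power_Suc_expand:
  fixes om :: "'v::real_vector \<Rightarrow> 'v \<Rightarrow> real"
  assumes bil: "bilinear om" and skew: "\<And>x y. om x y = - om y x"
  shows "om_power om (Suc k) v =
    (real k + 1) * (\<Sum>j\<le>2 * k. (-1) ^ j * om (v 0) (v (Suc j)) * om_power om k (omit j (v \<circ> Suc)))"
proof (induction k arbitrary: v)
  case 0
  have "om_power om (Suc 0) v = (om (v 0) (v 1) - om (v 1) (v 0)) / 2"
    unfolding om_power_Suc_altsum by (simp add: altsum_Suc omit_def numeral_2_eq_2)
  also have "\<dots> = om (v 0) (v 1)" using skew[of "v 1" "v 0"] by simp
  finally show ?case by simp
next
  case (Suc k)
  define T where "T = om_power om"
  define n where "n = 2 * Suc k"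
  define t where "t = v \<circ> Suc"
  have altT: "alternating_form (2 * m) (T m)" for m
    unfolding T_def by (rule alternating_om_power[OF bil])
  have altn: "alternating_form n (T (Suc k))" using altT[of "Suc k"] by (simp add: n_def)
  \<comment> \<open>Up to \<open>fact n\<close> this is the covector \<open>om u\<close> wedge
    \<omega>^(k+1), evaluated on the remaining vectors \<open>t\<close>. Every term below is reduced
    to a multiple of \<open>X (v 0)\<close>.\<close>
  define X where "X u = altsum (Suc n) (\<lambda>w. om u (w 0) * T (Suc k) (w \<circ> Suc)) t" for u
  have X: "X u = fact n * (\<Sum>i\<le>n. (-1) ^ i * om u (t i) * T (Suc k) (omit i t))" for u
    unfolding X_def by (rule altsum_shift[OF altn])
  have "altsum (n + 2) (\<lambda>w. om (w 0) (w 1) * T (Suc k) (\<lambda>i. w (Suc (Suc i)))) v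
     = (\<Sum>i\<le>Suc n. (-1) ^ i * altsum (Suc n) (\<lambda>w. om (v i) (w 0) * T (Suc k) (w \<circ> Suc)) (omit i v))"
    by (simp add: altsum_Suc[of "Suc n"] comp_def)
  also have "\<dots> = X (v 0) - (\<Sum>i\<le>n. (-1) ^ i * altsum (Suc n) (\<lambda>w. om (t i) (w 0) * T (Suc k) (w \<circ> Suc))
       (case_nat (v 0) (omit i t)))"
    by (subst sum.atMost_Suc_shift) (simp add: X_def omit_0 omit_Suc t_def sum_negf)
  \<comment> \<open>Slot 1 is expanded in turn: \<open>v 0\<close> either fills it, which is the
    first summand, or enters the power \<open>T (Suc k)\<close>.\<close>
  also have "\<dots> = X (v 0) - (\<Sum>i\<le>n. (-1) ^ i * (fact n * (om (t i) (v 0) * T (Suc k) (omit i t)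
       - (\<Sum>j\<le>2*k+1. (-1) ^ j * om (t i) (omit i t j) * T (Suc k) (case_nat (v 0) (omit j (omit i t)))))))"
  proof -
    define m where "m = 2 * k + 1"
    have nm: "n = Suc m" by (simp add: n_def m_def)
    have "altsum (Suc n) (\<lambda>w. om (t i) (w 0) * T (Suc k) (w \<circ> Suc)) (case_nat (v 0) (omit i t))
      = fact n * (om (t i) (v 0) * T (Suc k) (omit i t)
       - (\<Sum>j\<le>m. (-1) ^ j * om (t i) (omit i t j) * T (Suc k) (case_nat (v 0) (omit j (omit i t)))))" for i
      unfolding altsum_shift[OF altn]
      unfolding nm by (subst sum.atMost_Suc_shift) (simp add: omit_0 omit_Suc sum_negf)
    then show ?thesis unfolding m_def by presburger
  qed
  \<comment> \<open>By skew symmetry the terms in which \<open>v 0\<close> fills slot 1 add up to a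
    second copy of \<open>X (v 0)\<close>.\<close>
  also have "\<dots> = 2 * X (v 0) + fact n * (\<Sum>i\<le>n. \<Sum>j\<le>2*k+1. (-1) ^ i * ((-1) ^ j * om (t i) (omit i t j)
       * T (Suc k) (case_nat (v 0) (omit j (omit i t)))))"
  proof -
    have "om (t i) (v 0) = - om (v 0) (t i)" for i by (rule skew)
    then show ?thesis unfolding X
      by (simp add: sum_distrib_left algebra_simps sum.distrib sum_subtractf sum_negf)
  qed
  \<comment> \<open>The induction hypothesis extracts \<open>v 0\<close> from the power.\<close>
  also have "(\<Sum>i\<le>n. \<Sum>j\<le>2*k+1. (-1) ^ i * ((-1) ^ j * om (t i) (omit i t j)
       * T (Suc k) (case_nat (v 0) (omit j (omit i t)))))
      = (real k + 1) / fact (2 * k) * (\<Sum>i\<le>n. \<Sum>j\<le>2*k+1. (-1) ^ i * ((-1) ^ j * om (t i) (omit i t j)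
       * altsum (2 * k + 1) (\<lambda>w. om (v 0) (w 0) * T k (w \<circ> Suc)) (omit j (omit i t))))"
  proof -
    have "T (Suc k) (case_nat (v 0) s) = (real k + 1) / fact (2 * k) *
        altsum (2 * k + 1) (\<lambda>w. om (v 0) (w 0) * T k (w \<circ> Suc)) s" for s
      using Suc.IH[of "case_nat (v 0) s"] altsum_shift[OF altT[of k], of "om (v 0)" s]
      by (simp add: T_def)
    then show ?thesis unfolding sum_distrib_left by (intro sum.cong refl) (simp add: mult_ac)
  qed
  also have "(\<Sum>i\<le>n. \<Sum>j\<le>2*k+1. (-1) ^ i * ((-1) ^ j * om (t i) (omit i t j)
       * altsum (2 * k + 1) (\<lambda>w. om (v 0) (w 0) * T k (w \<circ> Suc)) (omit j (omit i t))))
     = altsum (Suc n) (\<lambda>w. om (w 0) (w 1) * (om (v 0) (w 2) * T k (\<lambda>i. w (Suc (Suc (Suc i)))))) t"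
  proof -
    define m where "m = 2 * k + 1"
    have nm: "n = Suc m" by (simp add: n_def m_def)
    show ?thesis unfolding nm m_def[symmetric]
      by (simp only: altsum_Suc[of "Suc m"] altsum_Suc[of m])
        (simp add: sum_distrib_left altsum_cmult numeral_2_eq_2 comp_def mult.assoc)
  qed
  \<comment> \<open>A 3-cycle of the slots, an even permutation, brings the covector
    \<open>om (v 0)\<close> to the front. What remains behind it is again the \<open>altsum\<close>
    defining \<omega>^(k+1).\<close>
  also have "\<dots> = altsum (Suc n) (\<lambda>w. om (v 0) (w 0) * (om (w 1) (w 2) * T k (\<lambda>i. w (Suc (Suc (Suc i)))))) t"
  proof -
    define \<tau> where "\<tau> = Transposition.transpose 1 2 \<circ> Transposition.transpose 0 (1::nat)"
    have "\<tau> permutes {..<Suc n}"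
      unfolding \<tau>_def by (intro permutes_compose permutes_swap_id) (auto simp: n_def)
    moreover have "sign \<tau> = 1"
      by (simp add: \<tau>_def sign_compose permutation_swap_id sign_swap_id)
    moreover have "\<tau> 0 = 2" "\<tau> 1 = 0" "\<tau> 2 = 1" "\<tau> (Suc (Suc (Suc i))) = Suc (Suc (Suc i))" for i
      by (auto simp: \<tau>_def Transposition.transpose_def)
    ultimately show ?thesis
      using altsum_permute_arg[of \<tau> "Suc n"
          "\<lambda>w. om (v 0) (w 0) * (om (w 1) (w 2) * T k (\<lambda>i. w (Suc (Suc (Suc i)))))" t]
      by (simp add: mult_ac)
  qed
  also have "\<dots> = X (v 0) * (2 * fact (2 * k)) / fact n"
  proof -
    have T': "T (Suc k) w = altsum n (\<lambda>w. om (w 0) (w 1) * T k (\<lambda>i. w (Suc (Suc i)))) w / (2 * fact (2 * k))" for w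
      unfolding T_def n_def by (simp only: om_power_Suc_altsum) simp
    have "X (v 0) = fact n * (\<Sum>i\<le>n. (-1) ^ i * om (v 0) (t i) *
         (altsum n (\<lambda>w. om (w 0) (w 1) * T k (\<lambda>i. w (Suc (Suc i)))) (omit i t) / (2 * fact (2 * k))))"
      by (simp only: X T')
    also have "\<dots> = fact n / (2 * fact (2 * k)) *
        altsum (Suc n) (\<lambda>w. om (v 0) (w 0) * (om (w 1) (w 2) * T k (\<lambda>i. w (Suc (Suc (Suc i)))))) t"
      by (simp add: altsum_Suc[of n] altsum_cmult sum_distrib_left numeral_2_eq_2 mult_ac)
    finally show ?thesis by simp
  qed
  finally have *: "altsum (n + 2) (\<lambda>w. om (w 0) (w 1) * T (Suc k) (\<lambda>i. w (Suc (Suc i)))) v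
    = 2 * X (v 0) + fact n * ((real k + 1) / fact (2 * k) * (X (v 0) * (2 * fact (2 * k)) / fact n))" .
  \<comment> \<open>Two copies from the first factor and 2 (k+1) copies from the remaining power
    make 2 (k+2).\<close>
  have "\<dots> = 2 * (real (Suc k) + 1) * X (v 0)"
    by (simp add: field_simps)
  with * have v: "altsum (n + 2) (\<lambda>w. om (w 0) (w 1) * T (Suc k) (\<lambda>i. w (Suc (Suc i)))) v
      = 2 * ((real (Suc k) + 1) * X (v 0))"
    by (simp only: mult.assoc)
  have "om_power om (Suc (Suc k)) v =
      altsum (n + 2) (\<lambda>w. om (w 0) (w 1) * T (Suc k) (\<lambda>i. w (Suc (Suc i)))) v / (2 * fact n)"
    unfolding om_power_Suc_altsum[of om "Suc k"] T_def n_def ..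
  also have "\<dots> = (real (Suc k) + 1) * X (v 0) / fact n"
    unfolding v by (rule mult_divide_mult_cancel_left) simp
  also have "X (v 0) = fact n * (\<Sum>j\<le>2 * Suc k. (-1) ^ j * om (v 0) (v (Suc j)) *
      om_power om (Suc k) (omit j (v \<circ> Suc)))"
    by (simp only: X T_def t_def comp_apply n_def)
  finally show ?case by (simp only: times_divide_eq_right mult.left_commute[of _ "fact n"]
        nonzero_mult_div_cancel_left[OF fact_nonzero])
qed

section \<open>Contraction with the inverse of a symplectic form\<close>

lemma linear_case_nat:
  assumes "multilinear_form k \<alpha>" "0 < k"
  shows "linear (\<lambda>x. \<alpha> (case_nat x w))"
proof -
  have eq: "case_nat x w = (case_nat 0 w)(0 := x)" for x
    by (auto simp: fun_eq_iff split: nat.split)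
  then show ?thesis using multilinear_form_linear[OF assms, of "case_nat 0 w"] by (subst eq)
qed

lemma linear_case_nat_1:
  assumes "multilinear_form k \<alpha>" "1 < k"
  shows "linear (\<lambda>x. \<alpha> (case_nat a (case_nat x w)))"
proof -
  have eq: "case_nat a (case_nat x w) = (case_nat a (case_nat 0 w))(1 := x)" for x
  proof
    fix j :: nat
    show "case_nat a (case_nat x w) j = ((case_nat a (case_nat 0 w))(1 := x)) j"
    proof (cases j)
      case (Suc m)
      then show ?thesis by (cases m) auto
    qed simp
  qed
  then show ?thesis using multilinear_form_linear[OF assms, of "case_nat a (case_nat 0 w)"] by (subst eq)
qed

text \<open>A linear \<open>sharp\<close> of this kind encodes nondegeneracy, and it is at the same
  time the bivector inverse to \<open>om\<close>, the Euclidean product identifying covectors with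
  vectors.\<close>

locale symplectic =
  fixes om :: "'v::euclidean_space \<Rightarrow> 'v \<Rightarrow> real" and sharp :: "'v \<Rightarrow> 'v"
  assumes bil: "bilinear om" and skew: "\<And>x y. om x y = - om y x"
    and linear_sharp: "linear sharp" and sharp: "\<And>b y. om (sharp b) y = b \<bullet> y"
begin

lemma sharp_skew: "sharp a \<bullet> b = - (a \<bullet> sharp b)"
  by (metis inner_commute sharp skew)

lemma nondegenerate: "(\<And>x. om w x = 0) \<Longrightarrow> w = 0"
proof -
  assume z: "\<And>x. om w x = 0"
  have "inj sharp"
    unfolding linear_injective_0[OF linear_sharp]
    by (metis (no_types) bil bilinear_lzero inner_eq_zero_iff sharp)
  then obtain b where "w = sharp b"
    using linear_injective_imp_surjective[OF linear_sharp] by blast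
  with z[of b] have "b = 0" by (simp add: sharp)
  with \<open>w = sharp b\<close> show "w = 0" by (simp add: linear_0[OF linear_sharp])
qed

text \<open>Pairing the left side with x under \<open>om\<close> gives \<open>om x y\<close>; the
  sign is skew symmetry, and nondegeneracy concludes.\<close>

lemma sum_sharp: "(\<Sum>b\<in>Basis. om b y *\<^sub>R sharp b) = - y"
proof -
  have "om ((\<Sum>b\<in>Basis. om b y *\<^sub>R sharp b) + y) x = 0" for x
  proof -
    have lin1: "linear (\<lambda>z. om z x)" for x using bil by (simp add: bilinear_def)
    have "om (\<Sum>b\<in>Basis. om b y *\<^sub>R sharp b) x = (\<Sum>b\<in>Basis. om b y * (b \<bullet> x))"
      by (simp add: linear_sum[OF lin1] linear_scale[OF lin1] sharp)
    also have "\<dots> = om (\<Sum>b\<in>Basis. (x \<bullet> b) *\<^sub>R b) y"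
      by (simp add: linear_sum[OF lin1] linear_scale[OF lin1] inner_commute mult.commute)
    finally show ?thesis
      using skew[of x y] by (simp add: linear_add[OF lin1] euclidean_representation)
  qed
  then show ?thesis using nondegenerate by (simp add: eq_neg_iff_add_eq_0)
qed

text \<open>The Lefschetz identity for contraction with the inverse bivector. The pairing of
  \<open>b\<close> with \<open>sharp b\<close> contributes minus the dimension, and each of the 2k
  remaining vectors contributes 1, since \<open>sum_sharp\<close> puts it back into its
  place.\<close>

lemma om_power_contract:
  "(\<Sum>b\<in>Basis. om_power om (Suc k) (case_nat b (case_nat (sharp b) v))) =
     - (real k + 1) * (DIM('v) - 2 * real k) * om_power om k v"
proof -
  define T where "T = om_power om"
  have altT: "alternating_form (2 * k) (T k)" unfolding T_def by (rule alternating_om_power[OF bil])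
  have "T (Suc k) (case_nat b (case_nat (sharp b) v)) = (real k + 1) *
      (om b (sharp b) * T k v - (\<Sum>j<2 * k. (-1) ^ j * (om b (v j) * T k (case_nat (sharp b) (omit j v)))))" for b
    unfolding T_def om_power_Suc_expand[OF bil skew] sum.atMost_shift
    by (simp add: omit_0 omit_Suc sum_negf mult.assoc)
  then have "(\<Sum>b\<in>Basis. T (Suc k) (case_nat b (case_nat (sharp b) v))) = (real k + 1) *
     ((\<Sum>b\<in>Basis. om b (sharp b)) * T k v - (\<Sum>j<2 * k. (-1) ^ j *
        (\<Sum>b\<in>Basis. om b (v j) * T k (case_nat (sharp b) (omit j v)))))"
    by (simp add: sum_subtractf sum_distrib_right sum_distrib_left[of "(-1) ^ _" _ Basis]
        sum.swap[of _ "{..<2 * k}" Basis] flip: sum_distrib_left[of "real k + 1"])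
  also have "(\<Sum>b\<in>Basis. om b (sharp b)) = - DIM('v)"
  proof -
    have "om b (sharp b) = - (b \<bullet> b)" for b by (metis sharp skew)
    then have "(\<Sum>b\<in>Basis. om b (sharp b)) = (\<Sum>b\<in>(Basis::'v set). - 1)"
      by (intro sum.cong) auto
    then show ?thesis by simp
  qed
  also have "(\<Sum>j<2 * k. (-1) ^ j * (\<Sum>b\<in>Basis. om b (v j) * T k (case_nat (sharp b) (omit j v))))
     = (\<Sum>j<2 * k. - T k v)"
  proof (intro sum.cong refl)
    fix j assume "j \<in> {..<2 * k}"
    then have j: "j < 2 * k" by simp
    have lin: "linear (\<lambda>x. T k (case_nat x (omit j v)))"
      by (rule linear_case_nat[OF alternating_imp_multilinear[OF altT]]) (use j in auto)
    have "(\<Sum>b\<in>Basis. om b (v j) * T k (case_nat (sharp b) (omit j v))) = T k (case_nat (- v j) (omit j v))"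
      unfolding sum_sharp[symmetric] by (simp add: linear_sum[OF lin] linear_scale[OF lin])
    also have "\<dots> = - T k (case_nat (v j) (omit j v))"
      by (simp add: linear_neg[OF lin])
    finally show "(-1) ^ j * (\<Sum>b\<in>Basis. om b (v j) * T k (case_nat (sharp b) (omit j v))) = - T k v"
      by (simp add: alternating_form_move[OF altT j] flip: power_add mult_2 mult.assoc)
  qed
  finally show ?thesis by (simp add: T_def algebra_simps)
qed

text \<open>The factor in \<open>om_power_contract\<close> is nonzero as long as 2k is below the
  dimension, so a vanishing next power would force the previous one to vanish.\<close>

lemma om_power_nonzero: "2 * k \<le> DIM('v) \<Longrightarrow> \<exists>v. om_power om k v \<noteq> 0"
proof (induction k)
  case (Suc k)
  then obtain v where "om_power om k v \<noteq> 0" by auto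
  then have "(\<Sum>b\<in>Basis. om_power om (Suc k) (case_nat b (case_nat (sharp b) v))) \<noteq> 0"
    unfolding om_power_contract using Suc.prems by auto
  then show ?case by (metis (no_types, lifting) sum.neutral)
qed auto

end

section \<open>Forms of top degree\<close>

lemma alternating_form_dependent:
  assumes a: "alternating_form k \<alpha>" and i: "i < k" "v i \<in> span (v ` ({..<k} - {i}))"
  shows "\<alpha> v = 0"
proof -
  have "linear (\<lambda>x. \<alpha> (v(i := x)))"
    using alternating_imp_multilinear[OF a] i(1) by (rule multilinear_form_linear)
  moreover have "\<alpha> (v(i := x)) = 0" if "x \<in> v ` ({..<k} - {i})" for x
  proof -
    from that obtain m where "m < k" "m \<noteq> i" "x = v m" by auto
    then show ?thesis by (intro alternating_form_eq_0[OF a, of m i]) (auto simp: i(1))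
  qed
  ultimately have "\<alpha> (v(i := v i)) = 0"
    using linear_eq_0_on_span[of "\<lambda>x. \<alpha> (v(i := x))", OF _ _ i(2)] by blast
  then show ?thesis by simp
qed

lemma alternating_form_degree_gt_dim:
  fixes v :: "nat \<Rightarrow> 'v::euclidean_space"
  assumes a: "alternating_form k \<alpha>" and k: "DIM('v) < k"
  shows "\<alpha> v = 0"
proof (cases "inj_on v {..<k}")
  case False
  then show ?thesis by (auto simp: inj_on_def intro: alternating_form_eq_0[OF a])
next
  case True
  have "dependent (v ` {..<k})"
    using independent_bound[of "v ` {..<k}"] k card_image[OF True] by auto
  then obtain i where i: "i < k" "v i \<in> span (v ` {..<k} - {v i})"
    by (auto simp: dependent_def)
  moreover have "v ` {..<k} - {v i} = v ` ({..<k} - {i})"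
    using True i(1) by (auto simp: inj_on_def)
  ultimately show ?thesis using alternating_form_dependent[OF a] by metis
qed

text \<open>Up to a factor this is \<open>f\<close> wedge \<open>\<alpha>\<close>, whose degree
  exceeds the dimension. It serves as Cramer's rule for exchanging vectors inside a volume
  form.\<close>

lemma covector_wedge_top:
  fixes v :: "nat \<Rightarrow> 'v::euclidean_space"
  assumes a: "alternating_form DIM('v) \<alpha>" and l: "linear f"
  shows "(\<Sum>i\<le>DIM('v). (-1) ^ i * f (v i) * \<alpha> (omit i v)) = 0"
proof -
  have "multilinear_form (Suc DIM('v)) (\<lambda>w. f (w 0) * \<alpha> (w \<circ> Suc))"
    unfolding multilinear_form_def
  proof (intro conjI allI impI)
    fix v w :: "nat \<Rightarrow> 'v" assume "\<forall>i<Suc DIM('v). v i = w i"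
    then show "f (v 0) * \<alpha> (v \<circ> Suc) = f (w 0) * \<alpha> (w \<circ> Suc)"
      using multilinear_form_cong[OF alternating_imp_multilinear[OF a], of "v \<circ> Suc" "w \<circ> Suc"] by simp
  next
    fix v :: "nat \<Rightarrow> 'v" and i assume i: "i < Suc DIM('v)"
    show "linear (\<lambda>x. f ((v(i := x)) 0) * \<alpha> (v(i := x) \<circ> Suc))"
    proof (cases i)
      case 0
      then have "v(i := x) \<circ> Suc = v \<circ> Suc" for x by auto
      then show ?thesis using l 0 by (simp add: linear_iff algebra_simps)
    next
      case (Suc m)
      have "v(i := x) \<circ> Suc = (v \<circ> Suc)(m := x)" for x by (auto simp: Suc)
      then show ?thesis
        using multilinear_form_linear[OF alternating_imp_multilinear[OF a], of m "v \<circ> Suc"] i Suc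
        by (simp add: linear_iff algebra_simps)
    qed
  qed
  then have "altsum (Suc DIM('v)) (\<lambda>w. f (w 0) * \<alpha> (w \<circ> Suc)) v = 0"
    by (intro alternating_form_degree_gt_dim[OF alternating_form_altsum]) auto
  then show ?thesis by (simp add: altsum_shift[OF a])
qed

lemma top_form_eq_0:
  fixes \<alpha> :: "(nat \<Rightarrow> 'v::euclidean_space) \<Rightarrow> real"
  assumes a: "alternating_form DIM('v) \<alpha>" and e: "bij_betw e {..<DIM('v)} B" "span B = UNIV"
    and z: "\<alpha> e = 0"
  shows "\<alpha> v = 0"
proof -
  \<comment> \<open>\<open>m\<close> counts the leading arguments that are arbitrary; the others
    come from the basis. For m = 0 either an argument repeats or the list is a permutation of
    \<open>e\<close>.\<close>
  have "\<forall>v. (\<forall>i. m \<le> i \<longrightarrow> i < DIM('v) \<longrightarrow> v i \<in> B) \<longrightarrow> \<alpha> v = 0" if "m \<le> DIM('v)" for m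
    using that
  proof (induction m)
    case 0
    show ?case
    proof (intro allI impI)
      fix v :: "nat \<Rightarrow> 'v" assume "\<forall>i. 0 \<le> i \<longrightarrow> i < DIM('v) \<longrightarrow> v i \<in> B"
      then have vB: "v i \<in> B" if "i < DIM('v)" for i using that by auto
      show "\<alpha> v = 0"
      proof (cases "inj_on v {..<DIM('v)}")
        case False
        then show ?thesis by (auto simp: inj_on_def intro: alternating_form_eq_0[OF a])
      next
        case True
        define \<sigma> where "\<sigma> i = (if i < DIM('v) then inv_into {..<DIM('v)} e (v i) else i)" for i
        have ev: "e (\<sigma> i) = v i" if "i < DIM('v)" for i
          using that vB e(1) by (auto simp: \<sigma>_def bij_betw_def f_inv_into_f)
        have "\<sigma> permutes {..<DIM('v)}"
        proof (rule inj_imp_permutes)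
          show "inj_on \<sigma> {..<DIM('v)}"
            using True ev by (metis (no_types, opaque_lifting) inj_on_def lessThan_iff)
          show "\<sigma> x \<in> {..<DIM('v)}" if "x \<in> {..<DIM('v)}" for x
            using that vB e(1) inv_into_into[of "v x" e "{..<DIM('v)}"] by (auto simp: \<sigma>_def bij_betw_def)
        qed (auto simp: \<sigma>_def)
        then have "\<alpha> (e \<circ> \<sigma>) = 0" using alternating_form_permute[OF a, of \<sigma> e] z by simp
        moreover have "\<alpha> (e \<circ> \<sigma>) = \<alpha> v"
          by (rule multilinear_form_cong[OF alternating_imp_multilinear[OF a]]) (simp add: ev)
        ultimately show ?thesis by simp
      qed
    qed
  next
    case (Suc m)
    show ?case
    proof (intro allI impI)
      fix v :: "nat \<Rightarrow> 'v" assume v: "\<forall>i. Suc m \<le> i \<longrightarrow> i < DIM('v) \<longrightarrow> v i \<in> B"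
      have lin: "linear (\<lambda>x. \<alpha> (v(m := x)))"
        using Suc.prems by (intro multilinear_form_linear[OF alternating_imp_multilinear[OF a]]) auto
      have "\<alpha> (v(m := x)) = 0" if "x \<in> B" for x
        using Suc v that by auto
      then have "\<alpha> (v(m := v m)) = 0"
        using linear_eq_0_on_span[OF lin, of B "v m"] e(2) by auto
      then show "\<alpha> v = 0" by simp
    qed
  qed
  from this[of "DIM('v)"] show ?thesis by auto
qed

lemma ex_basis_enum: "\<exists>e. bij_betw e {..<DIM('v)} (Basis :: 'v::euclidean_space set)"
  using ex_bij_betw_nat_finite[OF finite_Basis] by (simp add: atLeast0LessThan)

lemma alternating_form_combine:
  assumes "alternating_form k \<alpha>" "alternating_form k \<beta>"
  shows "alternating_form k (\<lambda>v. a * \<alpha> v + b * \<beta> v)"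
  using assms unfolding alternating_form_def linear_iff
  by (auto simp: algebra_simps) metis+

text \<open>The combination \<beta>(e) \<alpha> - \<alpha>(e) \<beta> vanishes on a basis
  \<open>e\<close>, hence everywhere. In product form neither side has to be nonzero.\<close>

lemma top_forms_proportional:
  fixes \<alpha> \<beta> :: "(nat \<Rightarrow> 'v::euclidean_space) \<Rightarrow> real"
  assumes a: "alternating_form DIM('v) \<alpha>" and b: "alternating_form DIM('v) \<beta>"
  shows "\<alpha> v * \<beta> w = \<alpha> w * \<beta> v"
proof -
  obtain e where e: "bij_betw e {..<DIM('v)} (Basis :: 'v set)" using ex_basis_enum by blast
  have *: "\<beta> e * \<alpha> v + (- \<alpha> e) * \<beta> v = 0" for v
    by (rule top_form_eq_0[OF alternating_form_combine[OF a b] e]) auto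
  show ?thesis
  proof (cases "\<alpha> e = 0")
    case True
    then have "\<alpha> v = 0" for v using top_form_eq_0[OF a e] by simp
    then show ?thesis by simp
  next
    case False
    have "\<alpha> e * (\<alpha> v * \<beta> w) = \<alpha> e * (\<alpha> w * \<beta> v)"
      using *[of v] *[of w] by algebra
    then show ?thesis using False by simp
  qed
qed

text \<open>A nonzero \<open>r\<close> could be completed to a basis, and a top form vanishing on a
  basis is 0.\<close>

lemma top_form_nondegenerate:
  fixes \<alpha> :: "(nat \<Rightarrow> 'v::euclidean_space) \<Rightarrow> real"
  assumes a: "alternating_form DIM('v) \<alpha>" and nz: "\<alpha> u \<noteq> 0" and r: "\<And>v. \<alpha> (case_nat r v) = 0"
  shows "r = 0"
proof (rule ccontr)
  assume "r \<noteq> 0"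
  then have ind: "independent {r}" by simp
  define B where "B = extend_basis {r}"
  have B: "independent B" "span B = UNIV" "r \<in> B"
    using independent_extend_basis[OF ind] extend_basis_superset[OF ind] span_extend_basis[OF ind]
    by (auto simp: B_def)
  then have "card B = DIM('v)" using dim_eq_card[of B UNIV] by (simp add: dim_span)
  moreover have "finite B" using B(1) independent_bound by blast
  ultimately obtain e where e: "bij_betw e {..<DIM('v)} B"
    using ex_bij_betw_nat_finite[of B] by (auto simp: atLeast0LessThan)
  then obtain i where i: "i < DIM('v)" "e i = r" using B(3) by (auto simp: bij_betw_def)
  have "\<alpha> e = 0" using alternating_form_move[OF a i(1), of e] r i(2) by simp
  then show False using top_form_eq_0[OF a e B(2)] nz by blast
qed

lemma alternating_form_linear_comp:
  assumes a: "alternating_form k \<alpha>" and f: "linear f"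
  shows "alternating_form k (\<lambda>v. \<alpha> (\<lambda>i. f (v i)))"
  unfolding alternating_form_def
proof (intro conjI allI impI)
  fix v and i assume i: "i < k"
  have "(\<lambda>j. f ((v(i := x)) j)) = (\<lambda>j. f (v j))(i := f x)" for x by auto
  then show "linear (\<lambda>x. \<alpha> (\<lambda>j. f ((v(i := x)) j)))"
    using linear_compose[OF f multilinear_form_linear[OF alternating_imp_multilinear[OF a] i]]
    by (simp add: comp_def)
next
  fix v :: "nat \<Rightarrow> 'b" and i j assume "i < j" "j < k" "v i = v j"
  then show "\<alpha> (\<lambda>i. f (v i)) = 0"
    by (intro alternating_form_eq_0[OF a, of i j]) auto
qed (auto intro: multilinear_form_cong[OF alternating_imp_multilinear[OF a]])

text \<open>The factor is the real determinant, obtained from the one-dimensionality of top forms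
  rather than from entries. One factor serves all \<open>\<alpha>\<close>, because any two of them
  are proportional.\<close>

lemma ex_form_det:
  fixes f :: "'v::euclidean_space \<Rightarrow> 'v"
  assumes "linear f"
  shows "\<exists>J. \<forall>\<alpha> v. alternating_form DIM('v) \<alpha> \<longrightarrow> \<alpha> (\<lambda>i. f (v i)) = J * \<alpha> v"
proof (cases "\<exists>\<alpha>::(nat \<Rightarrow> 'v) \<Rightarrow> real. \<exists>v. alternating_form DIM('v) \<alpha> \<and> \<alpha> v \<noteq> 0")
  case True
  then obtain \<beta> :: "(nat \<Rightarrow> 'v) \<Rightarrow> real" and w where b: "alternating_form DIM('v) \<beta>" "\<beta> w \<noteq> 0" by blast
  have "\<alpha> (\<lambda>i. f (v i)) = \<beta> (\<lambda>i. f (w i)) / \<beta> w * \<alpha> v" if a: "alternating_form DIM('v) \<alpha>" for \<alpha> v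
    using top_forms_proportional[OF alternating_form_linear_comp[OF a assms] b(1), of v w]
      top_forms_proportional[OF a b(1), of "\<lambda>i. f (w i)" w]
      top_forms_proportional[OF a b(1), of v w] b(2)
    by (simp add: field_simps) algebra
  then show ?thesis by blast
next
  case False
  then show ?thesis by (intro exI[of _ 0]) simp
qed

section \<open>The differential of the next-to-top power of a two-form\<close>

text \<open>By \<open>om_power_contract\<close>, \<omega>^k is a constant times the contraction of
  the fixed form \<open>vol\<close> with the bivector field K = \<phi> sharp. Differentiation
  therefore sees K only, and d of the contraction is, up to a constant, the contraction of
  \<open>vol\<close> with the divergence of K.\<close>

lemma ext_deriv_om_power:
  fixes om :: "'v::euclidean_space \<Rightarrow> 'v \<Rightarrow> 'v \<Rightarrow> real" and sh :: "'v \<Rightarrow> 'v \<Rightarrow> 'v"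
  assumes dim: "DIM('v) = 2 * Suc k" and U: "open U" "x \<in> U"
    and sy: "\<And>y. y \<in> U \<Longrightarrow> symplectic (om y) (sh y)"
    and vol: "alternating_form DIM('v) vol"
    and phi: "\<And>y v. y \<in> U \<Longrightarrow> om_power (om y) (Suc k) v = \<phi> y * vol v"
    and der: "\<And>b. ((\<lambda>y. \<phi> y *\<^sub>R sh y b) has_derivative K' b) (at x)"
  shows "ext_deriv (2 * k) (\<lambda>y. om_power (om y) k) x v =
    (1 / real (Suc k)) * vol (case_nat (\<Sum>b\<in>Basis. K' b b) v)"
proof -
  define K where "K y b = \<phi> y *\<^sub>R sh y b" for y b
  \<comment> \<open>Inverse of the factor -(k+1) (2(k+1) - 2k) of \<open>om_power_contract\<close>
    in dimension 2(k+1).\<close>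
  define c where "c = - 1 / (2 * real (Suc k))"
  have mvol: "multilinear_form DIM('v) vol" by (rule alternating_imp_multilinear[OF vol])
  have lin0: "linear (\<lambda>z. vol (case_nat z w))" for w
    by (rule linear_case_nat[OF mvol]) (simp add: dim)
  have lin1: "linear (\<lambda>z. vol (case_nat a (case_nat z w)))" for a w
    by (rule linear_case_nat_1[OF mvol]) (simp add: dim)
  have rep: "om_power (om y) k w = c * (\<Sum>b\<in>Basis. vol (case_nat b (case_nat (K y b) w)))" if "y \<in> U" for y w
  proof -
    interpret symplectic "om y" "sh y" by (rule sy[OF that])
    have "(\<Sum>b\<in>Basis. vol (case_nat b (case_nat (K y b) w)))
        = (\<Sum>b\<in>Basis. om_power (om y) (Suc k) (case_nat b (case_nat (sh y b) w)))"
      unfolding phi[OF that] K_def by (simp add: linear_scale[OF lin1])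
    also have "\<dots> = - (2 * real (Suc k)) * om_power (om y) k w"
      unfolding om_power_contract using dim by (simp add: algebra_simps)
    finally show ?thesis by (simp add: c_def field_simps)
  qed
  have derT: "((\<lambda>y. om_power (om y) k w) has_derivative
      (\<lambda>u. c * (\<Sum>b\<in>Basis. vol (case_nat b (case_nat (K' b u) w))))) (at x)" for w
  proof -
    have "((\<lambda>y. vol (case_nat b (case_nat (K y b) w))) has_derivative
        (\<lambda>u. vol (case_nat b (case_nat (K' b u) w)))) (at x)" for b
      using bounded_linear.has_derivative[OF linear_conv_bounded_linear[THEN iffD1, OF lin1] der]
      by (simp add: K_def)
    then have "((\<lambda>y. c * (\<Sum>b\<in>Basis. vol (case_nat b (case_nat (K y b) w)))) has_derivative
      (\<lambda>u. c * (\<Sum>b\<in>Basis. vol (case_nat b (case_nat (K' b u) w))))) (at x)"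
      by (intro has_derivative_mult_right has_derivative_sum) auto
    then show ?thesis
      by (rule has_derivative_transform_within_open[OF _ U]) (rule rep[symmetric])
  qed
  \<comment> \<open>K is skew at every point of \<open>U\<close>, so its derivative is skew as
    well.\<close>
  have skewK: "K' a u \<bullet> b = - (K' b u \<bullet> a)" for a b u
  proof -
    have "((\<lambda>y. K y a \<bullet> b) has_derivative (\<lambda>u. K' a u \<bullet> b)) (at x)"
      unfolding K_def using der by (intro has_derivative_inner_left) auto
    moreover have "((\<lambda>y. - (K y b \<bullet> a)) has_derivative (\<lambda>u. - (K' b u \<bullet> a))) (at x)"
      unfolding K_def using der by (intro has_derivative_inner_left has_derivative_minus) auto
    then have "((\<lambda>y. K y a \<bullet> b) has_derivative (\<lambda>u. - (K' b u \<bullet> a))) (at x)"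
    proof (rule has_derivative_transform_within_open[OF _ U])
      fix y assume "y \<in> U"
      then interpret symplectic "om y" "sh y" by (rule sy)
      show "- (K y b \<bullet> a) = K y a \<bullet> b"
        using sharp_skew[of a b] by (simp add: K_def inner_commute)
    qed
    ultimately show ?thesis by (metis has_derivative_unique)
  qed
  have linK': "linear (K' b)" for b using der has_derivative_linear by blast
  \<comment> \<open>The vanishing form of excessive degree trades the differentiated direction
    \<open>v i\<close> for the basis vectors \<open>b\<close> and \<open>b'\<close>.\<close>
  have cram: "(\<Sum>i\<le>2 * k. (-1) ^ i * (K' b (v i) \<bullet> b') * vol (case_nat b (case_nat b' (omit i v))))
      = - (K' b b \<bullet> b') * vol (case_nat b' v) + (K' b b' \<bullet> b') * vol (case_nat b v)" for b b'
  proof -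
    have "linear (\<lambda>u. K' b u \<bullet> b')"
      using linK'[of b] by (simp add: linear_iff inner_add_left)
    from covector_wedge_top[OF vol this, of "case_nat b (case_nat b' v)"]
    have "(K' b b \<bullet> b') * vol (case_nat b' v) - (K' b b' \<bullet> b') * vol (case_nat b v)
       + (\<Sum>i\<le>2 * k. (-1) ^ i * (K' b (v i) \<bullet> b') * vol (case_nat b (case_nat b' (omit i v)))) = 0"
      unfolding dim mult_Suc_right add_2_eq_Suc
      by (simp only: sum.atMost_Suc_shift) (simp add: omit_0 omit_Suc)
    then show ?thesis by linarith
  qed
  have "ext_deriv (2 * k) (\<lambda>y. om_power (om y) k) x v =
      (\<Sum>i\<le>2 * k. (-1) ^ i * (c * (\<Sum>b\<in>Basis. vol (case_nat b (case_nat (K' b (v i)) (omit i v))))))"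
    unfolding ext_deriv_def omit_def[symmetric]
    by (simp only: frechet_derivative_at[OF derT, symmetric])
  also have "\<dots> = (\<Sum>i\<le>2 * k. (-1) ^ i * (c * (\<Sum>b\<in>Basis. \<Sum>b'\<in>Basis. (K' b (v i) \<bullet> b') *
       vol (case_nat b (case_nat b' (omit i v))))))"
  proof -
    have "vol (case_nat b (case_nat z w)) = (\<Sum>b'\<in>Basis. (z \<bullet> b') * vol (case_nat b (case_nat b' w)))" for b z w
      by (subst euclidean_representation[of z, symmetric])
        (simp add: linear_sum[OF lin1] linear_scale[OF lin1] del: euclidean_representation)
    from this[of _ "K' _ _"] show ?thesis by simp
  qed
  also have "\<dots> = c * (\<Sum>b\<in>Basis. \<Sum>b'\<in>Basis. \<Sum>i\<le>2 * k. (-1) ^ i * (K' b (v i) \<bullet> b')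
       * vol (case_nat b (case_nat b' (omit i v))))"
    unfolding sum_distrib_left
    by (subst sum.swap, intro sum.cong refl, subst sum.swap) (simp add: mult_ac)
  also have "\<dots> = c * ((\<Sum>b\<in>Basis. \<Sum>b'\<in>Basis. - (K' b b \<bullet> b') * vol (case_nat b' v)) +
      (\<Sum>b\<in>Basis. \<Sum>b'\<in>Basis. (K' b b' \<bullet> b') * vol (case_nat b v)))"
    unfolding cram by (simp only: sum.distrib)
  \<comment> \<open>By skewness both double sums agree. The divergence thus appears twice, which
    cancels the 2 in the denominator of \<open>c\<close>.\<close>
  also have "(\<Sum>b\<in>Basis. \<Sum>b'\<in>Basis. (K' b b' \<bullet> b') * vol (case_nat b v))
      = (\<Sum>b\<in>Basis. \<Sum>b'\<in>Basis. - (K' b b \<bullet> b') * vol (case_nat b' v))"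
  proof -
    have "(\<Sum>b\<in>Basis. \<Sum>b'\<in>Basis. (K' b b' \<bullet> b') * vol (case_nat b v))
      = (\<Sum>b\<in>Basis. \<Sum>b'\<in>Basis. - (K' b' b' \<bullet> b) * vol (case_nat b v))"
      by (intro sum.cong refl arg_cong2[where f = "(*)"] skewK)
    then show ?thesis by (subst (asm) (2) sum.swap) simp
  qed
  also have "(\<Sum>b\<in>Basis. \<Sum>b'\<in>Basis. - (K' b b \<bullet> b') * vol (case_nat b' v))
     = - vol (case_nat (\<Sum>b\<in>Basis. K' b b) v)"
  proof -
    have "(\<Sum>b'\<in>Basis. (z \<bullet> b') * vol (case_nat b' v)) = vol (case_nat z v)" for z
    proof -
      have "vol (case_nat (\<Sum>b\<in>Basis. (z \<bullet> b) *\<^sub>R b) v) = (\<Sum>b'\<in>Basis. (z \<bullet> b') * vol (case_nat b' v))"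
        by (simp add: linear_sum[OF lin0] linear_scale[OF lin0] del: euclidean_representation)
      then show ?thesis by (simp add: euclidean_representation)
    qed
    then show ?thesis by (simp add: sum_negf linear_sum[OF lin0])
  qed
  finally show ?thesis by (simp add: c_def field_simps)
qed

section \<open>Calculus of \<open>C\<^sup>k\<close> functions\<close>

lemma frechet_derivative_cong:
  assumes "open S" "x \<in> S" "\<And>y. y \<in> S \<Longrightarrow> f y = g y"
  shows "frechet_derivative f (at x) = frechet_derivative g (at x)"
proof -
  have "(f has_derivative D) (at x) \<longleftrightarrow> (g has_derivative D) (at x)" for D
    using has_derivative_transform_within_open[of f D x UNIV S g]
      has_derivative_transform_within_open[of g D x UNIV S f] assms by auto
  then show ?thesis by (simp add: frechet_derivative_def)
qed

lemma differentiable_cong_open: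
  assumes "open S" "x \<in> S" "\<And>y. y \<in> S \<Longrightarrow> f y = g y" "f differentiable (at x)"
  shows "g differentiable (at x)"
  using assms has_derivative_transform_within_open[of f _ x UNIV S g]
  unfolding differentiable_def by auto

lemma Ck_on_cong:
  assumes "open S" "\<And>x. x \<in> S \<Longrightarrow> f x = g x" "Ck_on k S f"
  shows "Ck_on k S g"
  using assms(2,3)
proof (induction k arbitrary: f g)
  case 0
  then show ?case using continuous_on_cong[of S S f g] by simp
next
  case (Suc k)
  have "g differentiable (at x)" if "x \<in> S" for x
    using differentiable_cong_open[OF assms(1) that, of f g] Suc.prems that by auto
  moreover have "Ck_on k S (\<lambda>x. frechet_derivative g (at x) v)" for v
  proof (rule Suc.IH[of "\<lambda>x. frechet_derivative f (at x) v"])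
    show "frechet_derivative f (at x) v = frechet_derivative g (at x) v" if "x \<in> S" for x
      using frechet_derivative_cong[OF assms(1) that, of f g] Suc.prems(1) by simp
  qed (use Suc.prems in auto)
  ultimately show ?case by simp
qed

lemma Ck_on_subset: "Ck_on k S f \<Longrightarrow> T \<subseteq> S \<Longrightarrow> Ck_on k T f"
  by (induction k arbitrary: f) (auto intro: continuous_on_subset)

text \<open>Allows the derivative to be given by any formula, whereas \<open>Ck_on\<close> refers to
  \<open>frechet_derivative\<close>; the two agree on the open set.\<close>

lemma Ck_on_SucI:
  assumes "open S" "\<And>x. x \<in> S \<Longrightarrow> (f has_derivative D x) (at x)" "\<And>v. Ck_on k S (\<lambda>x. D x v)"
  shows "Ck_on (Suc k) S f"
proof -
  have "D x v = frechet_derivative f (at x) v" if "x \<in> S" for x v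
    using frechet_derivative_at[OF assms(2)[OF that]] by simp
  then have "Ck_on k S (\<lambda>x. frechet_derivative f (at x) v)" for v
    by (rule Ck_on_cong[OF assms(1) _ assms(3)])
  then show ?thesis using assms(2) by (auto simp: differentiable_def)
qed

lemma Ck_on_SucD:
  assumes "Ck_on (Suc k) S f"
  shows "x \<in> S \<Longrightarrow> (f has_derivative frechet_derivative f (at x)) (at x)"
    "Ck_on k S (\<lambda>x. frechet_derivative f (at x) v)"
  using assms frechet_derivative_works by auto

lemma Ck_on_Suc_imp: "Ck_on (Suc k) S f \<Longrightarrow> Ck_on k S f"
proof (induction k arbitrary: f)
  case 0
  then show ?case
    by (auto intro!: continuous_at_imp_continuous_on differentiable_imp_continuous_within)
next
  case (Suc k)
  then show ?case by (metis Ck_on.simps(2))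
qed

lemma Ck_on_const: "open S \<Longrightarrow> Ck_on k S (\<lambda>x. c)"
proof (induction k arbitrary: c)
  case (Suc k)
  then show ?case by (intro Ck_on_SucI[where D = "\<lambda>_ _. 0"]) auto
qed auto

lemma Ck_on_linear: "open S \<Longrightarrow> bounded_linear f \<Longrightarrow> Ck_on k S f"
proof (cases k)
  case (Suc m)
  assume "open S" "bounded_linear f"
  then show ?thesis
    unfolding Suc by (intro Ck_on_SucI[where D = "\<lambda>_. f"] Ck_on_const bounded_linear_imp_has_derivative)
qed (auto intro: linear_continuous_on)

lemma Ck_on_add:
  "open S \<Longrightarrow> Ck_on k S f \<Longrightarrow> Ck_on k S g \<Longrightarrow> Ck_on k S (\<lambda>x. f x + g x)"
proof (induction k arbitrary: f g)
  case 0
  then show ?case by (simp add: continuous_on_add)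
next
  case (Suc k)
  show ?case
  proof (rule Ck_on_SucI[where D = "\<lambda>x v. frechet_derivative f (at x) v + frechet_derivative g (at x) v"])
    show "Ck_on k S (\<lambda>x. frechet_derivative f (at x) v + frechet_derivative g (at x) v)" for v
      by (rule Suc.IH[OF Suc.prems(1) Ck_on_SucD(2)[OF Suc.prems(2)] Ck_on_SucD(2)[OF Suc.prems(3)]])
    show "((\<lambda>x. f x + g x) has_derivative (\<lambda>v. frechet_derivative f (at x) v + frechet_derivative g (at x) v)) (at x)"
      if "x \<in> S" for x
      by (rule has_derivative_add[OF Ck_on_SucD(1)[OF Suc.prems(2) that] Ck_on_SucD(1)[OF Suc.prems(3) that]])
  qed (rule Suc.prems)
qed

lemma Ck_on_linear_compose:
  assumes "open S" "bounded_linear L"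
  shows "Ck_on k S f \<Longrightarrow> Ck_on k S (\<lambda>x. L (f x))"
proof (induction k arbitrary: f)
  case 0
  then show ?case unfolding Ck_on.simps(1) by (rule bounded_linear.continuous_on[OF assms(2)])
next
  case (Suc k)
  show ?case
  proof (rule Ck_on_SucI[where D = "\<lambda>x v. L (frechet_derivative f (at x) v)"])
    show "Ck_on k S (\<lambda>x. L (frechet_derivative f (at x) v))" for v
      by (rule Suc.IH[OF Ck_on_SucD(2)[OF Suc.prems]])
    show "((\<lambda>x. L (f x)) has_derivative (\<lambda>v. L (frechet_derivative f (at x) v))) (at x)" if "x \<in> S" for x
      by (rule bounded_linear.has_derivative[OF assms(2) Ck_on_SucD(1)[OF Suc.prems that]])
  qed (rule assms)
qed

lemma Ck_on_bilinear:
  assumes "open S" "bounded_bilinear B"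
  shows "Ck_on k S f \<Longrightarrow> Ck_on k S g \<Longrightarrow> Ck_on k S (\<lambda>x. B (f x) (g x))"
proof (induction k arbitrary: f g)
  case 0
  then show ?case unfolding Ck_on.simps(1) by (rule bounded_bilinear.continuous_on[OF assms(2)])
next
  case (Suc k)
  show ?case
  proof (rule Ck_on_SucI[where D = "\<lambda>x v. B (f x) (frechet_derivative g (at x) v) + B (frechet_derivative f (at x) v) (g x)"])
    show "Ck_on k S (\<lambda>x. B (f x) (frechet_derivative g (at x) v) + B (frechet_derivative f (at x) v) (g x))" for v
      by (rule Ck_on_add[OF assms(1) Suc.IH[OF Ck_on_Suc_imp[OF Suc.prems(1)] Ck_on_SucD(2)[OF Suc.prems(2)]]
            Suc.IH[OF Ck_on_SucD(2)[OF Suc.prems(1)] Ck_on_Suc_imp[OF Suc.prems(2)]]])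
    show "((\<lambda>x. B (f x) (g x)) has_derivative
        (\<lambda>v. B (f x) (frechet_derivative g (at x) v) + B (frechet_derivative f (at x) v) (g x))) (at x)"
      if "x \<in> S" for x
      by (rule bounded_bilinear.FDERIV[OF assms(2) Ck_on_SucD(1)[OF Suc.prems(1) that] Ck_on_SucD(1)[OF Suc.prems(2) that]])
  qed (rule assms)
qed

lemma Ck_on_sum:
  assumes "open S" "\<And>i. i \<in> I \<Longrightarrow> Ck_on k S (f i)"
  shows "Ck_on k S (\<lambda>x. \<Sum>i\<in>I. f i x)"
  using assms(2)
proof (induction I rule: infinite_finite_induct)
  case (insert i I)
  then show ?case using Ck_on_add[OF assms(1), of k "f i" "\<lambda>x. \<Sum>i\<in>I. f i x"] by simp
qed (simp_all add: Ck_on_const assms(1))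

lemma Ck_on_prod:
  fixes f :: "'i \<Rightarrow> 'a::real_normed_vector \<Rightarrow> 'b::real_normed_field"
  assumes "open S" "\<And>i. i \<in> I \<Longrightarrow> Ck_on k S (f i)"
  shows "Ck_on k S (\<lambda>x. \<Prod>i\<in>I. f i x)"
  using assms(2)
proof (induction I rule: infinite_finite_induct)
  case (insert i I)
  then have "Ck_on k S (f i)" "Ck_on k S (\<lambda>x. \<Prod>i\<in>I. f i x)" by blast+
  then show ?case
    unfolding prod.insert[OF insert.hyps] by (rule Ck_on_bilinear[OF assms(1) bounded_bilinear_mult])
next
  case empty
  show ?case unfolding prod.empty by (rule Ck_on_const[OF assms(1)])
next
  case (infinite I)
  show ?case unfolding prod.infinite[OF infinite.hyps] by (rule Ck_on_const[OF assms(1)])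
qed

text \<open>\<open>Ck_on\<close> controls derivatives in fixed directions, but the chain rule
  differentiates \<open>f\<close> in the moving direction Dg(x) v. Expanding that direction in a
  basis leaves fixed ones; hence the Euclidean middle space.\<close>

lemma Ck_on_compose:
  fixes g :: "'a::real_normed_vector \<Rightarrow> 'b::euclidean_space" and f :: "'b \<Rightarrow> 'c::real_normed_vector"
  assumes "open S" "open T" "g ` S \<subseteq> T"
  shows "Ck_on k T f \<Longrightarrow> Ck_on k S g \<Longrightarrow> Ck_on k S (\<lambda>x. f (g x))"
proof (induction k arbitrary: f)
  case 0
  then show ?case using continuous_on_compose2[of T f S g] assms(3) by auto
next
  case (Suc k)
  note f = Ck_on_SucD[OF Suc.prems(1)] and g = Ck_on_SucD[OF Suc.prems(2)]
  show ?case
  proof (rule Ck_on_SucI[where D = "\<lambda>x v. \<Sum>b\<in>Basis. (frechet_derivative g (at x) v \<bullet> b) *\<^sub>R frechet_derivative f (at (g x)) b"])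
    fix x assume x: "x \<in> S"
    then have gx: "g x \<in> T" using assms(3) by auto
    interpret bounded_linear "frechet_derivative f (at (g x))"
      using f(1)[OF gx] by (rule has_derivative_bounded_linear)
    have eq: "(\<Sum>b\<in>Basis. (w \<bullet> b) *\<^sub>R frechet_derivative f (at (g x)) b) = frechet_derivative f (at (g x)) w" for w
    proof -
      have "frechet_derivative f (at (g x)) (\<Sum>b\<in>Basis. (w \<bullet> b) *\<^sub>R b)
          = (\<Sum>b\<in>Basis. (w \<bullet> b) *\<^sub>R frechet_derivative f (at (g x)) b)"
        by (simp only: sum scaleR)
      then show ?thesis by (simp only: euclidean_representation)
    qed
    show "((\<lambda>x. f (g x)) has_derivative (\<lambda>v. \<Sum>b\<in>Basis. (frechet_derivative g (at x) v \<bullet> b) *\<^sub>R frechet_derivative f (at (g x)) b)) (at x)"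
      unfolding eq by (rule has_derivative_compose[OF g(1)[OF x] f(1)[OF gx]])
  next
    fix v
    show "Ck_on k S (\<lambda>x. \<Sum>b\<in>Basis. (frechet_derivative g (at x) v \<bullet> b) *\<^sub>R frechet_derivative f (at (g x)) b)"
    proof (rule Ck_on_sum[OF assms(1)])
      fix b
      have "Ck_on k S (\<lambda>x. frechet_derivative f (at (g x)) b)"
        by (rule Suc.IH[OF f(2) Ck_on_Suc_imp[OF Suc.prems(2)]])
      moreover have "Ck_on k S (\<lambda>x. frechet_derivative g (at x) v \<bullet> b)"
        by (rule Ck_on_linear_compose[OF assms(1) bounded_linear_inner_left g(2)])
      ultimately show "Ck_on k S (\<lambda>x. (frechet_derivative g (at x) v \<bullet> b) *\<^sub>R frechet_derivative f (at (g x)) b)"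
        by (rule Ck_on_bilinear[OF assms(1) bounded_bilinear_scaleR, rotated])
    qed
  qed (rule assms)
qed

lemma Ck_on_local:
  assumes "\<And>x. x \<in> S \<Longrightarrow> \<exists>U. open U \<and> x \<in> U \<and> Ck_on k (S \<inter> U) f"
  shows "Ck_on k S f"
  using assms
proof (induction k arbitrary: f)
  case 0
  have "continuous (at x within S) f" if "x \<in> S" for x
  proof -
    obtain U where U: "open U" "x \<in> U" "continuous_on (S \<inter> U) f" using 0[OF \<open>x \<in> S\<close>] by auto
    then have "continuous (at x within S \<inter> U) f"
      using \<open>x \<in> S\<close> by (simp add: continuous_on_eq_continuous_within)
    moreover have "at x within S \<inter> U = at x within S"
      by (rule at_within_nhd[OF U(2,1)]) auto
    ultimately show ?thesis by (simp add: continuous_within)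
  qed
  then show ?case by (simp add: continuous_on_eq_continuous_within)
next
  case (Suc k)
  have "Ck_on k S (\<lambda>x. frechet_derivative f (at x) v)" for v
  proof (rule Suc.IH)
    fix x assume "x \<in> S"
    from Suc.prems[OF this] obtain U where "open U" "x \<in> U" "Ck_on (Suc k) (S \<inter> U) f" by blast
    then show "\<exists>U. open U \<and> x \<in> U \<and> Ck_on k (S \<inter> U) (\<lambda>x. frechet_derivative f (at x) v)"
      by (intro exI[of _ U]) (simp add: Ck_on_SucD(2))
  qed
  moreover have "f differentiable (at x)" if "x \<in> S" for x
    using Suc.prems[OF that] that by auto
  ultimately show ?case by simp
qed

section \<open>Closure properties of smooth functions\<close>

lemma smooth_onI: "(\<And>k. Ck_on k S f) \<Longrightarrow> smooth_on S f"
  by (simp add: smooth_on_def)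

lemma smooth_onD: "smooth_on S f \<Longrightarrow> Ck_on k S f"
  by (simp add: smooth_on_def)

lemma smooth_on_frechet: "smooth_on S f \<Longrightarrow> smooth_on S (\<lambda>x. frechet_derivative f (at x) v)"
  unfolding smooth_on_def by (metis Ck_on.simps(2))

lemma smooth_on_has_derivative:
  "smooth_on S f \<Longrightarrow> x \<in> S \<Longrightarrow> (f has_derivative frechet_derivative f (at x)) (at x)"
  by (rule Ck_on_SucD(1)[OF smooth_onD])

lemma smooth_on_continuous: "smooth_on S f \<Longrightarrow> continuous_on S f"
  using smooth_onD[of S f 0] by simp

lemma smooth_on_cong: "open S \<Longrightarrow> (\<And>x. x \<in> S \<Longrightarrow> f x = g x) \<Longrightarrow> smooth_on S f \<Longrightarrow> smooth_on S g"
  unfolding smooth_on_def by (blast intro: Ck_on_cong)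

lemma smooth_on_subset: "smooth_on S f \<Longrightarrow> T \<subseteq> S \<Longrightarrow> smooth_on T f"
  unfolding smooth_on_def by (blast intro: Ck_on_subset)

lemma smooth_on_local:
  assumes "\<And>x. x \<in> S \<Longrightarrow> \<exists>U. open U \<and> x \<in> U \<and> smooth_on (S \<inter> U) f"
  shows "smooth_on S f"
proof (intro smooth_onI Ck_on_local)
  fix k x assume "x \<in> S"
  then obtain U where "open U" "x \<in> U" "smooth_on (S \<inter> U) f" using assms by blast
  then show "\<exists>U. open U \<and> x \<in> U \<and> Ck_on k (S \<inter> U) f" using smooth_onD by blast
qed

lemma smooth_on_const: "open S \<Longrightarrow> smooth_on S (\<lambda>x. c)"
  by (simp add: smooth_on_def Ck_on_const)

lemma smooth_on_linear: "open S \<Longrightarrow> bounded_linear f \<Longrightarrow> smooth_on S f"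
  by (simp add: smooth_on_def Ck_on_linear)

lemma smooth_on_add: "open S \<Longrightarrow> smooth_on S f \<Longrightarrow> smooth_on S g \<Longrightarrow> smooth_on S (\<lambda>x. f x + g x)"
  by (simp add: smooth_on_def Ck_on_add)

lemma smooth_on_linear_compose:
  "open S \<Longrightarrow> bounded_linear L \<Longrightarrow> smooth_on S f \<Longrightarrow> smooth_on S (\<lambda>x. L (f x))"
  by (simp add: smooth_on_def Ck_on_linear_compose)

lemma smooth_on_minus: "open S \<Longrightarrow> smooth_on S f \<Longrightarrow> smooth_on S (\<lambda>x. - f x)"
  by (rule smooth_on_linear_compose[OF _ bounded_linear_minus[OF bounded_linear_ident]])

lemma smooth_on_mult:
  fixes f :: "'a::real_normed_vector \<Rightarrow> 'b::real_normed_algebra"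
  shows "open S \<Longrightarrow> smooth_on S f \<Longrightarrow> smooth_on S g \<Longrightarrow> smooth_on S (\<lambda>x. f x * g x)"
  by (simp add: smooth_on_def Ck_on_bilinear[OF _ bounded_bilinear_mult])

lemma smooth_on_scaleR:
  "open S \<Longrightarrow> smooth_on S f \<Longrightarrow> smooth_on S g \<Longrightarrow> smooth_on S (\<lambda>x. f x *\<^sub>R g x)"
  by (simp add: smooth_on_def Ck_on_bilinear[OF _ bounded_bilinear_scaleR])

lemma smooth_on_sum:
  "open S \<Longrightarrow> (\<And>i. i \<in> I \<Longrightarrow> smooth_on S (f i)) \<Longrightarrow> smooth_on S (\<lambda>x. \<Sum>i\<in>I. f i x)"
  by (simp add: smooth_on_def Ck_on_sum)

lemma smooth_on_prod:
  fixes f :: "'i \<Rightarrow> 'a::real_normed_vector \<Rightarrow> 'b::real_normed_field"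
  shows "open S \<Longrightarrow> (\<And>i. i \<in> I \<Longrightarrow> smooth_on S (f i)) \<Longrightarrow> smooth_on S (\<lambda>x. \<Prod>i\<in>I. f i x)"
  by (simp add: smooth_on_def Ck_on_prod)

lemma smooth_on_compose:
  fixes g :: "'a::real_normed_vector \<Rightarrow> 'b::euclidean_space"
  shows "open S \<Longrightarrow> open T \<Longrightarrow> g ` S \<subseteq> T \<Longrightarrow> smooth_on T f \<Longrightarrow> smooth_on S g \<Longrightarrow> smooth_on S (\<lambda>x. f (g x))"
  by (simp add: smooth_on_def Ck_on_compose)

lemma smooth_on_vec_nth: "open S \<Longrightarrow> smooth_on S f \<Longrightarrow> smooth_on S (\<lambda>x. f x $ i)"
  by (rule smooth_on_linear_compose[OF _ bounded_linear_vec_nth])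

lemma smooth_on_vec_lambda:
  fixes f :: "'a::real_normed_vector \<Rightarrow> 'i::finite \<Rightarrow> 'b::euclidean_space"
  assumes "open S" "\<And>i. smooth_on S (\<lambda>x. f x i)"
  shows "smooth_on S (\<lambda>x. \<chi> i. f x i)"
proof -
  have "(\<chi> i. f x i) = (\<Sum>i\<in>UNIV. axis i (f x i))" for x
    by (simp add: vec_eq_iff axis_def if_distrib if_distribR cong: if_cong)
  moreover have "bounded_linear (axis i :: 'b \<Rightarrow> 'b ^ 'i)" for i
    by (intro linear_conv_bounded_linear[THEN iffD1] linearI) (auto simp: vec_eq_iff axis_def)
  ultimately show ?thesis
    by (simp only:) (rule smooth_on_sum[OF assms(1) smooth_on_linear_compose[OF assms(1) _ assms(2)]])
qed

text \<open>The derivative is a product of copies of the function itself, so each order of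
  differentiability yields the next.\<close>

lemma smooth_on_inverse:
  "smooth_on (- {0}) (inverse :: 'a::real_normed_field \<Rightarrow> 'a)"
proof (rule smooth_onI)
  fix k show "Ck_on k (- {0}) (inverse :: 'a \<Rightarrow> 'a)"
  proof (induction k)
    case 0
    show ?case by (simp add: continuous_on_inverse)
  next
    case (Suc k)
    have o: "open (- {0 :: 'a})" by auto
    show ?case
    proof (rule Ck_on_SucI[OF o, where D = "\<lambda>x v. - (inverse x * v * inverse x)"])
      fix x :: 'a assume "x \<in> - {0}"
      then show "(inverse has_derivative (\<lambda>v. - (inverse x * v * inverse x))) (at x)"
        by (intro has_derivative_inverse') auto
    next
      fix v :: 'a
      have "Ck_on k (- {0}) (\<lambda>x. - v * (inverse x * inverse x))"
        by (intro Ck_on_bilinear[OF o bounded_bilinear_mult] Suc Ck_on_const[OF o])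
      then show "Ck_on k (- {0}) (\<lambda>x. - (inverse x * v * inverse x))"
        by (simp add: mult_ac)
    qed
  qed
qed

lemma smooth_on_powr: "smooth_on {0<..} (\<lambda>x::real. x powr a)"
proof (rule smooth_onI)
  fix k show "Ck_on k {0<..} (\<lambda>x::real. x powr a)"
  proof (induction k arbitrary: a)
    case 0
    show ?case by (auto intro!: continuous_on_powr)
  next
    case (Suc k)
    have o: "open {0::real<..}" by auto
    show ?case
    proof (rule Ck_on_SucI[OF o, where D = "\<lambda>x v. (a * x powr (a - 1)) * v"])
      fix x :: real assume "x \<in> {0<..}"
      then show "((\<lambda>x. x powr a) has_derivative (*) (a * x powr (a - 1))) (at x)"
        using has_real_derivative_powr[of x a] by (simp add: has_field_derivative_def)
    next
      fix v :: real
      show "Ck_on k {0<..} (\<lambda>x. a * x powr (a - 1) * v)"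
        by (intro Ck_on_bilinear[OF o bounded_bilinear_mult] Suc Ck_on_const[OF o])
    qed
  qed
qed

lemma smooth_on_abs: "smooth_on (- {0}) (abs :: real \<Rightarrow> real)"
proof (rule smooth_on_local)
  fix x :: real assume x: "x \<in> - {0}"
  show "\<exists>U. open U \<and> x \<in> U \<and> smooth_on (- {0} \<inter> U) abs"
  proof (cases "x > 0")
    case True
    have "smooth_on (- {0} \<inter> {0<..}) (abs :: real \<Rightarrow> real)"
      by (rule smooth_on_cong[OF _ _ smooth_on_linear[OF _ bounded_linear_ident]]) auto
    then show ?thesis using True by (intro exI[of _ "{0<..}"]) auto
  next
    case False
    have "smooth_on (- {0} \<inter> {..<0}) (abs :: real \<Rightarrow> real)"
      by (rule smooth_on_cong[OF _ _ smooth_on_linear[OF _ bounded_linear_minus[OF bounded_linear_ident]]]) auto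
    then show ?thesis using False x by (intro exI[of _ "{..<0}"]) auto
  qed
qed

section \<open>A smooth bump function\<close>

text \<open>The functions P(1/x) exp(-1/x), extended by 0, form a class closed under
  differentiation: the derivative belongs to the polynomial X^2 (P - P'). Keeping P general makes
  the induction on the order of smoothness work.\<close>

definition flat :: "real poly \<Rightarrow> real \<Rightarrow> real" where
  "flat P x = (if 0 < x then poly P (1 / x) * exp (- 1 / x) else 0)"

lemma poly_exp_tendsto_0: "((\<lambda>y. poly P y * exp (- y)) \<longlongrightarrow> (0::real)) at_top"
proof -
  have "((\<lambda>y. \<Sum>i\<le>degree P. coeff P i * (y ^ i / exp y)) \<longlongrightarrow> (\<Sum>i\<le>degree P. coeff P i * 0)) at_top"
    by (intro tendsto_intros tendsto_power_div_exp_0)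
  then show ?thesis
    by (simp add: poly_altdef sum_distrib_left exp_minus divide_inverse mult_ac)
qed

lemma flat_has_derivative:
  "(flat P has_real_derivative flat ([:0, 0, 1:] * (P - pderiv P)) x) (at x)"
proof -
  consider "x < 0" | "x = 0" | "x > 0" by linarith
  then show ?thesis
  proof cases
    case 1
    have "((\<lambda>_. 0) has_real_derivative 0) (at x)" by simp
    then have "(flat P has_real_derivative 0) (at x)"
      by (rule has_field_derivative_transform_within_open[of _ _ _ "{..<0}"]) (use 1 in \<open>auto simp: flat_def\<close>)
    then show ?thesis using 1 by (simp add: flat_def)
  next
    case 3
    have "((\<lambda>x. poly P (1 / x) * exp (- 1 / x)) has_real_derivative
        flat ([:0, 0, 1:] * (P - pderiv P)) x) (at x)"
      using 3 by (auto intro!: derivative_eq_intros simp: flat_def field_simps power2_eq_square)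
    then show ?thesis
      by (rule has_field_derivative_transform_within_open[of _ _ _ "{0<..}"]) (use 3 in \<open>auto simp: flat_def\<close>)
  next
    case 2
    \<comment> \<open>The difference quotient at 0 is the function belonging to X P, and the
      exponential beats every polynomial in 1/h.\<close>
    have "((\<lambda>h. flat P h / h) \<longlongrightarrow> 0) (at_right 0)"
    proof -
      have "((\<lambda>h. poly ([:0, 1:] * P) (inverse h) * exp (- inverse h)) \<longlongrightarrow> 0) (at_right (0::real))"
        by (rule filterlim_compose[OF poly_exp_tendsto_0 filterlim_inverse_at_top_right])
      then show ?thesis
        by (rule Lim_transform_eventually)
          (auto simp: eventually_at_filter flat_def field_simps)
    qed
    moreover have "((\<lambda>h. flat P h / h) \<longlongrightarrow> 0) (at_left 0)"
      by (rule Lim_transform_eventually[OF tendsto_const])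
        (auto simp: eventually_at_filter flat_def)
    ultimately have "((\<lambda>h. flat P h / h) \<longlongrightarrow> 0) (at 0)"
      by (simp add: filterlim_split_at)
    then show ?thesis using 2 by (simp add: has_field_derivative_iff flat_def)
  qed
qed

lemma smooth_on_flat: "smooth_on UNIV (flat P)"
proof (rule smooth_onI)
  fix k show "Ck_on k UNIV (flat P)"
  proof (induction k arbitrary: P)
    case 0
    show ?case
      unfolding Ck_on.simps(1) by (rule DERIV_continuous_on) (rule flat_has_derivative)
  next
    case (Suc k)
    show ?case
      by (rule Ck_on_SucI[where D = "\<lambda>x v. flat ([:0, 0, 1:] * (P - pderiv P)) x * v"])
        (use flat_has_derivative Suc in \<open>auto simp: has_field_derivative_def
          intro!: Ck_on_bilinear[OF _ bounded_bilinear_mult] Ck_on_const\<close>)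
  qed
qed

text \<open>Positive exactly on (-1, 1), an interval longer than 1, so that its integer translates
  cover the line.\<close>

definition bump :: "real \<Rightarrow> real" where
  "bump x = flat 1 (1 - x\<^sup>2)"

lemma bump_pos_iff: "0 < bump x \<longleftrightarrow> \<bar>x\<bar> < 1"
  by (auto simp: bump_def flat_def abs_square_less_1)

lemma bump_nonneg: "0 \<le> bump x"
  by (simp add: bump_def flat_def)

lemma bump_eq_0_iff: "bump x = 0 \<longleftrightarrow> 1 \<le> \<bar>x\<bar>"
  using bump_pos_iff[of x] bump_nonneg[of x] by linarith

lemma smooth_on_bump: "smooth_on UNIV bump"
proof -
  have "smooth_on UNIV (\<lambda>x::real. x * x)"
    by (intro smooth_on_mult smooth_on_linear) auto
  then have "smooth_on UNIV (\<lambda>x::real. 1 + - (x * x))"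
    by (intro smooth_on_add smooth_on_minus smooth_on_const) auto
  then have "smooth_on UNIV (\<lambda>x. flat 1 (1 + - (x * x)))"
    by (rule smooth_on_compose[OF _ _ _ smooth_on_flat, rotated 3]) auto
  then show ?thesis by (rule smooth_on_cong[rotated 2]) (auto simp: bump_def power2_eq_square)
qed

section \<open>Holomorphic maps of several variables are smooth\<close>

lemma norm_vector_smult: "norm (c *s (u :: complex ^ 'n::finite)) = cmod c * norm u"
  by (simp add: norm_vec_def norm_mult L2_set_right_distrib)

lemma bounded_linear_smult_left: "bounded_linear (\<lambda>c. c *s (u :: complex ^ 'n::finite))"
  by (rule linear_conv_bounded_linear[THEN iffD1], rule linearI)
    (simp_all add: vec_eq_iff algebra_simps)

text \<open>Scalar version of \<open>holomorphic_vec_on\<close>. Additivity comes with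
  \<open>has_derivative\<close>, so only complex homogeneity is asked for.\<close>

definition cdiff_on :: "(complex ^ 'n::finite \<Rightarrow> complex) \<Rightarrow> (complex ^ 'n) set \<Rightarrow> bool" where
  "cdiff_on f S \<longleftrightarrow> (\<forall>x\<in>S. \<exists>D. (f has_derivative D) (at x) \<and> (\<forall>c u. D (c *s u) = c * D u))"

lemma cdiff_onD:
  assumes "cdiff_on f S" "x \<in> S"
  shows "(f has_derivative frechet_derivative f (at x)) (at x)"
    "frechet_derivative f (at x) (c *s u) = c * frechet_derivative f (at x) u"
proof -
  obtain D where D: "(f has_derivative D) (at x)" "\<And>c u. D (c *s u) = c * D u"
    using assms by (auto simp: cdiff_on_def)
  then have "D = frechet_derivative f (at x)" by (simp add: frechet_derivative_at)
  with D show "(f has_derivative frechet_derivative f (at x)) (at x)"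
    "frechet_derivative f (at x) (c *s u) = c * frechet_derivative f (at x) u" by auto
qed

lemma cdiff_on_line:
  assumes "cdiff_on f S" "x + z *s u \<in> S"
  shows "((\<lambda>z. f (x + z *s u)) has_field_derivative frechet_derivative f (at (x + z *s u)) u) (at z)"
proof -
  have "((\<lambda>z. x + z *s u) has_derivative (\<lambda>c. c *s u)) (at z)"
    using has_derivative_add[OF has_derivative_const bounded_linear_imp_has_derivative[OF bounded_linear_smult_left]]
    by simp
  from has_derivative_compose[OF this cdiff_onD(1)[OF assms]]
  show ?thesis
    by (simp add: has_field_derivative_def cdiff_onD(2)[OF assms] mult.commute[of _ "frechet_derivative f _ u"])
qed

lemma line_mem_cball:
  fixes u :: "complex ^ 'n::finite"
  assumes "cmod z * norm u \<le> r"
  shows "x + z *s u \<in> cball x r"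
  using assms by (simp add: dist_norm norm_vector_smult)

text \<open>The one-variable Cauchy inequality on the complex line through \<open>x\<close> in
  direction \<open>u\<close>, where the disc of radius \<open>r / norm u\<close> stays inside the
  ball.\<close>

lemma cdiff_on_cauchy:
  assumes f: "cdiff_on f S" and S: "cball x r \<subseteq> S" and r: "0 < r"
    and B: "\<And>y. y \<in> cball x r \<Longrightarrow> cmod (f y) \<le> B"
  shows "cmod (frechet_derivative f (at x) u) \<le> B / r * norm u"
proof (cases "u = 0")
  case True
  have "linear (frechet_derivative f (at x))"
    using cdiff_onD(1)[OF f, of x] S r has_derivative_linear by (auto simp: subset_iff)
  then show ?thesis using True by (simp add: linear_0)
next
  case False
  define \<rho> where "\<rho> = r / norm u"
  have \<rho>: "0 < \<rho>" using False r by (simp add: \<rho>_def)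
  define F where "F z = f (x + z *s u)" for z
  have mem: "x + z *s u \<in> cball x r" if "cmod z \<le> \<rho>" for z
    using that False by (intro line_mem_cball) (simp add: \<rho>_def field_simps)
  have dF: "(F has_field_derivative frechet_derivative f (at (x + z *s u)) u) (at z)" if "cmod z \<le> \<rho>" for z
    unfolding F_def by (rule cdiff_on_line[OF f]) (use mem[OF that] S in auto)
  have "cmod ((deriv ^^ 1) F 0) \<le> fact 1 * B / \<rho> ^ 1"
  proof (rule Cauchy_inequality[OF _ _ \<rho>])
    show "F holomorphic_on ball 0 \<rho>"
      unfolding holomorphic_on_open[OF open_ball] by (metis dF less_imp_le mem_ball_0)
    show "continuous_on (cball 0 \<rho>) F"
      by (intro continuous_at_imp_continuous_on ballI DERIV_isCont[OF dF]) auto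
    show "cmod (F z) \<le> B" if "cmod (0 - z) = \<rho>" for z
      unfolding F_def by (rule B[OF mem]) (use that in auto)
  qed
  moreover have "deriv F 0 = frechet_derivative f (at x) u"
    using DERIV_imp_deriv[OF dF[of 0]] \<rho> by simp
  ultimately show ?thesis by (simp add: \<rho>_def field_simps)
qed

text \<open>The difference quotients in direction \<open>v\<close> are holomorphic and converge
  uniformly to the directional derivative, by Taylor expansion along \<open>v\<close>. The Cauchy
  estimate makes their derivatives converge uniformly too, so the limit is differentiable and its
  derivative is complex homogeneous.\<close>

lemma cdiff_on_directional:
  assumes f: "cdiff_on f S" and S: "open S"
  shows "cdiff_on (\<lambda>x. frechet_derivative f (at x) v) S"
  unfolding cdiff_on_def
proof
  fix x0 assume "x0 \<in> S"
  obtain R0 where R0: "R0 > 0" "cball x0 R0 \<subseteq> S" using S \<open>x0 \<in> S\<close> open_contains_cball by blast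
  \<comment> \<open>Three nested balls: the limit is differentiated on radius R, the quotients are
    holomorphic and close to \<open>g\<close> on radius 2R, and the shifted points stay within
    radius 3R.\<close>
  define R where "R = R0 / 3"
  have R: "R > 0" "cball x0 (3 * R) \<subseteq> S" using R0 by (auto simp: R_def)
  have contf: "continuous_on S f"
    using cdiff_onD(1)[OF f] by (auto intro!: continuous_at_imp_continuous_on has_derivative_continuous)
  have "compact (f ` cball x0 (3 * R))"
    by (intro compact_continuous_image continuous_on_subset[OF contf R(2)]) auto
  then obtain B where B: "\<And>y. y \<in> cball x0 (3 * R) \<Longrightarrow> cmod (f y) \<le> B"
    using bounded_iff compact_imp_bounded by (metis imageI)
  \<comment> \<open>Shifts by z v with z of modulus at most \<delta> have length at most R; the
    summand 1 covers v = 0.\<close>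
  define \<delta> where "\<delta> = R / (1 + norm v)"
  have "0 < 1 + norm v" by (rule add_pos_nonneg) auto
  then have \<delta>: "\<delta> > 0" "\<delta> * norm v \<le> R" using R(1) by (auto simp: \<delta>_def field_simps)
  \<comment> \<open>Cauchy bound for the second derivative along \<open>v\<close>, on discs of
    radius \<delta>/2 centred at points of modulus at most \<delta>/2.\<close>
  define C where "C = fact 2 * B / (\<delta> / 2) ^ 2"
  define g where "g x = frechet_derivative f (at x) v" for x
  define t where "t n = complex_of_real (\<delta> / 2 / real (Suc n))" for n
  have t: "cmod (t n) = \<delta> / 2 / real (Suc n)" "t n \<noteq> 0" "cmod (t n) \<le> \<delta> / 2" for n
    using \<delta>(1) by (auto simp: t_def norm_divide field_simps simp del: of_nat_Suc)
  define h where "h n x = (f (x + t n *s v) - f x) / t n" for n x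
  have near: "x + z *s v \<in> cball x0 (3 * R)" if "x \<in> cball x0 (2 * R)" "cmod z \<le> \<delta>" for x z
  proof -
    have "cmod z * norm v \<le> R" using that(2) \<delta>(2) by (meson mult_right_mono norm_ge_zero order_trans)
    then have "dist x (x + z *s v) \<le> R" by (simp add: dist_norm norm_vector_smult)
    then show ?thesis using that(1) dist_triangle[of x0 "x + z *s v" x] by simp
  qed
  \<comment> \<open>The second order Taylor remainder along \<open>v\<close>, divided by
    \<open>t n\<close>.\<close>
  have hg: "cmod (h n x - g x) \<le> C * cmod (t n)" if x: "x \<in> cball x0 (2 * R)" for n x
  proof -
    define F where "F z = f (x + z *s v)" for z
    have dF: "(F has_field_derivative frechet_derivative f (at (x + z *s v)) v) (at z)" if "cmod z \<le> \<delta>" for z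
      unfolding F_def by (rule cdiff_on_line[OF f]) (use near[OF x that] R(2) in auto)
    have hol: "F holomorphic_on ball 0 \<delta>"
      unfolding holomorphic_on_open[OF open_ball] by (metis dF less_imp_le mem_ball_0)
    have cont: "continuous_on (cball 0 \<delta>) F"
      by (intro continuous_at_imp_continuous_on ballI DERIV_isCont[OF dF]) auto
    have "cmod ((deriv ^^ 0) F (t n) - (\<Sum>i\<le>1. (deriv ^^ i) F 0 * (t n - 0) ^ i / fact i))
        \<le> C * cmod (t n - 0) ^ Suc 1 / fact 1"
    proof (rule complex_Taylor[where S = "cball 0 (\<delta> / 2)"])
      fix i :: nat and z :: complex assume "z \<in> cball 0 (\<delta> / 2)"
      then have "z \<in> ball 0 \<delta>" using \<delta>(1) by auto
      then show "((deriv ^^ i) F has_field_derivative (deriv ^^ Suc i) F z) (at z within cball 0 (\<delta> / 2))"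
        using has_field_derivative_higher_deriv[OF hol open_ball] has_field_derivative_at_within by blast
    next
      fix z :: complex assume z: "z \<in> cball 0 (\<delta> / 2)"
      have sub: "cball z (\<delta> / 2) \<subseteq> cball 0 \<delta>"
        using z by (auto simp: cball_subset_cball_iff)
      have "cmod ((deriv ^^ 2) F z) \<le> fact 2 * B / (\<delta> / 2) ^ 2"
      proof (rule Cauchy_inequality)
        show "F holomorphic_on ball z (\<delta> / 2)"
          by (rule holomorphic_on_subset[OF hol]) (use z in \<open>auto simp: ball_subset_ball_iff\<close>)
        show "continuous_on (cball z (\<delta> / 2)) F" by (rule continuous_on_subset[OF cont sub])
        show "cmod (F y) \<le> B" if "cmod (z - y) = \<delta> / 2" for y
        proof -
          have "y \<in> cball z (\<delta> / 2)" using that by (simp add: dist_norm)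
          then have "cmod y \<le> \<delta>" using sub by (auto simp: subset_iff)
          then show ?thesis unfolding F_def by (intro B near[OF x])
        qed
      qed (use \<delta> in auto)
      then show "cmod ((deriv ^^ Suc 1) F z) \<le> C" by (simp add: C_def numeral_2_eq_2)
    qed (use t \<delta> in auto)
    moreover have "deriv F 0 = g x"
      using DERIV_imp_deriv[OF dF[of 0]] \<delta> by (simp add: g_def)
    moreover have "F (t n) - F 0 - g x * t n = (h n x - g x) * t n"
      using t(2)[of n] by (simp add: F_def h_def field_simps)
    ultimately have "cmod (h n x - g x) * cmod (t n) \<le> (C * cmod (t n)) * cmod (t n)"
      by (simp add: norm_mult power2_eq_square algebra_simps flip: norm_mult)
    then show ?thesis using t(2)[of n] by simp
  qed
  have dh: "(h n has_derivative (\<lambda>u. (frechet_derivative f (at (x + t n *s v)) u - frechet_derivative f (at x) u) / t n)) (at x)"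
    if x: "x \<in> cball x0 (2 * R)" for n x
  proof -
    have "x + t n *s v \<in> S" using near[OF x, of "t n"] t(3)[of n] \<delta>(1) R(2) by auto
    moreover have "x \<in> S" using x R by (auto simp: subset_iff)
    moreover have "((\<lambda>x. x + t n *s v) has_derivative (\<lambda>u. u)) (at x)"
      by (auto intro!: derivative_eq_intros)
    ultimately have "((\<lambda>x. f (x + t n *s v) - f x) has_derivative
        (\<lambda>u. frechet_derivative f (at (x + t n *s v)) u - frechet_derivative f (at x) u)) (at x)"
      using has_derivative_compose[of "\<lambda>x. x + t n *s v" "\<lambda>u. u" x UNIV f] cdiff_onD(1)[OF f]
      by (intro has_derivative_diff) auto
    then show ?thesis
      unfolding h_def divide_inverse by (rule has_derivative_mult_left)
  qed
  define h' where "h' n x u = (frechet_derivative f (at (x + t n *s v)) u - frechet_derivative f (at x) u) / t n" for n x u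
  have mem2: "x \<in> S" "x + t n *s v \<in> S" if "x \<in> cball x0 (2 * R)" for x n
    using near[OF that, of "t n"] t(3)[of n] \<delta>(1) R(2) that R(1) by (auto simp: subset_iff)
  have smult_h': "h' n x (c *s u) = c * h' n x u" if "x \<in> cball x0 (2 * R)" for n x c u
    unfolding h'_def using mem2[OF that] by (simp add: cdiff_onD(2)[OF f] algebra_simps)
  \<comment> \<open>Cauchy estimate for the difference of two quotients on the ball of radius R
    around \<open>x\<close>.\<close>
  have cauchy_h': "cmod (h' n x u - h' m x u) \<le> (C * (cmod (t n) + cmod (t m))) / R * norm u"
    if x: "x \<in> cball x0 R" for n m x u
  proof -
    define k where "k y = h n y - h m y" for y
    have dk: "(k has_derivative (\<lambda>u. h' n y u - h' m y u)) (at y)" if "y \<in> cball x0 (2 * R)" for y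
      unfolding k_def h'_def by (intro has_derivative_diff dh[OF that])
    have "cdiff_on k (cball x0 (2 * R))"
      unfolding cdiff_on_def using dk by (metis (no_types, lifting) right_diff_distrib smult_h')
    moreover have "cball x R \<subseteq> cball x0 (2 * R)"
      using x R(1) by (auto simp: cball_subset_cball_iff dist_commute)
    moreover have "cmod (k y) \<le> C * (cmod (t n) + cmod (t m))" if "y \<in> cball x R" for y
    proof -
      have y: "y \<in> cball x0 (2 * R)" using that calculation(2) by auto
      have "k y = (h n y - g y) - (h m y - g y)" by (simp add: k_def)
      then have "cmod (k y) \<le> cmod (h n y - g y) + cmod (h m y - g y)" by (metis norm_triangle_ineq4)
      then show ?thesis using hg[OF y, of n] hg[OF y, of m] by (simp add: algebra_simps)
    qed
    ultimately have "cmod (frechet_derivative k (at x) u) \<le> C * (cmod (t n) + cmod (t m)) / R * norm u"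
      by (intro cdiff_on_cauchy R(1)) auto
    moreover have "frechet_derivative k (at x) = (\<lambda>u. h' n x u - h' m x u)"
      using frechet_derivative_at[OF dk, of x] x R(1) by simp
    ultimately show ?thesis by simp
  qed
  have C0: "C \<ge> 0"
  proof -
    have "0 \<le> B" using B[of x0] R(1) norm_ge_zero[of "f x0"] by (metis (no_types, opaque_lifting) centre_in_cball less_eq_real_def mult_pos_pos order_trans zero_less_numeral)
    then show ?thesis by (simp add: C_def)
  qed
  have tlim: "(\<lambda>n. cmod (t n)) \<longlonglongrightarrow> 0"
    unfolding t(1) by (rule LIMSEQ_Suc[where f = "\<lambda>n. \<delta> / 2 / real n"]) (rule lim_const_over_n)
  have tlim2: "(\<lambda>n. C * (2 * cmod (t n)) / R * K) \<longlonglongrightarrow> 0" for K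
    using tendsto_mult_right_zero[OF tlim, of "C * 2 / R * K"] by (simp add: mult_ac)
  have tdec: "cmod (t n) \<le> cmod (t m)" if "m \<le> n" for m n
    unfolding t(1) using that \<delta>(1) by (auto simp: field_simps)
  define L where "L x u = lim (\<lambda>n. h' n x u)" for x u
  have L: "(\<lambda>n. h' n x u) \<longlonglongrightarrow> L x u" if x: "x \<in> cball x0 R" for x u
  proof -
    have "Cauchy (\<lambda>n. h' n x u)"
    proof (rule metric_CauchyI)
      fix e :: real assume "e > 0"
      from order_tendstoD(2)[OF tlim2 this] obtain N where "\<forall>n\<ge>N. C * (2 * cmod (t n)) / R * norm u < e"
        unfolding eventually_sequentially by blast
      then have N: "C * (2 * cmod (t N)) / R * norm u < e" by blast
      have "dist (h' n x u) (h' m x u) < e" if "n \<ge> N" "m \<ge> N" for n m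
      proof -
        have "cmod (t n) + cmod (t m) \<le> 2 * cmod (t N)" using tdec[OF that(1)] tdec[OF that(2)] by simp
        then have "C * (cmod (t n) + cmod (t m)) / R * norm u \<le> C * (2 * cmod (t N)) / R * norm u"
          using C0 R(1) by (intro mult_right_mono divide_right_mono mult_left_mono) auto
        then show ?thesis using cauchy_h'[OF x, of n u m] N by (simp add: dist_norm)
      qed
      then show "\<exists>M. \<forall>m\<ge>M. \<forall>n\<ge>M. dist (h' m x u) (h' n x u) < e" by blast
    qed
    then show ?thesis unfolding L_def by (simp add: Cauchy_convergent flip: convergent_LIMSEQ_iff)
  qed
  have hL: "cmod (h' n x u - L x u) \<le> C * (2 * cmod (t n)) / R * norm u" if x: "x \<in> cball x0 R" for n x u
  proof (rule tendsto_upperbound)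
    show "(\<lambda>m. cmod (h' n x u - h' m x u)) \<longlonglongrightarrow> cmod (h' n x u - L x u)"
      by (intro tendsto_intros L[OF x])
    show "\<forall>\<^sub>F m in sequentially. cmod (h' n x u - h' m x u) \<le> C * (2 * cmod (t n)) / R * norm u"
      unfolding eventually_sequentially
    proof (intro exI allI impI)
      fix m assume "n \<le> m"
      then have "C * (cmod (t n) + cmod (t m)) / R * norm u \<le> C * (2 * cmod (t n)) / R * norm u"
        using C0 R(1) tdec[of n m] by (intro mult_right_mono divide_right_mono mult_left_mono) auto
      then show "cmod (h' n x u - h' m x u) \<le> C * (2 * cmod (t n)) / R * norm u"
        using cauchy_h'[OF x, of n u m] by simp
    qed
  qed simp
  have hgl: "(\<lambda>n. h n x) \<longlonglongrightarrow> g x" if "x \<in> cball x0 (2 * R)" for x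
  proof -
    have "(\<lambda>n. h n x - g x) \<longlonglongrightarrow> 0"
    proof (rule Lim_null_comparison)
      show "\<forall>\<^sub>F n in sequentially. norm (h n x - g x) \<le> C * cmod (t n)" using hg[OF that] by simp
      show "(\<lambda>n. C * cmod (t n)) \<longlonglongrightarrow> 0" by (rule tendsto_mult_right_zero[OF tlim])
    qed
    then show ?thesis by (rule LIM_zero_cancel)
  qed
  have "\<exists>g0. \<forall>x\<in>ball x0 R. (\<lambda>n. h n x) \<longlonglongrightarrow> g0 x \<and> (g0 has_derivative L x) (at x within ball x0 R)"
  proof (rule has_derivative_sequence[where f' = h' and ?x0.0 = x0 and l = "g x0"])
    show "(h n has_derivative h' n x) (at x within ball x0 R)" if "x \<in> ball x0 R" for n x
      unfolding h'_def by (rule has_derivative_at_withinI, rule dh) (use that R(1) in auto)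
    show "\<forall>\<^sub>F n in sequentially. \<forall>x\<in>ball x0 R. \<forall>u. norm (h' n x u - L x u) \<le> e * norm u" if "e > 0" for e
    proof -
      have "\<forall>\<^sub>F n in sequentially. C * (2 * cmod (t n)) / R * 1 < e"
        using order_tendstoD(2)[OF tlim2 that] .
      then show ?thesis
      proof eventually_elim
        case (elim n)
        show ?case
        proof (intro ballI allI)
          fix x u assume "x \<in> ball x0 R"
          then have "norm (h' n x u - L x u) \<le> C * (2 * cmod (t n)) / R * norm u" by (intro hL) auto
          also have "\<dots> \<le> e * norm u" using elim by (intro mult_right_mono) auto
          finally show "norm (h' n x u - L x u) \<le> e * norm u" .
        qed
      qed
    qed
    show "(\<lambda>n. h n x0) \<longlonglongrightarrow> g x0" by (rule hgl) (use R in auto)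
  qed (use R in auto)
  then obtain g0 where "\<forall>x\<in>ball x0 R. (\<lambda>n. h n x) \<longlonglongrightarrow> g0 x \<and> (g0 has_derivative L x) (at x within ball x0 R)"
    by blast
  then have g0: "\<And>x. x \<in> ball x0 R \<Longrightarrow> (\<lambda>n. h n x) \<longlonglongrightarrow> g0 x"
    "(g0 has_derivative L x0) (at x0 within ball x0 R)"
    using R(1) by (blast, simp)
  have "(g0 has_derivative L x0) (at x0)"
    using g0(2) R(1) by (simp add: at_within_open[of x0 "ball x0 R"])
  then have "(g has_derivative L x0) (at x0)"
  proof (rule has_derivative_transform_within_open)
    show "g0 x = g x" if "x \<in> ball x0 R" for x
      using LIMSEQ_unique[OF g0(1)[OF that] hgl] that R(1) by auto
  qed (use R in auto)
  moreover have "L x0 (c *s u) = c * L x0 u" for c u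
  proof (rule LIMSEQ_unique)
    show "(\<lambda>n. h' n x0 (c *s u)) \<longlonglongrightarrow> L x0 (c *s u)" by (rule L) (use R in auto)
    have "(\<lambda>n. c * h' n x0 u) \<longlonglongrightarrow> c * L x0 u" by (intro tendsto_intros L) (use R in auto)
    then show "(\<lambda>n. h' n x0 (c *s u)) \<longlonglongrightarrow> c * L x0 u" using smult_h'[of x0] R(1) by simp
  qed
  ultimately show "\<exists>D. ((\<lambda>x. frechet_derivative f (at x) v) has_derivative D) (at x0) \<and> (\<forall>c u. D (c *s u) = c * D u)"
    unfolding g_def by blast
qed

lemma cdiff_on_smooth:
  assumes "open S" "cdiff_on f S"
  shows "smooth_on S f"
proof (rule smooth_onI)
  fix k show "Ck_on k S f"
    using assms(2)
  proof (induction k arbitrary: f)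
    case 0
    then show ?case
      unfolding Ck_on.simps
      by (intro continuous_at_imp_continuous_on ballI has_derivative_continuous[OF cdiff_onD(1)])
  next
    case (Suc k)
    show ?case
      by (rule Ck_on_SucI[OF assms(1) cdiff_onD(1)[OF Suc.prems] Suc.IH[OF cdiff_on_directional[OF Suc.prems assms(1)]]])
  qed
qed

lemma holomorphic_vec_on_smooth:
  fixes f :: "complex ^ 'n::finite \<Rightarrow> complex ^ 'm::finite"
  assumes S: "open S" and f: "holomorphic_vec_on f S"
  shows "smooth_on S f"
proof -
  have "smooth_on S (\<lambda>x. f x $ i)" for i
  proof (rule cdiff_on_smooth[OF S])
    show "cdiff_on (\<lambda>x. f x $ i) S"
      unfolding cdiff_on_def
    proof
      fix x assume "x \<in> S"
      then obtain D where D: "(f has_derivative D) (at x)" "Vector_Spaces.linear (*s) (*s) D"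
        using f by (auto simp: holomorphic_vec_on_def)
      interpret Vector_Spaces.linear "(*s)" "(*s)" D by (rule D(2))
      show "\<exists>D. ((\<lambda>x. f x $ i) has_derivative D) (at x) \<and> (\<forall>c u. D (c *s u) = c * D u)"
        using bounded_linear.has_derivative[OF bounded_linear_vec_nth D(1)]
        by (intro exI[of _ "\<lambda>u. D u $ i"]) (simp add: scale)
    qed
  qed
  then have "smooth_on S (\<lambda>x. \<chi> i. f x $ i)" by (rule smooth_on_vec_lambda[OF S])
  then show ?thesis by simp
qed

section \<open>Exterior derivative and pullback\<close>

lemma mvt_line:
  fixes f :: "'v::real_normed_vector \<Rightarrow> real"
  assumes "0 < t" and der: "\<And>s. 0 \<le> s \<Longrightarrow> s \<le> t \<Longrightarrow> (f has_derivative D (a + s *\<^sub>R u)) (at (a + s *\<^sub>R u))"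
  shows "\<exists>s. 0 < s \<and> s < t \<and> f (a + t *\<^sub>R u) - f a = t * D (a + s *\<^sub>R u) u"
proof -
  have "((\<lambda>s. f (a + s *\<^sub>R u)) has_real_derivative D (a + s *\<^sub>R u) u) (at s)" if "0 \<le> s" "s \<le> t" for s
  proof -
    have "((\<lambda>s. a + s *\<^sub>R u) has_derivative (\<lambda>h. h *\<^sub>R u)) (at s)"
      by (auto intro!: derivative_eq_intros)
    from has_derivative_compose[OF this der[OF that]]
    show ?thesis
      using linear_scale[OF has_derivative_linear[OF der[OF that]]]
      by (simp add: has_field_derivative_def mult_commute_abs)
  qed
  from MVT2[OF assms(1) this] show ?thesis by auto
qed

text \<open>The mean value theorem is applied to y -> f(y + t v) - f(y) in direction u, and then to
  the derivative of f in direction u along v.\<close>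

lemma second_difference:
  fixes f :: "'v::real_normed_vector \<Rightarrow> real"
  assumes f: "smooth_on S f" and t: "0 < t"
    and S: "\<And>a b. 0 \<le> a \<Longrightarrow> a \<le> t \<Longrightarrow> 0 \<le> b \<Longrightarrow> b \<le> t \<Longrightarrow> x + a *\<^sub>R u + b *\<^sub>R v \<in> S"
  shows "\<exists>a b. 0 < a \<and> a < t \<and> 0 < b \<and> b < t \<and>
    f (x + t *\<^sub>R u + t *\<^sub>R v) - f (x + t *\<^sub>R u) - f (x + t *\<^sub>R v) + f x =
      t * (t * frechet_derivative (\<lambda>y. frechet_derivative f (at y) u) (at (x + a *\<^sub>R u + b *\<^sub>R v)) v)"
proof -
  define F where "F y = f (y + t *\<^sub>R v) - f y" for y
  have dF: "(F has_derivative (\<lambda>h. frechet_derivative f (at (x + s *\<^sub>R u + t *\<^sub>R v)) h -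
      frechet_derivative f (at (x + s *\<^sub>R u)) h)) (at (x + s *\<^sub>R u))" if "0 \<le> s" "s \<le> t" for s
  proof -
    have 1: "(f has_derivative frechet_derivative f (at (x + s *\<^sub>R u))) (at (x + s *\<^sub>R u))"
      using smooth_on_has_derivative[OF f S[of s 0]] that t by simp
    have 2: "(f has_derivative frechet_derivative f (at (x + s *\<^sub>R u + t *\<^sub>R v))) (at (x + s *\<^sub>R u + t *\<^sub>R v))"
      using smooth_on_has_derivative[OF f S[of s t]] that t by simp
    have "((\<lambda>y. y + t *\<^sub>R v) has_derivative (\<lambda>h. h)) (at (x + s *\<^sub>R u))"
      by (auto intro!: derivative_eq_intros)
    from has_derivative_compose[OF this 2]
    show ?thesis unfolding F_def by (intro has_derivative_diff 1) simp
  qed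
  obtain a where a: "0 < a" "a < t" "F (x + t *\<^sub>R u) - F x =
      t * (frechet_derivative f (at (x + a *\<^sub>R u + t *\<^sub>R v)) u - frechet_derivative f (at (x + a *\<^sub>R u)) u)"
    using mvt_line[OF t, of F "\<lambda>y h. frechet_derivative f (at (y + t *\<^sub>R v)) h - frechet_derivative f (at y) h" x u] dF
    by auto
  have "\<exists>b. 0 < b \<and> b < t \<and> frechet_derivative f (at (x + a *\<^sub>R u + t *\<^sub>R v)) u - frechet_derivative f (at (x + a *\<^sub>R u)) u
    = t * frechet_derivative (\<lambda>y. frechet_derivative f (at y) u) (at (x + a *\<^sub>R u + b *\<^sub>R v)) v"
    by (rule mvt_line[OF t, of _ "\<lambda>z. frechet_derivative (\<lambda>y. frechet_derivative f (at y) u) (at z)"])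
      (use a in \<open>auto intro!: smooth_on_has_derivative[OF smooth_on_frechet[OF f]] S\<close>)
  then obtain b where "0 < b" "b < t" "frechet_derivative f (at (x + a *\<^sub>R u + t *\<^sub>R v)) u - frechet_derivative f (at (x + a *\<^sub>R u)) u
    = t * frechet_derivative (\<lambda>y. frechet_derivative f (at y) u) (at (x + a *\<^sub>R u + b *\<^sub>R v)) v" by blast
  then have "F (x + t *\<^sub>R u) - F x = t * (t * frechet_derivative (\<lambda>y. frechet_derivative f (at y) u) (at (x + a *\<^sub>R u + b *\<^sub>R v)) v)"
    using a(3) by simp
  moreover have "F (x + t *\<^sub>R u) - F x = f (x + t *\<^sub>R u + t *\<^sub>R v) - f (x + t *\<^sub>R u) - f (x + t *\<^sub>R v) + f x"
    by (simp add: F_def algebra_simps)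
  ultimately show ?thesis using a \<open>0 < b\<close> \<open>b < t\<close> by auto
qed

text \<open>The second difference is symmetric in u and v and equals t^2 times either mixed
  derivative at some nearby point. Continuity of the mixed derivatives then excludes a gap at
  \<open>x\<close>.\<close>

lemma second_derivative_symmetric_real:
  fixes f :: "'v::real_normed_vector \<Rightarrow> real"
  assumes S: "open S" "x \<in> S" and f: "smooth_on S f"
  shows "frechet_derivative (\<lambda>y. frechet_derivative f (at y) u) (at x) v =
    frechet_derivative (\<lambda>y. frechet_derivative f (at y) v) (at x) u"
proof (rule ccontr)
  define A where "A y = frechet_derivative (\<lambda>y. frechet_derivative f (at y) u) (at y) v" for y
  define B where "B y = frechet_derivative (\<lambda>y. frechet_derivative f (at y) v) (at y) u" for y
  assume "\<not> ?thesis"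
  then have e: "0 < \<bar>A x - B x\<bar> / 2" (is "0 < ?e") by (simp add: A_def B_def)
  have "continuous_on S A" "continuous_on S B"
    unfolding A_def B_def by (intro smooth_on_continuous smooth_on_frechet f)+
  then have "continuous (at x) A" "continuous (at x) B"
    using S by (auto simp: continuous_on_eq_continuous_at)
  then obtain d1 d2 where d: "d1 > 0" "\<And>y. dist y x < d1 \<Longrightarrow> dist (A y) (A x) < ?e"
    "d2 > 0" "\<And>y. dist y x < d2 \<Longrightarrow> dist (B y) (B x) < ?e"
    using e unfolding continuous_at_eps_delta by metis
  obtain d3 where d3: "d3 > 0" "ball x d3 \<subseteq> S" using S open_contains_ball by blast
  define d where "d = min d1 (min d2 d3)"
  have dp: "d > 0" using d d3 by (simp add: d_def)
  \<comment> \<open>Chosen so that the parallelogram with sides t u and t v stays within distance d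
    of \<open>x\<close>.\<close>
  define t where "t = d / (2 * (norm u + norm v + 1))"
  have np: "norm u + norm v + 1 > 0" by (simp add: add_nonneg_pos)
  have t: "t > 0" using dp np by (simp add: t_def)
  have near: "dist (x + a *\<^sub>R p + b *\<^sub>R q) x < d"
    if "0 \<le> a" "a \<le> t" "0 \<le> b" "b \<le> t" "norm p + norm q = norm u + norm v" for a b p q
  proof -
    have "dist (x + a *\<^sub>R p + b *\<^sub>R q) x = norm (a *\<^sub>R p + b *\<^sub>R q)" by (simp add: dist_norm)
    also have "\<dots> \<le> norm (a *\<^sub>R p) + norm (b *\<^sub>R q)" by (rule norm_triangle_ineq)
    also have "\<dots> \<le> t * norm p + t * norm q"
      using that by (auto intro!: add_mono mult_right_mono)
    also have "\<dots> = t * (norm u + norm v)" using that(5) by (simp flip: distrib_left)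
    also have "\<dots> \<le> t * (norm u + norm v + 1)" using t by simp
    also have "\<dots> = d / 2" using np by (simp add: t_def field_simps)
    also have "\<dots> < d" using dp by simp
    finally show ?thesis .
  qed
  have inS: "y \<in> S" if "dist y x < d" for y
    using that d3(2) by (auto simp: d_def dist_commute)
  obtain a b where ab: "0 < a" "a < t" "0 < b" "b < t"
    "f (x + t *\<^sub>R u + t *\<^sub>R v) - f (x + t *\<^sub>R u) - f (x + t *\<^sub>R v) + f x = t * (t * A (x + a *\<^sub>R u + b *\<^sub>R v))"
    unfolding A_def using second_difference[OF f t, of x u v] inS near by auto
  obtain a' b' where ab': "0 < a'" "a' < t" "0 < b'" "b' < t"
    "f (x + t *\<^sub>R v + t *\<^sub>R u) - f (x + t *\<^sub>R v) - f (x + t *\<^sub>R u) + f x = t * (t * B (x + a' *\<^sub>R v + b' *\<^sub>R u))"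
    unfolding B_def using second_difference[OF f t, of x v u] inS near by (auto simp: add.commute)
  have "t * (t * A (x + a *\<^sub>R u + b *\<^sub>R v)) = t * (t * B (x + a' *\<^sub>R v + b' *\<^sub>R u))"
    using ab(5) ab'(5) by (simp add: algebra_simps)
  then have eq: "A (x + a *\<^sub>R u + b *\<^sub>R v) = B (x + a' *\<^sub>R v + b' *\<^sub>R u)" using t by simp
  have "dist (A (x + a *\<^sub>R u + b *\<^sub>R v)) (A x) < ?e"
    by (rule d) (use near[of a b u v] ab in \<open>auto simp: d_def\<close>)
  moreover have "dist (B (x + a' *\<^sub>R v + b' *\<^sub>R u)) (B x) < ?e"
    by (rule d) (use near[of a' b' v u] ab' in \<open>auto simp: d_def\<close>)
  ultimately show False unfolding eq by (auto simp: dist_real_def abs_if split: if_splits)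
qed

lemma second_derivative_symmetric:
  fixes f :: "'v::real_normed_vector \<Rightarrow> 'w::euclidean_space"
  assumes S: "open S" "x \<in> S" and f: "smooth_on S f"
  shows "frechet_derivative (\<lambda>y. frechet_derivative f (at y) u) (at x) v =
    frechet_derivative (\<lambda>y. frechet_derivative f (at y) v) (at x) u"
proof (rule euclidean_eqI)
  fix b :: 'w assume "b \<in> Basis"
  have fr: "frechet_derivative (\<lambda>y. g y \<bullet> b) (at y) w = frechet_derivative g (at y) w \<bullet> b"
    if "smooth_on S g" "y \<in> S" for g y w
    using frechet_derivative_at[OF has_derivative_inner_left[OF smooth_on_has_derivative[OF that]], of b] by metis
  have fr2: "frechet_derivative (\<lambda>y. frechet_derivative f (at y) u) (at x) v \<bullet> b =
      frechet_derivative (\<lambda>y. frechet_derivative (\<lambda>y. f y \<bullet> b) (at y) u) (at x) v" for u v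
  proof -
    have "frechet_derivative (\<lambda>y. frechet_derivative (\<lambda>y. f y \<bullet> b) (at y) u) (at x) v
        = frechet_derivative (\<lambda>y. frechet_derivative f (at y) u \<bullet> b) (at x) v"
      using frechet_derivative_cong[OF S, of "\<lambda>y. frechet_derivative (\<lambda>y. f y \<bullet> b) (at y) u"
          "\<lambda>y. frechet_derivative f (at y) u \<bullet> b"] fr[OF f] by simp
    then show ?thesis using fr[OF smooth_on_frechet[OF f] S(2)] by simp
  qed
  have "smooth_on S (\<lambda>y. f y \<bullet> b)"
    by (rule smooth_on_linear_compose[OF S(1) bounded_linear_inner_left f])
  from second_derivative_symmetric_real[OF S this]
  show "frechet_derivative (\<lambda>y. frechet_derivative f (at y) u) (at x) v \<bullet> b =
    frechet_derivative (\<lambda>y. frechet_derivative f (at y) v) (at x) u \<bullet> b"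
    unfolding fr2 .
qed

lemma alternating_form_case_nat:
  assumes a: "alternating_form (Suc k) \<alpha>"
  shows "alternating_form k (\<lambda>w. \<alpha> (case_nat q w))"
  unfolding alternating_form_def
proof (intro conjI allI impI)
  fix v w :: "nat \<Rightarrow> 'a" assume "\<forall>i<k. v i = w i"
  then show "\<alpha> (case_nat q v) = \<alpha> (case_nat q w)"
    by (intro multilinear_form_cong[OF alternating_imp_multilinear[OF a]]) (auto split: nat.split)
next
  fix v :: "nat \<Rightarrow> 'a" and i assume i: "i < k"
  have "case_nat q (v(i := x)) = (case_nat q v)(Suc i := x)" for x
    by (auto simp: fun_eq_iff split: nat.split)
  then show "linear (\<lambda>x. \<alpha> (case_nat q (v(i := x))))"
    using multilinear_form_linear[OF alternating_imp_multilinear[OF a], of "Suc i" "case_nat q v"] i by simp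
next
  fix v :: "nat \<Rightarrow> 'a" and i j assume "i < j" "j < k" "v i = v j"
  then show "\<alpha> (case_nat q v) = 0" by (intro alternating_form_eq_0[OF a, of "Suc i" "Suc j"]) auto
qed

text \<open>Product rule for a form whose coefficients and arguments both vary. The arguments are
  released one at a time and expanded in a basis, so that each stage differentiates a finite sum of
  products of real functions.\<close>

lemma multilinear_form_field_has_derivative:
  fixes \<alpha> :: "'w::euclidean_space \<Rightarrow> (nat \<Rightarrow> 'w) \<Rightarrow> real" and G :: "'v::real_normed_vector \<Rightarrow> 'w"
  assumes G: "(G has_derivative G') (at x)" and U: "open U" "x \<in> U"
    and T: "open T" "G ` U \<subseteq> T" and mT: "\<And>z. z \<in> T \<Longrightarrow> multilinear_form k (\<alpha> z)"
    and da: "\<And>w. ((\<lambda>z. \<alpha> z w) has_derivative D w) (at (G x))"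
    and a: "\<And>i. i < k \<Longrightarrow> (a i has_derivative a' i) (at x)"
  shows "((\<lambda>y. \<alpha> (G y) (\<lambda>i. a i y)) has_derivative
    (\<lambda>u. D (\<lambda>i. a i x) (G' u) + (\<Sum>j<k. \<alpha> (G x) ((\<lambda>i. a i x)(j := a' j u))))) (at x)"
proof -
  \<comment> \<open>The first \<open>m\<close> arguments move and the others are frozen at
    \<open>w\<close>; the induction on \<open>m\<close> is uniform in \<open>w\<close>.\<close>
  define A where "A m w y i = (if i < m then a i y else w i)" for m :: nat and w y i
  have m: "multilinear_form k (\<alpha> (G y))" if "y \<in> U" for y using mT T(2) that by blast
  have mx: "multilinear_form k (\<alpha> (G x))" by (rule m[OF U(2)])
  have Gx: "G x \<in> T" using T(2) U(2) by blast
  \<comment> \<open>The derivative of the coefficients inherits linearity in each slot, by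
    uniqueness of derivatives.\<close>
  have Dlin: "linear (\<lambda>z. D (w(i := z)) h)" if i: "i < k" for w i h
  proof (rule linearI)
    note lin = multilinear_form_linear[OF mT i, of _ w]
    show "D (w(i := z + z')) h = D (w(i := z)) h + D (w(i := z')) h" for z z'
    proof -
      have "((\<lambda>y. \<alpha> y (w(i := z + z'))) has_derivative (\<lambda>h. D (w(i := z)) h + D (w(i := z')) h)) (at (G x))"
        by (rule has_derivative_transform_within_open[OF has_derivative_add[OF da da] T(1) Gx])
          (simp add: linear_add[OF lin])
      then show ?thesis using has_derivative_unique[OF da] by metis
    qed
    show "D (w(i := c *\<^sub>R z)) h = c *\<^sub>R D (w(i := z)) h" for c z
    proof -
      have "((\<lambda>y. \<alpha> y (w(i := c *\<^sub>R z))) has_derivative (\<lambda>h. c *\<^sub>R D (w(i := z)) h)) (at (G x))"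
        by (rule has_derivative_transform_within_open[OF has_derivative_scaleR_right[OF da] T(1) Gx])
          (simp add: linear_scale[OF lin])
      then show ?thesis using has_derivative_unique[OF da] by metis
    qed
  qed
  have main: "((\<lambda>y. \<alpha> (G y) (A m w y)) has_derivative
    (\<lambda>u. D (A m w x) (G' u) + (\<Sum>j<m. \<alpha> (G x) ((A m w x)(j := a' j u))))) (at x)" if "m \<le> k" for m w
    using that
  proof (induction m arbitrary: w)
    case 0
    have "A 0 w y = w" for y by (auto simp: A_def)
    then show ?case using has_derivative_compose[OF G da[of w]] by simp
  next
    case (Suc m)
    then have mk: "m < k" by simp
    have AS: "A (Suc m) w y = (A m w y)(m := a m y)" for y
      by (auto simp: A_def fun_eq_iff less_Suc_eq)
    have Ab: "A m (w(m := b)) y = (A m w y)(m := b)" for b y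
      by (auto simp: A_def fun_eq_iff)
    have rep: "\<alpha> (G y) (W(m := z)) = (\<Sum>b\<in>Basis. (z \<bullet> b) * \<alpha> (G y) (W(m := b)))" if "y \<in> U" for y W z
    proof -
      have l: "linear (\<lambda>z. \<alpha> (G y) (W(m := z)))" by (rule multilinear_form_linear[OF m[OF that] mk])
      have "\<alpha> (G y) (W(m := (\<Sum>b\<in>Basis. (z \<bullet> b) *\<^sub>R b))) = (\<Sum>b\<in>Basis. (z \<bullet> b) * \<alpha> (G y) (W(m := b)))"
        by (simp add: linear_sum[OF l] linear_scale[OF l] del: euclidean_representation)
      then show ?thesis by (simp only: euclidean_representation)
    qed
    have Drep: "D (W(m := z)) h = (\<Sum>b\<in>Basis. (z \<bullet> b) * D (W(m := b)) h)" for W z h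
    proof -
      have "D (W(m := (\<Sum>b\<in>Basis. (z \<bullet> b) *\<^sub>R b))) h = (\<Sum>b\<in>Basis. (z \<bullet> b) * D (W(m := b)) h)"
        by (simp add: linear_sum[OF Dlin[OF mk]] linear_scale[OF Dlin[OF mk]] del: euclidean_representation)
      then show ?thesis by (simp only: euclidean_representation)
    qed
    have "((\<lambda>y. \<Sum>b\<in>Basis. (a m y \<bullet> b) * \<alpha> (G y) ((A m w y)(m := b))) has_derivative
      (\<lambda>u. \<Sum>b\<in>Basis. (a m x \<bullet> b) * (D ((A m w x)(m := b)) (G' u) +
         (\<Sum>j<m. \<alpha> (G x) ((A m w x)(m := b, j := a' j u)))) + (a' m u \<bullet> b) * \<alpha> (G x) ((A m w x)(m := b)))) (at x)"
    proof (rule has_derivative_sum)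
      fix b
      have "((\<lambda>y. \<alpha> (G y) ((A m w y)(m := b))) has_derivative (\<lambda>u. D ((A m w x)(m := b)) (G' u) +
         (\<Sum>j<m. \<alpha> (G x) ((A m w x)(m := b, j := a' j u))))) (at x)"
        by (rule Suc.IH[of "w(m := b)", unfolded Ab]) (use mk in simp)
      then show "((\<lambda>y. (a m y \<bullet> b) * \<alpha> (G y) ((A m w y)(m := b))) has_derivative
      (\<lambda>u. (a m x \<bullet> b) * (D ((A m w x)(m := b)) (G' u) +
         (\<Sum>j<m. \<alpha> (G x) ((A m w x)(m := b, j := a' j u)))) + (a' m u \<bullet> b) * \<alpha> (G x) ((A m w x)(m := b)))) (at x)"
        by (rule has_derivative_mult[OF has_derivative_inner_left[OF a[OF mk]]])
    qed
    moreover have "(\<Sum>b\<in>Basis. (a m x \<bullet> b) * (D ((A m w x)(m := b)) (G' u) +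
         (\<Sum>j<m. \<alpha> (G x) ((A m w x)(m := b, j := a' j u)))) + (a' m u \<bullet> b) * \<alpha> (G x) ((A m w x)(m := b)))
      = D (A (Suc m) w x) (G' u) + (\<Sum>j<Suc m. \<alpha> (G x) ((A (Suc m) w x)(j := a' j u)))" for u
    proof -
      have "(\<Sum>b\<in>Basis. (a m x \<bullet> b) * (\<Sum>j<m. \<alpha> (G x) ((A m w x)(m := b, j := a' j u))))
        = (\<Sum>j<m. \<Sum>b\<in>Basis. (a m x \<bullet> b) * \<alpha> (G x) (((A m w x)(j := a' j u))(m := b)))"
        unfolding sum_distrib_left
        by (subst sum.swap) (intro sum.cong refl arg_cong2[where f = "(*)"] arg_cong[where f = "\<alpha> (G x)"] fun_upd_twist, auto)
      also have "\<dots> = (\<Sum>j<m. \<alpha> (G x) ((A (Suc m) w x)(j := a' j u)))"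
      proof (intro sum.cong refl)
        fix j assume "j \<in> {..<m}"
        then have "((A m w x)(j := a' j u))(m := a m x) = (A (Suc m) w x)(j := a' j u)"
          unfolding AS by (intro fun_upd_twist) auto
        then show "(\<Sum>b\<in>Basis. (a m x \<bullet> b) * \<alpha> (G x) (((A m w x)(j := a' j u))(m := b)))
            = \<alpha> (G x) ((A (Suc m) w x)(j := a' j u))"
          using rep[OF U(2), of "(A m w x)(j := a' j u)" "a m x"] by simp
      qed
      finally have e3: "(\<Sum>b\<in>Basis. (a m x \<bullet> b) * (\<Sum>j<m. \<alpha> (G x) ((A m w x)(m := b, j := a' j u))))
        = (\<Sum>j<m. \<alpha> (G x) ((A (Suc m) w x)(j := a' j u)))" .
      have e1: "(\<Sum>b\<in>Basis. (a m x \<bullet> b) * D ((A m w x)(m := b)) (G' u)) = D (A (Suc m) w x) (G' u)"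
        unfolding AS by (rule Drep[symmetric])
      have e2: "(\<Sum>b\<in>Basis. (a' m u \<bullet> b) * \<alpha> (G x) ((A m w x)(m := b)))
          = \<alpha> (G x) ((A (Suc m) w x)(m := a' m u))"
        unfolding AS fun_upd_upd by (rule rep[OF U(2), symmetric])
      show ?thesis by (simp only: e1 e2 e3 sum.distrib distrib_left sum.lessThan_Suc add.assoc)
    qed
    ultimately have "((\<lambda>y. \<Sum>b\<in>Basis. (a m y \<bullet> b) * \<alpha> (G y) ((A m w y)(m := b))) has_derivative
       (\<lambda>u. D (A (Suc m) w x) (G' u) + (\<Sum>j<Suc m. \<alpha> (G x) ((A (Suc m) w x)(j := a' j u))))) (at x)"
      by simp
    then show ?case
      by (rule has_derivative_transform_within_open[OF _ U]) (unfold AS, rule rep[symmetric])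
  qed
  have Ak: "A k (\<lambda>i. a i x) x = (\<lambda>i. a i x)" by (rule ext) (simp add: A_def)
  have "((\<lambda>y. \<alpha> (G y) (A k (\<lambda>i. a i x) y)) has_derivative
    (\<lambda>u. D (\<lambda>i. a i x) (G' u) + (\<Sum>j<k. \<alpha> (G x) ((\<lambda>i. a i x)(j := a' j u))))) (at x)"
    by (rule main[OF order_refl, of "\<lambda>i. a i x", unfolded Ak])
  then show ?thesis
    by (rule has_derivative_transform_within_open[OF _ U])
      (auto simp: A_def intro!: multilinear_form_cong[OF m])
qed

text \<open>Naturality of d. Besides the expected terms, differentiation meets second derivatives of
  \<open>G\<close> in the arguments; symmetry of these makes their alternating sum vanish.\<close>

lemma ext_deriv_pullback:
  fixes G :: "'v::real_normed_vector \<Rightarrow> 'w::euclidean_space"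
  assumes U: "open U" "x \<in> U" and G: "smooth_on U G" and T: "open T" and GT: "G ` U \<subseteq> T"
    and alt: "\<And>z. z \<in> T \<Longrightarrow> alternating_form k (\<alpha> z)"
    and da: "\<And>z w. z \<in> T \<Longrightarrow> (\<lambda>z. \<alpha> z w) differentiable (at z)"
  shows "ext_deriv k (\<lambda>y v. \<alpha> (G y) (\<lambda>i. frechet_derivative G (at y) (v i))) x v =
    ext_deriv k \<alpha> (G x) (\<lambda>i. frechet_derivative G (at x) (v i))"
proof -
  define DG where "DG y = frechet_derivative G (at y)" for y
  define H where "H w u = frechet_derivative (\<lambda>y. DG y w) (at x) u" for w u
  define D where "D w = frechet_derivative (\<lambda>z. \<alpha> z w) (at (G x))" for w
  have GxT: "G x \<in> T" using U GT by auto
  have dG: "(G has_derivative DG x) (at x)"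
    unfolding DG_def by (rule smooth_on_has_derivative[OF G U(2)])
  have dDG: "((\<lambda>y. DG y w) has_derivative H w) (at x)" for w
    unfolding DG_def H_def by (rule smooth_on_has_derivative[OF smooth_on_frechet[OF G] U(2)])
  have Hsym: "H w u = H u w" for w u
    unfolding H_def DG_def by (rule second_derivative_symmetric[OF U G])
  have D: "((\<lambda>z. \<alpha> z w) has_derivative D w) (at (G x))" for w
    unfolding D_def using da[OF GxT] by (simp add: frechet_derivative_works)
  have altx: "alternating_form k (\<alpha> (G x))" by (rule alt[OF GxT])
  have der: "frechet_derivative (\<lambda>y. \<alpha> (G y) (\<lambda>i. DG y (w i))) (at x) u =
     D (\<lambda>i. DG x (w i)) (DG x u) + (\<Sum>j<k. \<alpha> (G x) ((\<lambda>i. DG x (w i))(j := H (w j) u)))" for w u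
  proof -
    have h: "((\<lambda>y. \<alpha> (G y) (\<lambda>i. DG y (w i))) has_derivative (\<lambda>u. D (\<lambda>i. DG x (w i)) (DG x u) +
        (\<Sum>j<k. \<alpha> (G x) ((\<lambda>i. DG x (w i))(j := H (w j) u))))) (at x)"
      by (rule multilinear_form_field_has_derivative[OF dG U T GT alternating_imp_multilinear[OF alt] D dDG])
    show ?thesis by (rule fun_cong[OF frechet_derivative_at[OF h], symmetric])
  qed
  have om: "(\<lambda>i. DG x (omit l v i)) = omit l (\<lambda>i. DG x (v i))" for l
    by (auto simp: omit_def)
  have "ext_deriv k (\<lambda>y v. \<alpha> (G y) (\<lambda>i. DG y (v i))) x v =
      (\<Sum>i\<le>k. (-1) ^ i * frechet_derivative (\<lambda>y. \<alpha> (G y) (\<lambda>j. DG y (omit i v j))) (at x) (v i))"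
    unfolding ext_deriv_def omit_def ..
  also have "\<dots> = (\<Sum>i\<le>k. (-1) ^ i * D (omit i (\<lambda>i. DG x (v i))) (DG x (v i))) +
      (\<Sum>i\<le>k. (-1) ^ i * (\<Sum>j<k. \<alpha> (G x) ((omit i (\<lambda>i. DG x (v i)))(j := H (omit i v j) (v i)))))"
    unfolding der om by (simp add: distrib_left sum.distrib)
  also have "(\<Sum>i\<le>k. (-1) ^ i * (\<Sum>j<k. \<alpha> (G x) ((omit i (\<lambda>i. DG x (v i)))(j := H (omit i v j) (v i))))) = 0"
  proof (cases k)
    case (Suc n)
    \<comment> \<open>\<open>F\<close> carries the second-derivative terms, with the two directions
      of differentiation in slots 0 and 1. Swapping these slots leaves \<open>F\<close> unchanged,
      so its \<open>altsum\<close> equals its own negative.\<close>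
    define F where "F w = \<alpha> (G x) (case_nat (H (w 1) (w 0)) (\<lambda>i. DG x (w (Suc (Suc i)))))" for w
    have linDG: "linear (DG x)" by (rule has_derivative_linear[OF dG])
    have alt1: "alternating_form n (\<lambda>w. \<alpha> (G x) (case_nat q (\<lambda>i. DG x (w i))))" for q
      by (rule alternating_form_linear_comp[OF alternating_form_case_nat[OF altx[unfolded Suc]] linDG])
    have move: "\<alpha> (G x) (W(j := q)) = (-1) ^ j * \<alpha> (G x) (case_nat q (omit j W))" if "j < k" for W j q
    proof -
      have "omit j (W(j := q)) = omit j W" by (auto simp: omit_def)
      then show ?thesis using alternating_form_move[OF altx that, of "W(j := q)"]
        by (simp flip: power_add mult.assoc mult_2)
    qed
    have "altsum (Suc (Suc n)) F v = (\<Sum>i\<le>Suc n. (-1) ^ i * (\<Sum>j\<le>n. (-1) ^ j *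
        altsum n (\<lambda>w. \<alpha> (G x) (case_nat (H (omit i v j) (v i)) (\<lambda>i. DG x (w i)))) (omit j (omit i v))))"
      by (simp add: altsum_Suc[of "Suc n"] altsum_Suc[of n] F_def)
    also have "\<dots> = fact n * (\<Sum>i\<le>k. (-1) ^ i * (\<Sum>j<k. \<alpha> (G x) ((omit i (\<lambda>i. DG x (v i)))(j := H (omit i v j) (v i)))))"
    proof -
      have om2: "(\<lambda>l. DG x (omit j (omit i v) l)) = omit j (omit i (\<lambda>i. DG x (v i)))" for i j
        by (auto simp: omit_def)
      have "(\<Sum>j<k. \<alpha> (G x) ((omit i (\<lambda>i. DG x (v i)))(j := H (omit i v j) (v i)))) =
         (\<Sum>j\<le>n. (-1) ^ j * \<alpha> (G x) (case_nat (H (omit i v j) (v i)) (omit j (omit i (\<lambda>i. DG x (v i))))))" for i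
        unfolding Suc lessThan_Suc_atMost by (intro sum.cong refl move) (simp add: Suc)
      then show ?thesis
        by (simp only: altsum_alternating[OF alt1] om2 Suc sum_distrib_left) (simp add: mult_ac)
    qed
    finally have *: "altsum (Suc k) F v = fact n * (\<Sum>i\<le>k. (-1) ^ i * (\<Sum>j<k. \<alpha> (G x) ((omit i (\<lambda>i. DG x (v i)))(j := H (omit i v j) (v i)))))"
      unfolding Suc .
    have "F (w \<circ> Transposition.transpose 0 1) = F w" for w
      by (simp add: F_def Hsym)
    moreover have "Transposition.transpose 0 1 permutes {..<Suc k}"
      by (rule permutes_swap_id) (auto simp: Suc)
    ultimately have "altsum (Suc k) F v = - altsum (Suc k) F v"
      using altsum_permute_arg[of "Transposition.transpose 0 1" "Suc k" F v] by (simp add: sign_swap_id)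
    then show ?thesis using * by simp
  qed simp
  also have "(\<Sum>i\<le>k. (-1) ^ i * D (omit i (\<lambda>i. DG x (v i))) (DG x (v i))) =
      ext_deriv k \<alpha> (G x) (\<lambda>i. DG x (v i))"
    by (simp add: ext_deriv_def D_def omit_def)
  finally show ?thesis by (simp add: DG_def)
qed

section \<open>Hermitian matrices, their fundamental forms and densities\<close>

text \<open>Linear in the first argument, as in \<open>hermitian_metric\<close>; the real part is
  the Euclidean product of the underlying real space.\<close>

definition cip :: "complex ^ 'n::finite \<Rightarrow> complex ^ 'n \<Rightarrow> complex" where
  "cip u v = (\<Sum>k\<in>UNIV. u $ k * cnj (v $ k))"

definition adj :: "complex ^ 'n ^ 'm \<Rightarrow> complex ^ 'm ^ 'n" where
  "adj A = (\<chi> i j. cnj (A $ j $ i))"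

definition hpd :: "complex ^ 'n::finite ^ 'n \<Rightarrow> bool" where
  "hpd A \<longleftrightarrow> adj A = A \<and> (\<forall>u. u \<noteq> 0 \<longrightarrow> 0 < Re (cip (A *v u) u))"

text \<open>Fundamental form of the Hermitian metric with matrix \<open>A\<close>, with the sign of
  \<open>fundamental_form\<close>.\<close>

definition om :: "complex ^ 'n::finite ^ 'n \<Rightarrow> complex ^ 'n \<Rightarrow> complex ^ 'n \<Rightarrow> real" where
  "om A u v = - Im (cip (A *v u) v)"

lemma Re_cip: "Re (cip u v) = u \<bullet> v"
  by (simp add: cip_def inner_vec_def inner_complex_def)

lemma cip_add_left: "cip (u + v) w = cip u w + cip v w"
  and cip_add_right: "cip u (v + w) = cip u v + cip u w"
  and cip_smult_left: "cip (c *s u) v = c * cip u v"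
  and cip_smult_right: "cip u (c *s v) = cnj c * cip u v"
  and cip_scaleR_left: "cip (r *\<^sub>R u) v = of_real r * cip u v"
  and cip_scaleR_right: "cip u (r *\<^sub>R v) = of_real r * cip u v"
  by (simp_all add: cip_def algebra_simps sum.distrib sum_distrib_left scaleR_conv_of_real[where 'a = complex])

lemma cip_commute: "cip v u = cnj (cip u v)"
  by (simp add: cip_def mult.commute)

lemma cip_adj: "cip (A *v u) v = cip u (adj A *v v)"
proof -
  have "cip (A *v u) v = (\<Sum>k\<in>UNIV. \<Sum>j\<in>UNIV. A $ k $ j * u $ j * cnj (v $ k))"
    by (simp add: cip_def matrix_vector_mult_def sum_distrib_right)
  also have "\<dots> = (\<Sum>j\<in>UNIV. \<Sum>k\<in>UNIV. A $ k $ j * u $ j * cnj (v $ k))" by (rule sum.swap)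
  also have "\<dots> = cip u (adj A *v v)"
    by (simp add: cip_def matrix_vector_mult_def sum_distrib_left adj_def mult_ac)
  finally show ?thesis .
qed

lemma adj_adj [simp]: "adj (adj A) = A"
  and adj_mat_1 [simp]: "adj (mat 1) = mat 1"
  and adj_add: "adj (A + B) = adj A + adj B"
  and adj_scaleR: "adj (r *\<^sub>R A) = r *\<^sub>R adj A"
  by (auto simp: adj_def vec_eq_iff mat_def)

lemma adj_mult: "adj (A ** B) = adj B ** adj A"
  by (simp add: adj_def matrix_matrix_mult_def vec_eq_iff mult.commute)

lemma matrix_vector_scaleR_left: "(r *\<^sub>R A) *v u = r *\<^sub>R (A *v (u :: complex ^ 'n))"
  and matrix_vector_scaleR_right: "A *v (r *\<^sub>R u) = r *\<^sub>R (A *v (u :: complex ^ 'n))"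
  by (simp_all add: vec_eq_iff matrix_vector_mult_def scaleR_sum_right)

lemma linear_matrix_vector: "linear ((*v) (A :: complex ^ 'n ^ 'm))"
  by (rule linearI) (simp_all add: matrix_vector_right_distrib matrix_vector_scaleR_right)

lemma bilinear_om: "bilinear (om A)"
  by (auto simp: bilinear_def om_def linear_iff matrix_vector_right_distrib cip_add_left cip_add_right
      matrix_vector_scaleR_right cip_scaleR_left cip_scaleR_right)

lemma om_scaleR: "om (r *\<^sub>R A) u v = r * om A u v"
  by (simp add: om_def matrix_vector_scaleR_left cip_scaleR_left)

lemma om_pullback: "om (adj D ** A ** D) u v = om A (D *v u) (D *v v)"
proof -
  have "(adj D ** A ** D) *v u = adj D *v (A *v (D *v u))"
    by (simp add: matrix_vector_mul_assoc matrix_mul_assoc)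
  then show ?thesis by (simp add: om_def cip_adj[of "adj D"])
qed

section \<open>Inverses and positivity of Hermitian matrices\<close>

lemma matrix_inv_works:
  fixes A :: "complex ^ 'n::finite ^ 'n"
  assumes "invertible A"
  shows "A ** matrix_inv A = mat 1" "matrix_inv A ** A = mat 1"
  using someI_ex[of "\<lambda>B. A ** B = mat 1 \<and> B ** A = mat 1"] assms
  by (auto simp: matrix_inv_def invertible_def)

lemma matrix_inv_unique:
  fixes A :: "complex ^ 'n::finite ^ 'n"
  assumes "A ** B = mat 1"
  shows "invertible A" "matrix_inv A = B"
proof -
  show i: "invertible A"
    using assms matrix_left_right_inverse[of A B] by (auto simp: invertible_def)
  have "matrix_inv A = matrix_inv A ** (A ** B)" by (simp add: assms matrix_mul_rid)
  also have "\<dots> = B" by (simp add: matrix_mul_assoc matrix_inv_works[OF i] matrix_mul_lid)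
  finally show "matrix_inv A = B" .
qed

lemma invertible_mult_vec_neq_0:
  fixes A :: "complex ^ 'n::finite ^ 'n"
  assumes "invertible A" "u \<noteq> 0"
  shows "A *v u \<noteq> 0"
proof
  assume "A *v u = 0"
  then have "(matrix_inv A ** A) *v u = 0" by (simp flip: matrix_vector_mul_assoc)
  then show False using assms by (simp add: matrix_inv_works)
qed

lemma invertible_adj:
  fixes A :: "complex ^ 'n::finite ^ 'n"
  assumes "invertible A"
  shows "invertible (adj A)" "matrix_inv (adj A) = adj (matrix_inv A)"
proof -
  have "adj A ** adj (matrix_inv A) = mat 1"
    by (simp add: matrix_inv_works[OF assms] flip: adj_mult)
  from matrix_inv_unique[OF this] show "invertible (adj A)" "matrix_inv (adj A) = adj (matrix_inv A)" .
qed

lemma hpd_invertible: "hpd A \<Longrightarrow> invertible A"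
  unfolding invertible_left_inverse matrix_left_invertible_ker hpd_def
  by (metis Re_cip inner_zero_left less_irrefl)

lemma hpd_mat_1: "hpd (mat 1)"
  by (simp add: hpd_def Re_cip)

lemma hpd_add: "hpd A \<Longrightarrow> hpd B \<Longrightarrow> hpd (A + B)"
  by (simp add: hpd_def adj_add matrix_vector_mult_add_rdistrib cip_add_left add_pos_pos)

lemma hpd_scaleR: "hpd A \<Longrightarrow> 0 < r \<Longrightarrow> hpd (r *\<^sub>R A)"
  by (simp add: hpd_def adj_scaleR matrix_vector_scaleR_left cip_scaleR_left)

lemma hpd_pullback:
  fixes A D :: "complex ^ 'n::finite ^ 'n"
  assumes "hpd A" "invertible D"
  shows "hpd (adj D ** A ** D)"
proof -
  have "(adj D ** A ** D) *v u = adj D *v (A *v (D *v u))" for u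
    by (simp add: matrix_vector_mul_assoc matrix_mul_assoc)
  then show ?thesis
    using assms invertible_mult_vec_neq_0[OF assms(2)]
    by (simp add: hpd_def adj_mult matrix_mul_assoc cip_adj[of "adj D"])
qed

lemma hpd_matrix_inv: "hpd A \<Longrightarrow> hpd (matrix_inv A)"
proof -
  assume A: "hpd A"
  note i = hpd_invertible[OF A]
  have s: "adj (matrix_inv A) = matrix_inv A"
    using invertible_adj(2)[OF i] A by (simp add: hpd_def)
  have "0 < Re (cip (matrix_inv A *v u) u)" if "u \<noteq> 0" for u
  proof -
    define w where "w = matrix_inv A *v u"
    have u: "u = A *v w" by (simp add: w_def matrix_vector_mul_assoc matrix_inv_works[OF i])
    with that have "w \<noteq> 0" by auto
    then have "0 < Re (cip (A *v w) w)" using A by (simp add: hpd_def)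
    then have "0 < Re (cip u w)" by (simp only: u)
    then show ?thesis unfolding w_def[symmetric] by (subst cip_commute) simp
  qed
  with s show ?thesis by (simp add: hpd_def)
qed

text \<open>The factor -\<i> turns -Im into Re, and the real part of \<open>cip\<close> is the
  Euclidean product; so the inverse bivector is -\<i> times the inverse matrix.\<close>

lemma hpd_symplectic:
  assumes "hpd A"
  shows "symplectic (om A) (\<lambda>b. (- \<i>) *s (matrix_inv A *v b))"
proof -
  have 1: "bilinear (om A)" by (rule bilinear_om)
  have 2: "om A x y = - om A y x" for x y
  proof -
    have "cip (A *v x) y = cnj (cip (A *v y) x)"
      using assms cip_adj[of A x y] cip_commute[of "A *v y" x] by (simp add: hpd_def)
    then show ?thesis by (simp add: om_def)
  qed
  have 3: "linear (\<lambda>b. (- \<i>) *s (matrix_inv A *v b))"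
    by (rule linearI) (simp_all add: matrix_vector_right_distrib matrix_vector_scaleR_right vec_eq_iff algebra_simps)
  have 4: "om A ((- \<i>) *s (matrix_inv A *v b)) y = b \<bullet> y" for b y
  proof -
    have "A *v ((- \<i>) *s (matrix_inv A *v b)) = (- \<i>) *s ((A ** matrix_inv A) *v b)"
      by (simp only: vector_scalar_commute matrix_vector_mul_assoc)
    then show ?thesis
      by (simp only: om_def matrix_inv_works[OF hpd_invertible[OF assms]] matrix_vector_mul_lid cip_smult_left)
        (simp add: Re_cip)
  qed
  show ?thesis unfolding symplectic_def by (intro conjI allI 1 2 3 4)
qed

section \<open>Normalised volume form, densities and real determinants\<close>

lemma dim_complex_vec: "DIM(complex ^ 'n::finite) = 2 * CARD('n)"
  by simp

text \<open>Any list on which the standard top power does not vanish. It only fixes the scale of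
  \<open>vol\<close>, which takes the value 1 on it.\<close>

definition ref_list :: "nat \<Rightarrow> complex ^ 'n::finite" where
  "ref_list = (SOME v. om_power (om (mat 1)) CARD('n) v \<noteq> 0)"

definition vol :: "(nat \<Rightarrow> complex ^ 'n::finite) \<Rightarrow> real" where
  "vol v = om_power (om (mat 1)) CARD('n) v / om_power (om (mat 1)) CARD('n) (ref_list :: nat \<Rightarrow> complex ^ 'n)"

text \<open>The ratio of the top power of the form of \<open>A\<close> to that of the standard form.
  For positive Hermitian \<open>A\<close> it is the determinant of \<open>A\<close>.\<close>

definition hdensity :: "complex ^ 'n::finite ^ 'n \<Rightarrow> real" where
  "hdensity A = om_power (om A) CARD('n) (ref_list :: nat \<Rightarrow> complex ^ 'n) /
     om_power (om (mat 1)) CARD('n) (ref_list :: nat \<Rightarrow> complex ^ 'n)"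

lemma ref_list_nonzero: "om_power (om (mat 1)) CARD('n) (ref_list :: nat \<Rightarrow> complex ^ 'n::finite) \<noteq> 0"
proof -
  have "\<exists>v. om_power (om (mat 1 :: complex ^ 'n ^ 'n)) CARD('n) v \<noteq> 0"
    by (rule symplectic.om_power_nonzero[OF hpd_symplectic[OF hpd_mat_1]]) simp
  from someI_ex[OF this] show ?thesis by (simp only: ref_list_def not_False_eq_True)
qed

lemma alternating_top:
  "alternating_form DIM(complex ^ 'n::finite) (om_power (om (A :: complex ^ 'n ^ 'n)) CARD('n))"
  unfolding dim_complex_vec by (rule alternating_om_power[OF bilinear_om])

lemma alternating_vol: "alternating_form DIM(complex ^ 'n) (vol :: (nat \<Rightarrow> complex ^ 'n::finite) \<Rightarrow> real)"
proof -
  have eq: "vol = (\<lambda>v :: nat \<Rightarrow> complex ^ 'n. (1 / om_power (om (mat 1)) CARD('n) (ref_list :: nat \<Rightarrow> complex ^ 'n))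
      * om_power (om (mat 1)) CARD('n) v + 0 * om_power (om (mat 1)) CARD('n) v)"
    by (auto simp: vol_def)
  show ?thesis unfolding eq by (rule alternating_form_combine[OF alternating_top alternating_top])
qed

lemma vol_ref_list [simp]: "vol ref_list = 1"
  unfolding vol_def by (rule divide_self[OF ref_list_nonzero])

lemma top_form_eq_vol:
  assumes "alternating_form DIM(complex ^ 'n) (\<alpha> :: (nat \<Rightarrow> complex ^ 'n::finite) \<Rightarrow> real)"
  shows "\<alpha> v = \<alpha> ref_list * vol v"
  using top_forms_proportional[OF assms alternating_vol, of v ref_list] by simp

lemma om_power_density:
  fixes A :: "complex ^ 'n::finite ^ 'n"
  shows "om_power (om A) CARD('n) v =
    hdensity A * (om_power (om (mat 1)) CARD('n) (ref_list :: nat \<Rightarrow> complex ^ 'n) * vol v)"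
  using top_form_eq_vol[OF alternating_top, of A v] ref_list_nonzero[where 'n = 'n]
  by (simp add: hdensity_def)

lemma wedge_cmult: "wedge p q (\<lambda>v. a * \<alpha> v) (\<lambda>v. b * \<beta> v) v = a * b * wedge p q \<alpha> \<beta> v"
  by (simp add: wedge_def sum_distrib_left mult_ac)

lemma om_power_scale: "om_power (\<lambda>u v. c * f u v) k v = c ^ k * om_power f k v"
proof (induction k arbitrary: v)
  case (Suc k)
  then have "om_power (\<lambda>u v. c * f u v) k = (\<lambda>v. c ^ k * om_power f k v)" by auto
  then show ?case by (simp add: wedge_cmult)
qed simp

lemma om_power_natural: "om_power (\<lambda>u v. g (f u) (f v)) k v = om_power g k (\<lambda>i. f (v i))"
proof (induction k arbitrary: v)
  case (Suc k)
  then have "om_power (\<lambda>u v. g (f u) (f v)) k = (\<lambda>v. om_power g k (\<lambda>i. f (v i)))" by auto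
  then show ?case by (simp add: wedge_def)
qed simp

lemma density_scaleR: "hdensity (r *\<^sub>R (A :: complex ^ 'n::finite ^ 'n)) = r ^ CARD('n) * hdensity A"
proof -
  have eq: "om (r *\<^sub>R A) = (\<lambda>u v. r * om A u v)" by (intro ext om_scaleR)
  show ?thesis by (simp only: hdensity_def eq om_power_scale times_divide_eq_right)
qed

text \<open>The real determinant; for a complex-linear map it is the squared modulus of the complex
  determinant.\<close>

definition form_det :: "('v::euclidean_space \<Rightarrow> 'v) \<Rightarrow> real" where
  "form_det f = (SOME J. \<forall>\<alpha> v. alternating_form DIM('v) \<alpha> \<longrightarrow> \<alpha> (\<lambda>i. f (v i)) = J * \<alpha> v)"

lemma form_det:
  fixes f :: "'v::euclidean_space \<Rightarrow> 'v"
  assumes "linear f" "alternating_form DIM('v) \<alpha>"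
  shows "\<alpha> (\<lambda>i. f (v i)) = form_det f * \<alpha> v"
  using someI_ex[OF ex_form_det[OF assms(1)]] assms(2) unfolding form_det_def by blast

lemma density_pullback: "hdensity (adj D ** A ** D) = form_det ((*v) D) * hdensity A"
proof -
  have eq: "om (adj D ** A ** D) = (\<lambda>u v. om A (D *v u) (D *v v))" by (intro ext om_pullback)
  show ?thesis
    by (simp only: hdensity_def eq om_power_natural[of "om A" "(*v) D"]
        form_det[OF linear_matrix_vector alternating_top] times_divide_eq_right)
qed

lemma smooth_on_om_power:
  assumes "open S" "\<And>u v. smooth_on S (\<lambda>x. f x u v)"
  shows "smooth_on S (\<lambda>x. om_power (f x) k v)"
proof (induction k arbitrary: v)
  case (Suc k)
  show ?case
    unfolding two_form_power.simps wedge_def divide_inverse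
    by (intro smooth_on_mult smooth_on_sum smooth_on_const assms Suc)
qed (simp add: smooth_on_const assms)

lemma smooth_on_cip:
  assumes "open S" "smooth_on S f"
  shows "smooth_on S (\<lambda>x. cip (f x) v)"
  unfolding cip_def by (intro smooth_on_sum smooth_on_mult smooth_on_vec_nth smooth_on_const assms)

lemma smooth_on_matrix_vector:
  fixes A :: "'a::real_normed_vector \<Rightarrow> complex ^ 'n::finite ^ 'm::finite"
  assumes "open S" "smooth_on S A" "smooth_on S u"
  shows "smooth_on S (\<lambda>x. A x *v u x)"
  unfolding matrix_vector_mult_def
  by (intro smooth_on_vec_lambda smooth_on_sum smooth_on_mult smooth_on_vec_nth assms)

lemma smooth_on_om:
  assumes "open S" "smooth_on S A"
  shows "smooth_on S (\<lambda>x. om (A x) u v)"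
  unfolding om_def
  by (intro smooth_on_minus smooth_on_linear_compose[OF _ bounded_linear_Im] smooth_on_cip
      smooth_on_matrix_vector smooth_on_const assms)

lemma smooth_on_density:
  assumes "open S" "smooth_on S A"
  shows "smooth_on S (\<lambda>x. hdensity (A x))"
  unfolding hdensity_def divide_inverse
  by (intro smooth_on_mult smooth_on_om_power smooth_on_om smooth_on_const assms)

lemma density_nonzero: "hpd A \<Longrightarrow> hdensity A \<noteq> 0"
proof
  fix A :: "complex ^ 'n::finite ^ 'n" assume A: "hpd A" "hdensity A = 0"
  interpret symplectic "om A" "\<lambda>b. (- \<i>) *s (matrix_inv A *v b)" by (rule hpd_symplectic[OF A(1)])
  obtain v where "om_power (om A) CARD('n) v \<noteq> 0" using om_power_nonzero[of "CARD('n)"] by auto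
  then show False using om_power_density[of A v] A(2) by simp
qed

lemma density_mat_1 [simp]: "hdensity (mat 1) = 1"
  unfolding hdensity_def by (rule divide_self[OF ref_list_nonzero])

text \<open>Positivity follows by deforming \<open>A\<close> to the identity.\<close>

lemma density_pos:
  assumes A: "hpd A"
  shows "0 < hdensity A"
proof (rule ccontr)
  assume "\<not> 0 < hdensity A"
  define P where "P t = mat 1 + t *\<^sub>R (A - mat 1)" for t :: real
  have P: "P t = (1 - t) *\<^sub>R mat 1 + t *\<^sub>R A" for t by (simp add: P_def algebra_simps)
  have "smooth_on UNIV P"
    unfolding P_def by (intro smooth_on_add smooth_on_scaleR smooth_on_const smooth_on_linear bounded_linear_ident open_UNIV)
  then have "continuous_on UNIV (\<lambda>t. hdensity (P t))"
    by (intro smooth_on_continuous smooth_on_density) auto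
  then have "continuous_on {0..1} (\<lambda>t. hdensity (P t))" by (rule continuous_on_subset) auto
  moreover have "hdensity (P 1) \<le> 0" "0 \<le> hdensity (P 0)"
    using \<open>\<not> 0 < hdensity A\<close> by (auto simp: P_def)
  ultimately obtain t where t: "0 \<le> t" "t \<le> 1" "hdensity (P t) = 0"
    using IVT2'[of "\<lambda>t. hdensity (P t)" 1 0 0] by auto
  have "hpd (P t)"
  proof (cases "t = 0 \<or> t = 1")
    case True
    then show ?thesis using A hpd_mat_1 by (auto simp: P_def)
  next
    case False
    then show ?thesis unfolding P using t by (intro hpd_add hpd_scaleR hpd_mat_1 A) auto
  qed
  then show False using density_nonzero t(3) by blast
qed

text \<open>Complex-linear maps preserve orientation: the factor is the density of the positive
  matrix \<open>adj D ** mat 1 ** D\<close>.\<close>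

lemma form_det_pos:
  fixes D :: "complex ^ 'n::finite ^ 'n"
  assumes "invertible D"
  shows "0 < form_det ((*v) D)"
  using density_pullback[of D "mat 1"] density_pos[OF hpd_pullback[OF hpd_mat_1 assms]] by simp

text \<open>Up to a constant, \<open>\<omega>\<^sup>N\<^sup>-\<^sup>1\<close> is the contraction of the volume form with the bivector
  \<open>b \<mapsto> - \<i> (ldual A) b\<close>; hence it determines \<open>ldual A\<close>, depends linearly on it, and is closed iff
  \<open>ldual A\<close> is divergence free.\<close>

definition ldual :: "complex ^ 'n::finite ^ 'n \<Rightarrow> complex ^ 'n ^ 'n" where
  "ldual A = hdensity A *\<^sub>R matrix_inv A"

text \<open>Differentiability at \<open>x\<close> is part of the notion. The real basis pairs the
  directions 1 and \<i> of each coordinate, so that entry k of the sum is twice the sum over j of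
  the derivatives of L k j with respect to the conjugate of z j.\<close>

definition divfree :: "(complex ^ 'n::finite \<Rightarrow> complex ^ 'n ^ 'n) \<Rightarrow> complex ^ 'n \<Rightarrow> bool" where
  "divfree L x \<longleftrightarrow> (\<exists>L'. (L has_derivative L') (at x) \<and> (\<Sum>b\<in>Basis. L' b *v b) = 0)"

lemma hpd_ldual: "hpd A \<Longrightarrow> hpd (ldual A)"
  unfolding ldual_def by (intro hpd_scaleR hpd_matrix_inv density_pos)

lemma linear_matrix_apply: "linear (\<lambda>A :: complex ^ 'n ^ 'm. (- \<i>) *s (A *v b))"
  by (rule linearI) (simp_all add: matrix_vector_mult_add_rdistrib matrix_vector_scaleR_left vec_eq_iff algebra_simps)

lemma ext_deriv_om_power_ldual:
  fixes A :: "complex ^ 'n::finite \<Rightarrow> complex ^ 'n ^ 'n"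
  assumes N: "CARD('n) = Suc k" and U: "open U" "x \<in> U" and A: "\<And>y. y \<in> U \<Longrightarrow> hpd (A y)"
    and der: "((\<lambda>y. ldual (A y)) has_derivative L') (at x)"
  shows "ext_deriv (2 * k) (\<lambda>y. om_power (om (A y)) k) x v =
    (1 / real (Suc k)) * (om_power (om (mat 1)) CARD('n) (ref_list :: nat \<Rightarrow> complex ^ 'n) *
      vol (case_nat ((- \<i>) *s (\<Sum>b\<in>Basis. L' b *v b)) v))"
proof -
  define c where "c = om_power (om (mat 1)) CARD('n) (ref_list :: nat \<Rightarrow> complex ^ 'n)"
  have "ext_deriv (2 * k) (\<lambda>y. om_power (om (A y)) k) x v =
    (1 / real (Suc k)) * (c * vol (case_nat (\<Sum>b\<in>Basis. (- \<i>) *s (L' b *v b)) v))"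
  proof (rule ext_deriv_om_power[where sh = "\<lambda>y b. (- \<i>) *s (matrix_inv (A y) *v b)" and \<phi> = "\<lambda>y. hdensity (A y)"
        and K' = "\<lambda>b u. (- \<i>) *s (L' u *v b)" and U = U])
    show "DIM(complex ^ 'n) = 2 * Suc k" by (simp add: N)
    show "symplectic (om (A y)) (\<lambda>b. (- \<i>) *s (matrix_inv (A y) *v b))" if "y \<in> U" for y
      by (rule hpd_symplectic[OF A[OF that]])
    show "alternating_form DIM(complex ^ 'n) (\<lambda>v :: nat \<Rightarrow> complex ^ 'n. c * vol v)"
      using alternating_form_combine[OF alternating_vol[where 'n = 'n] alternating_vol[where 'n = 'n], of c 0]
      by simp
    show "om_power (om (A y)) (Suc k) v = hdensity (A y) * (c * vol v)" for y v
      using om_power_density[of "A y" v] by (simp only: c_def N)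
    show "((\<lambda>y. hdensity (A y) *\<^sub>R ((- \<i>) *s (matrix_inv (A y) *v b))) has_derivative
        (\<lambda>u. (- \<i>) *s (L' u *v b))) (at x)" for b
    proof -
      have "((\<lambda>y. (- \<i>) *s (ldual (A y) *v b)) has_derivative (\<lambda>u. (- \<i>) *s (L' u *v b))) (at x)"
        by (rule bounded_linear.has_derivative[OF linear_conv_bounded_linear[THEN iffD1, OF linear_matrix_apply] der])
      moreover have "(- \<i>) *s (ldual (A y) *v b) = hdensity (A y) *\<^sub>R ((- \<i>) *s (matrix_inv (A y) *v b))" for y
        by (simp add: ldual_def matrix_vector_scaleR_left vec_eq_iff)
      ultimately show ?thesis by (simp only:)
    qed
  qed (use U in auto)
  also have "(\<Sum>b\<in>Basis. (- \<i>) *s (L' b *v b)) = (- \<i>) *s (\<Sum>b\<in>Basis. L' b *v b)"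
    by (simp add: vec_eq_iff sum_distrib_left sum_negf)
  finally show ?thesis unfolding c_def .
qed

text \<open>The bivector is -\<i> times \<open>ldual\<close>, hence so is its divergence, and a
  nonzero volume form detects whether the vector contracted into it is 0.\<close>

lemma ext_deriv_om_power_eq_0_iff:
  fixes A :: "complex ^ 'n::finite \<Rightarrow> complex ^ 'n ^ 'n"
  assumes N: "CARD('n) = Suc k" and U: "open U" "x \<in> U" and A: "\<And>y. y \<in> U \<Longrightarrow> hpd (A y)"
    and der: "((\<lambda>y. ldual (A y)) has_derivative L') (at x)"
  shows "(\<forall>v. ext_deriv (2 * k) (\<lambda>y. om_power (om (A y)) k) x v = 0) \<longleftrightarrow> divfree (\<lambda>y. ldual (A y)) x"
proof
  have e: "ext_deriv (2 * k) (\<lambda>y. om_power (om (A y)) k) x v =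
    (1 / real (Suc k)) * (om_power (om (mat 1)) CARD('n) (ref_list :: nat \<Rightarrow> complex ^ 'n) *
      vol (case_nat ((- \<i>) *s (\<Sum>b\<in>Basis. L' b *v b)) v))" for v
    by (rule ext_deriv_om_power_ldual[OF assms])
  {
    assume h: "\<forall>v. ext_deriv (2 * k) (\<lambda>y. om_power (om (A y)) k) x v = 0"
    have "vol (case_nat ((- \<i>) *s (\<Sum>b\<in>Basis. L' b *v b)) v) = 0" for v
    proof -
      have "(1 / real (Suc k)) * (om_power (om (mat 1)) CARD('n) (ref_list :: nat \<Rightarrow> complex ^ 'n) *
          vol (case_nat ((- \<i>) *s (\<Sum>b\<in>Basis. L' b *v b)) v)) = 0"
        by (rule trans[OF e[symmetric] spec[OF h]])
      then show ?thesis using ref_list_nonzero[where 'n = 'n] by simp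
    qed
    then have "(- \<i>) *s (\<Sum>b\<in>Basis. L' b *v b) = 0"
      by (rule top_form_nondegenerate[OF alternating_vol, of ref_list, rotated]) simp
    then have "(\<Sum>b\<in>Basis. L' b *v b) = 0" by (simp add: vec_eq_iff)
    then show "divfree (\<lambda>y. ldual (A y)) x" using der by (auto simp: divfree_def)
  }
  assume "divfree (\<lambda>y. ldual (A y)) x"
  then have z: "(\<Sum>b\<in>Basis. L' b *v b) = 0"
    using has_derivative_unique[OF der] by (auto simp: divfree_def)
  have "linear (\<lambda>z. vol (case_nat z v))" for v :: "nat \<Rightarrow> complex ^ 'n"
    by (rule linear_case_nat[OF alternating_imp_multilinear[OF alternating_vol]]) simp
  then have v0: "vol (case_nat 0 v) = 0" for v :: "nat \<Rightarrow> complex ^ 'n" by (rule linear_0)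
  have z': "(- \<i>) *s (\<Sum>b\<in>Basis. L' b *v b) = 0" unfolding z by (simp add: vec_eq_iff)
  show "\<forall>v. ext_deriv (2 * k) (\<lambda>y. om_power (om (A y)) k) x v = 0"
  proof
    fix v
    show "ext_deriv (2 * k) (\<lambda>y. om_power (om (A y)) k) x v = 0"
      unfolding e z' v0 by simp
  qed
qed

lemma divfree_add: "divfree L x \<Longrightarrow> divfree M x \<Longrightarrow> divfree (\<lambda>y. L y + M y) x"
  unfolding divfree_def
proof (elim exE conjE)
  fix L' M' assume "(L has_derivative L') (at x)" "(M has_derivative M') (at x)"
    "(\<Sum>b\<in>Basis. L' b *v b) = 0" "(\<Sum>b\<in>Basis. M' b *v b) = 0"
  then show "\<exists>N. ((\<lambda>y. L y + M y) has_derivative N) (at x) \<and> (\<Sum>b\<in>Basis. N b *v b) = 0"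
    by (intro exI[of _ "\<lambda>b. L' b + M' b"])
      (simp add: has_derivative_add matrix_vector_mult_add_rdistrib sum.distrib)
qed

lemma divfree_0: "divfree (\<lambda>y. 0) x"
  unfolding divfree_def by (intro exI[of _ "\<lambda>_. 0"]) simp

lemma divfree_sum: "(\<And>i. i \<in> I \<Longrightarrow> divfree (L i) x) \<Longrightarrow> divfree (\<lambda>y. \<Sum>i\<in>I. L i y) x"
  by (induction I rule: infinite_finite_induct) (simp_all add: divfree_0 divfree_add)

lemma divfree_cong:
  assumes "open U" "x \<in> U" "\<And>y. y \<in> U \<Longrightarrow> L y = M y" "divfree L x"
  shows "divfree M x"
  using assms(4) has_derivative_transform_within_open[of L _ x UNIV U M] assms(1-3)
  unfolding divfree_def by blast

section \<open>Smooth dependence on the matrix and behaviour under pullback\<close>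

lemma smooth_on_det:
  assumes "open S" "smooth_on S (A :: _ \<Rightarrow> complex ^ 'n::finite ^ 'n)"
  shows "smooth_on S (\<lambda>x. det (A x))"
  unfolding det_def by (intro smooth_on_sum smooth_on_mult smooth_on_prod smooth_on_const smooth_on_vec_nth assms)

lemma smooth_on_inverse_compose:
  fixes f :: "'a::real_normed_vector \<Rightarrow> 'b::{real_normed_field,euclidean_space}"
  assumes "open S" "smooth_on S f" "\<And>x. x \<in> S \<Longrightarrow> f x \<noteq> 0"
  shows "smooth_on S (\<lambda>x. inverse (f x))"
  by (rule smooth_on_compose[OF assms(1) _ _ smooth_on_inverse assms(2)]) (use assms(3) in auto)

lemma matrix_vector_axis: "(B *v axis l 1) $ k = (B :: complex ^ 'n::finite ^ 'm) $ k $ l"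
  by (simp add: matrix_vector_mult_def axis_def if_distrib cong: if_cong)

text \<open>Cramer's rule: the entries of the inverse are quotients of determinants.\<close>

lemma smooth_on_matrix_inv:
  fixes A :: "'a::real_normed_vector \<Rightarrow> complex ^ 'n::finite ^ 'n"
  assumes S: "open S" and A: "smooth_on S A" and i: "\<And>x. x \<in> S \<Longrightarrow> invertible (A x)"
  shows "smooth_on S (\<lambda>x. matrix_inv (A x))"
proof -
  define C where "C x k l = det (\<chi> i j. if j = k then axis l 1 $ i else A x $ i $ j)" for x and k l :: 'n
  have d: "det (A x) \<noteq> 0" if "x \<in> S" for x using i[OF that] by (simp add: invertible_det_nz)
  have eq: "(\<chi> k l. C x k l * inverse (det (A x))) = matrix_inv (A x)" if "x \<in> S" for x
  proof -
    have "A x *v (matrix_inv (A x) *v axis l 1) = axis l 1" for l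
      by (simp add: matrix_vector_mul_assoc matrix_inv_works[OF i[OF that]])
    then have "(matrix_inv (A x) *v axis l 1) $ k = C x k l / det (A x)" for k l
      unfolding cramer[OF d[OF that]] by (simp add: C_def)
    then show ?thesis by (simp add: vec_eq_iff matrix_vector_axis divide_inverse)
  qed
  have "smooth_on S (\<lambda>x. C x k l)" for k l
    unfolding C_def
  proof (intro smooth_on_det S smooth_on_vec_lambda)
    show "smooth_on S (\<lambda>x. if j = k then axis l 1 $ i else A x $ i $ j)" for i j
      by (cases "j = k") (simp_all add: smooth_on_const smooth_on_vec_nth S A)
  qed
  then have sm: "smooth_on S (\<lambda>x. \<chi> k l. C x k l * inverse (det (A x)))"
    by (intro smooth_on_vec_lambda smooth_on_mult smooth_on_inverse_compose smooth_on_det S A d)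
  show ?thesis by (rule smooth_on_cong[OF S eq sm])
qed

lemma smooth_on_ldual:
  assumes "open S" "smooth_on S A" "\<And>x. x \<in> S \<Longrightarrow> hpd (A x)"
  shows "smooth_on S (\<lambda>x. ldual (A x))"
  unfolding ldual_def
  by (intro smooth_on_scaleR smooth_on_density smooth_on_matrix_inv assms hpd_invertible)

text \<open>\<open>ldual\<close> is a bivector with values in densities: the inverse matrix
  contributes inverses of \<open>D\<close>, the density contributes the real determinant.
  Multiplying by \<open>D\<close> on both sides keeps inverses out of the law.\<close>

lemma ldual_pullback:
  fixes A D :: "complex ^ 'n::finite ^ 'n"
  assumes "invertible A" "invertible D"
  shows "D ** ldual (adj D ** A ** D) ** adj D = form_det ((*v) D) *\<^sub>R ldual A"
proof -
  define E where "E = matrix_inv D ** matrix_inv A ** matrix_inv (adj D)"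
  note i = matrix_inv_works[OF assms(1)] matrix_inv_works[OF assms(2)]
    matrix_inv_works[OF invertible_adj(1)[OF assms(2)]]
  have "(adj D ** A ** D) ** E = adj D ** (A ** (D ** matrix_inv D) ** matrix_inv A) ** matrix_inv (adj D)"
    by (simp add: E_def matrix_mul_assoc)
  also have "\<dots> = mat 1" by (simp add: i)
  finally have inv: "matrix_inv (adj D ** A ** D) = E" by (rule matrix_inv_unique)
  have "D ** E ** adj D = (D ** matrix_inv D) ** matrix_inv A ** (matrix_inv (adj D) ** adj D)"
    by (simp add: E_def matrix_mul_assoc)
  also have "\<dots> = matrix_inv A" by (simp add: i)
  finally show ?thesis
    unfolding ldual_def density_pullback inv by (simp add: matrix_scalar_ac flip: scalar_matrix_assoc)
qed

text \<open>Michelsohn's root. With A = t L^(-1) and d the density of L^(-1), the dual of A is t^N d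
  (1/t) L; this equals L exactly if t^(N-1) = 1/d, which explains the exponent and the need for N
  \<ge> 2.\<close>

definition hroot :: "complex ^ 'n::finite ^ 'n \<Rightarrow> complex ^ 'n ^ 'n" where
  "hroot L = (hdensity (matrix_inv L) powr (- 1 / (real CARD('n) - 1))) *\<^sub>R matrix_inv L"

lemma hpd_hroot: "hpd L \<Longrightarrow> hpd (hroot L)"
  unfolding hroot_def using density_pos[OF hpd_matrix_inv[of L]] by (intro hpd_scaleR hpd_matrix_inv) auto

lemma ldual_hroot:
  fixes L :: "complex ^ 'n::finite ^ 'n"
  assumes L: "hpd L" and N: "CARD('n) = Suc (Suc k)"
  shows "ldual (hroot L) = L"
proof -
  define d where "d = hdensity (matrix_inv L)"
  define t where "t = d powr (- 1 / (real CARD('n) - 1))"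
  have d: "d > 0" unfolding d_def by (rule density_pos[OF hpd_matrix_inv[OF L]])
  then have t: "t > 0" by (simp add: t_def)
  have "t ^ Suc k * d = 1"
  proof -
    have "t ^ Suc k = t powr real (Suc k)" using t by (simp add: powr_realpow del: of_nat_Suc)
    also have "\<dots> = d powr (- 1)" unfolding t_def powr_powr using N by simp
    finally show ?thesis using d by (simp add: powr_minus_divide)
  qed
  moreover have "(t *\<^sub>R matrix_inv L) ** ((1 / t) *\<^sub>R L) = mat 1"
    using t by (simp add: matrix_scalar_ac matrix_inv_works[OF hpd_invertible[OF L]] flip: scalar_matrix_assoc)
  from matrix_inv_unique(2)[OF this]
  have "ldual (t *\<^sub>R matrix_inv L) = (t ^ CARD('n) * d * (1 / t)) *\<^sub>R L"
    by (simp add: ldual_def density_scaleR d_def)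
  moreover have "hroot L = t *\<^sub>R matrix_inv L" by (simp only: hroot_def t_def d_def)
  moreover have "t ^ CARD('n) * d * (1 / t) = t ^ Suc k * d" using t by (simp add: N)
  ultimately show ?thesis by (simp only: scaleR_one)
qed

text \<open>The root is canonical, so the density law for L becomes the tensor law for the metric.
  This is what makes an equivariant L descend.\<close>

lemma hroot_pullback:
  fixes L L' D :: "complex ^ 'n::finite ^ 'n"
  assumes L: "hpd L" and D: "invertible D" and N: "CARD('n) = Suc (Suc k)"
    and rel: "D ** L' ** adj D = form_det ((*v) D) *\<^sub>R L"
  shows "hroot L' = adj D ** hroot L ** D"
proof -
  define J where "J = form_det ((*v) D)"
  define d where "d = hdensity (matrix_inv L)"
  have J: "J > 0" unfolding J_def by (rule form_det_pos[OF D])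
  have d: "d > 0" unfolding d_def by (rule density_pos[OF hpd_matrix_inv[OF L]])
  note i = matrix_inv_works[OF hpd_invertible[OF L]] matrix_inv_works[OF D]
  define E where "E = adj D ** matrix_inv L ** D"
  have "L' ** E = (matrix_inv D ** D) ** L' ** adj D ** matrix_inv L ** D"
    by (simp add: E_def i matrix_mul_assoc)
  also have "\<dots> = matrix_inv D ** (D ** L' ** adj D) ** matrix_inv L ** D"
    by (simp add: matrix_mul_assoc)
  also have "\<dots> = J *\<^sub>R (matrix_inv D ** (L ** matrix_inv L) ** D)"
    unfolding rel J_def[symmetric] by (simp add: matrix_scalar_ac matrix_mul_assoc flip: scalar_matrix_assoc)
  also have "\<dots> = J *\<^sub>R mat 1" by (simp add: i)
  finally have "L' ** ((1 / J) *\<^sub>R E) = mat 1" using J by (simp add: matrix_scalar_ac flip: scalar_matrix_assoc)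
  then have inv: "matrix_inv L' = (1 / J) *\<^sub>R E" by (rule matrix_inv_unique)
  have "hdensity (matrix_inv L') = (1 / J) ^ CARD('n) * (J * d)"
    unfolding inv density_scaleR E_def density_pullback J_def d_def by simp
  \<comment> \<open>J^(-N) from the scaling and J from the pullback leave J^(-(N-1)). Its power
    -1/(N-1) is J, which cancels the factor 1/J of the inverse matrix.\<close>
  also have "\<dots> = (1 / J) ^ Suc k * d" using J by (simp add: N)
  finally have "hdensity (matrix_inv L') = (1 / J) ^ Suc k * d" .
  moreover have "- 1 / (real CARD('n) - 1) = - 1 / real (Suc k)" by (simp add: N)
  ultimately have "hdensity (matrix_inv L') powr (- 1 / (real CARD('n) - 1)) =
      ((1 / J) ^ Suc k) powr (- 1 / real (Suc k)) * d powr (- 1 / (real CARD('n) - 1))"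
    by (simp only: powr_mult)
  also have "((1 / J) ^ Suc k) powr (- 1 / real (Suc k)) = J"
  proof -
    have "(1 / J) ^ Suc k = (1 / J) powr real (Suc k)" using J by (simp add: powr_realpow del: of_nat_Suc)
    then have "((1 / J) ^ Suc k) powr (- 1 / real (Suc k)) = (1 / J) powr (- 1)" by (simp add: powr_powr)
    then show ?thesis using J by (simp add: powr_minus_divide)
  qed
  finally show ?thesis
    using J unfolding hroot_def inv d_def E_def
    by (simp add: matrix_scalar_ac flip: scalar_matrix_assoc)
qed

lemma smooth_on_hroot:
  assumes S: "open S" and L: "smooth_on S L" "\<And>x. x \<in> S \<Longrightarrow> hpd (L x)"
  shows "smooth_on S (\<lambda>x. hroot (L x))"
proof -
  have i: "smooth_on S (\<lambda>x. matrix_inv (L x))"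
    by (intro smooth_on_matrix_inv S L hpd_invertible)
  have "smooth_on S (\<lambda>x. hdensity (matrix_inv (L x)) powr a)" for a
    by (rule smooth_on_compose[OF S _ _ smooth_on_powr smooth_on_density[OF S i]])
      (auto intro!: density_pos hpd_matrix_inv L)
  then show ?thesis unfolding hroot_def by (intro smooth_on_scaleR S i)
qed

section \<open>Block matrices on the product with the plane\<close>

definition mkv :: "complex ^ 'n::finite \<Rightarrow> complex \<Rightarrow> complex ^ ('n option)" where
  "mkv w z = (\<chi> i. case i of None \<Rightarrow> z | Some j \<Rightarrow> w $ j)"

definition wpart :: "complex ^ ('n::finite option) \<Rightarrow> complex ^ 'n" where
  "wpart x = (\<chi> j. x $ Some j)"

definition blk :: "complex ^ 'n::finite ^ 'n \<Rightarrow> real \<Rightarrow> complex ^ ('n option) ^ ('n option)" where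
  "blk A r = (\<chi> i j. case i of None \<Rightarrow> (case j of None \<Rightarrow> of_real r | Some _ \<Rightarrow> 0)
     | Some a \<Rightarrow> (case j of None \<Rightarrow> 0 | Some b \<Rightarrow> A $ a $ b))"

lemma sum_option: "(\<Sum>i\<in>UNIV. f i) = f None + (\<Sum>j\<in>UNIV. f (Some (j :: 'n::finite)))"
  by (simp add: UNIV_option_conv sum.reindex)

lemma mkv_nth [simp]: "mkv w z $ None = z" "mkv w z $ Some j = w $ j"
  by (simp_all add: mkv_def)

lemma wpart_mkv [simp]: "wpart (mkv w z) = w"
  by (simp add: wpart_def vec_eq_iff)

lemma mkv_parts [simp]: "mkv (wpart x) (x $ None) = x"
  by (auto simp: mkv_def wpart_def vec_eq_iff split: option.split)

lemma mkv_0 [simp]: "mkv 0 0 = 0"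
  by (auto simp: mkv_def vec_eq_iff split: option.split)

lemma blk_mult_vec: "blk A r *v x = mkv (A *v wpart x) (of_real r * x $ None)"
  by (auto simp: vec_eq_iff matrix_vector_mult_def sum_option blk_def mkv_def wpart_def split: option.split)

lemma blk_mult: "blk A r ** blk B s = blk (A ** B) (r * s)"
  by (auto simp: vec_eq_iff matrix_matrix_mult_def sum_option blk_def split: option.split)

lemma adj_blk: "adj (blk A r) = blk (adj A) r"
  by (auto simp: vec_eq_iff adj_def blk_def split: option.split)

lemma blk_add: "blk A r + blk B s = blk (A + B) (r + s)"
  and blk_scaleR: "c *\<^sub>R blk A r = blk (c *\<^sub>R A) (c * r)"
  and blk_1: "blk (mat 1) 1 = mat 1"
  and blk_0: "blk 0 0 = 0"
  by (auto simp: vec_eq_iff blk_def mat_def scaleR_conv_of_real[where 'a = complex] split: option.split)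

lemma cip_mkv: "cip (mkv u a) x = cip u (wpart x) + a * cnj (x $ None)"
  by (simp add: cip_def sum_option wpart_def)

lemma hpd_blk:
  assumes "hpd A" "r > 0"
  shows "hpd (blk A r)"
  unfolding hpd_def
proof (intro conjI allI impI)
  show "adj (blk A r) = blk A r" using assms(1) by (simp add: adj_blk hpd_def)
  fix u :: "complex ^ ('a option)" assume u: "u \<noteq> 0"
  have "Re (cip (blk A r *v u) u) = Re (cip (A *v wpart u) (wpart u)) + r * (cmod (u $ None))\<^sup>2"
    by (simp add: blk_mult_vec cip_mkv cmod_power2[unfolded power2_eq_square] power2_eq_square algebra_simps)
  moreover have "0 < Re (cip (A *v wpart u) (wpart u)) \<or> (wpart u = 0 \<and> u $ None \<noteq> 0)"
  proof (cases "wpart u = 0")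
    case True
    have "u $ None \<noteq> 0"
    proof
      assume "u $ None = 0"
      then have "u = mkv 0 0" using True mkv_parts[of u] by simp
      then have "u = 0" by (auto simp: vec_eq_iff mkv_def split: option.split)
      then show False using u by simp
    qed
    with True show ?thesis by simp
  qed (use assms(1) in \<open>simp add: hpd_def\<close>)
  ultimately show "0 < Re (cip (blk A r *v u) u)"
    using assms(2) by (auto simp: cip_def add_pos_nonneg)
qed

lemma invertible_blk_1:
  assumes "invertible D"
  shows "invertible (blk D 1)"
  using matrix_inv_unique(1)[of "blk D 1" "blk (matrix_inv D) 1"]
  by (simp add: blk_mult matrix_inv_works[OF assms] blk_1)

lemma linear_mkv: "linear (\<lambda>w. mkv w 0)"
  by (rule linearI) (auto simp: vec_eq_iff mkv_def split: option.split)

lemma linear_blk: "linear (\<lambda>A. blk A 0)" "linear (\<lambda>r. blk 0 r)"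
  by (rule linearI; auto simp: vec_eq_iff blk_def scaleR_conv_of_real[where 'a = complex] split: option.split)+

lemma linear_wpart: "linear wpart"
  by (rule linearI) (auto simp: vec_eq_iff wpart_def)

text \<open>Filling the first two slots with 1 and \<i> of the new coordinate turns a volume form of
  the larger space into one of the smaller. The extended map fixes these two vectors, so the same
  number reveals both determinants.\<close>

lemma form_det_blk:
  fixes D :: "complex ^ 'n::finite ^ 'n"
  shows "form_det ((*v) (blk D 1)) = form_det ((*v) D)"
proof -
  define V where "V = (vol :: (nat \<Rightarrow> complex ^ ('n option)) \<Rightarrow> real)"
  define ext where "ext v = case_nat (mkv 0 1) (case_nat (mkv 0 \<i>) (\<lambda>i. mkv (v i) 0))"
    for v :: "nat \<Rightarrow> complex ^ 'n"
  have dim: "DIM(complex ^ ('n option)) = Suc (Suc DIM(complex ^ 'n))"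
    by simp
  have altV: "alternating_form (Suc (Suc DIM(complex ^ 'n))) V"
    using alternating_vol[where 'n = "'n option"] unfolding V_def dim .
  have alt: "alternating_form DIM(complex ^ 'n) (\<lambda>v. V (ext v))"
    unfolding ext_def
    by (intro alternating_form_linear_comp[OF alternating_form_case_nat linear_mkv] alternating_form_case_nat altV)
  obtain e where e: "bij_betw e {..<DIM(complex ^ 'n)} (Basis :: (complex ^ 'n) set)" using ex_basis_enum by blast
  \<comment> \<open>A basis of the larger space; on it the volume form is nonzero, so that the
    determinants can be compared.\<close>
  define B where "B = ext e ` {..<DIM(complex ^ ('n option))}"
  have mem: "mkv 0 1 \<in> B" "mkv 0 \<i> \<in> B" "mkv b 0 \<in> B" if "b \<in> Basis" for b
  proof -
    show "mkv 0 1 \<in> B" unfolding B_def by (rule image_eqI[of _ _ 0]) (simp_all add: ext_def)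
    show "mkv 0 \<i> \<in> B" unfolding B_def by (rule image_eqI[of _ _ 1]) (simp_all add: ext_def)
    obtain i where "i < DIM(complex ^ 'n)" "b = e i" using e \<open>b \<in> Basis\<close> by (auto simp: bij_betw_def)
    then show "mkv b 0 \<in> B" unfolding B_def dim by (intro image_eqI[of _ _ "Suc (Suc i)"]) (simp_all add: ext_def)
  qed
  have "x \<in> span B" for x
  proof -
    have "mkv w 0 \<in> span B" for w
    proof -
      have "(\<lambda>w. mkv w 0) ` Basis \<subseteq> span B" using mem(3) by (auto intro: span_base)
      then have "span ((\<lambda>w. mkv w 0) ` Basis) \<subseteq> span B" by (rule span_minimal) (rule subspace_span)
      then show ?thesis by (auto simp: linear_span_image[OF linear_mkv] span_Basis)
    qed
    moreover have "x = mkv (wpart x) 0 + Re (x $ None) *\<^sub>R mkv 0 1 + Im (x $ None) *\<^sub>R mkv 0 \<i>"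
      by (auto simp: vec_eq_iff mkv_def wpart_def complex_eq_iff split: option.split)
    ultimately show ?thesis
      using mem SOME_Basis by (metis span_add span_base span_scale)
  qed
  then have span: "span B = UNIV" by auto
  have "DIM(complex ^ ('n option)) \<le> card B"
    using dim_le_card[of UNIV B] span by (simp add: B_def)
  then have "card B = DIM(complex ^ ('n option))"
    using card_image_le[of "{..<DIM(complex ^ ('n option))}" "ext e"] by (simp add: B_def)
  then have "bij_betw (ext e) {..<DIM(complex ^ ('n option))} B"
    unfolding B_def bij_betw_def by (simp add: eq_card_imp_inj_on)
  then have nz: "V (ext e) \<noteq> 0"
    using top_form_eq_0[OF alternating_vol _ span, of "ext e" ref_list] unfolding V_def by auto
  have "(\<lambda>i. blk D 1 *v ext v i) = ext (\<lambda>i. D *v v i)" for v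
  proof
    fix i show "blk D 1 *v ext v i = ext (\<lambda>i. D *v v i) i"
      by (cases i rule: nat.exhaust; cases "i - 1") (auto simp: ext_def blk_mult_vec split: nat.split)
  qed
  then have "V (ext (\<lambda>i. D *v e i)) = form_det ((*v) (blk D 1)) * V (ext e)"
    using form_det[OF linear_matrix_vector alternating_vol, of "blk D 1" "ext e"] unfolding V_def by simp
  moreover have "V (ext (\<lambda>i. D *v e i)) = form_det ((*v) D) * V (ext e)"
    by (rule form_det[OF linear_matrix_vector alt])
  ultimately show ?thesis using nz by simp
qed

lemma sum_Basis_vec:
  "(\<Sum>b\<in>(Basis :: (complex ^ 'n::finite) set). f b) = (\<Sum>i\<in>UNIV. \<Sum>u\<in>Basis. f (axis i u))"
proof -
  have B: "Basis = (\<lambda>(i, u). axis i u) ` ((UNIV :: 'n set) \<times> (Basis :: complex set))"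
    by (auto simp: Basis_vec_def)
  have "inj_on (\<lambda>(i, u). axis i u) ((UNIV :: 'n set) \<times> (Basis :: complex set))"
    by (auto simp: inj_on_def axis_eq_axis)
  then show ?thesis unfolding B by (simp add: sum.reindex sum.cartesian_product split_def)
qed

text \<open>The product rule adds the derivative of \<open>c\<close> times the block. In the
  directions of M that derivative is 0, and the directions of the plane are annihilated by the
  block.\<close>

lemma divfree_blk_left:
  fixes L :: "complex ^ 'n::finite \<Rightarrow> complex ^ 'n ^ 'n"
  assumes L: "divfree L (wpart x)" and c: "(c has_derivative c') (at (x $ None))"
  shows "divfree (\<lambda>y. c (y $ None) *\<^sub>R blk (L (wpart y)) 0) x"
proof -
  obtain L' where L': "(L has_derivative L') (at (wpart x))" "(\<Sum>b\<in>Basis. L' b *v b) = 0"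
    using L by (auto simp: divfree_def)
  have l0: "linear L'" "linear c'" using L'(1) c has_derivative_linear by blast+
  have dL: "((\<lambda>y. blk (L (wpart y)) 0) has_derivative (\<lambda>h. blk (L' (wpart h)) 0)) (at x)"
    by (intro bounded_linear.has_derivative[OF linear_conv_bounded_linear[THEN iffD1, OF linear_blk(1)]]
        has_derivative_compose[OF bounded_linear_imp_has_derivative[OF linear_conv_bounded_linear[THEN iffD1, OF linear_wpart]] L'(1)])
  have dc: "((\<lambda>y. c (y $ None)) has_derivative (\<lambda>h. c' (h $ None))) (at x)"
    by (rule has_derivative_compose[OF bounded_linear_imp_has_derivative[OF bounded_linear_vec_nth] c])
  have d: "((\<lambda>y. c (y $ None) *\<^sub>R blk (L (wpart y)) 0) has_derivative
      (\<lambda>h. c (x $ None) *\<^sub>R blk (L' (wpart h)) 0 + c' (h $ None) *\<^sub>R blk (L (wpart x)) 0)) (at x)"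
    by (rule has_derivative_scaleR[OF dc dL])
  have n: "wpart (axis None u) = 0" "wpart (axis (Some j) u) = axis j u" "axis (Some j) u $ None = 0" for u :: complex and j :: 'n
    by (auto simp: wpart_def vec_eq_iff axis_def)
  have z: "blk A 0 *v axis None u = 0" for A :: "complex ^ 'n ^ 'n" and u
    by (simp add: blk_mult_vec n vec_eq_iff mkv_def split: option.split)
  have "(\<Sum>b\<in>Basis. (c (x $ None) *\<^sub>R blk (L' (wpart b)) 0 + c' (b $ None) *\<^sub>R blk (L (wpart x)) 0) *v b)
     = (\<Sum>j\<in>UNIV. \<Sum>u\<in>Basis. c (x $ None) *\<^sub>R mkv (L' (axis j u) *v axis j u) 0)"
    unfolding sum_Basis_vec sum_option
    by (simp add: n z matrix_vector_mult_add_rdistrib matrix_vector_scaleR_left blk_mult_vec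
        linear_0[OF l0(1)] linear_0[OF l0(2)])
  also have "\<dots> = c (x $ None) *\<^sub>R mkv (\<Sum>b\<in>Basis. L' b *v b) 0"
    unfolding sum_Basis_vec by (simp add: linear_sum[OF linear_mkv] scaleR_sum_right)
  also have "\<dots> = 0" unfolding L'(2) using linear_0[OF linear_mkv] by simp
  finally show ?thesis using d unfolding divfree_def by blast
qed

text \<open>Only the entry in the plane direction is nonzero, and it does not depend on the plane
  coordinate.\<close>

lemma divfree_blk_right:
  fixes r :: "complex ^ 'n::finite \<Rightarrow> real"
  assumes "(r has_derivative r') (at (wpart x))"
  shows "divfree (\<lambda>y. blk 0 (r (wpart y))) x"
proof -
  have d: "((\<lambda>y. blk (0 :: complex ^ 'n ^ 'n) (r (wpart y))) has_derivative (\<lambda>h. blk 0 (r' (wpart h)))) (at x)"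
    by (intro bounded_linear.has_derivative[OF linear_conv_bounded_linear[THEN iffD1, OF linear_blk(2)]]
        has_derivative_compose[OF bounded_linear_imp_has_derivative[OF linear_conv_bounded_linear[THEN iffD1, OF linear_wpart]] assms])
  have n: "wpart (axis None u) = 0" "axis (Some j) u $ None = 0" for u :: complex and j :: 'n
    by (auto simp: wpart_def vec_eq_iff axis_def)
  have "linear r'" using assms has_derivative_linear by blast
  then have "(\<Sum>b\<in>Basis. blk (0 :: complex ^ 'n ^ 'n) (r' (wpart b)) *v b) = 0"
    unfolding sum_Basis_vec sum_option
    by (auto simp: blk_mult_vec n linear_0 vec_eq_iff mkv_def split: option.split)
  with d show ?thesis unfolding divfree_def by blast
qed

section \<open>Charts and derivatives of holomorphic maps\<close>

text \<open>Equivalent to the conditions on a chart in \<open>complex_manifold\<close>, but free of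
  subtopologies, which suits charts of products and quotients.\<close>

definition chart_on :: "'a topology \<Rightarrow> ('a, 'n::finite) chart \<Rightarrow> bool" where
  "chart_on X c \<longleftrightarrow> openin X (fst c) \<and> inj_on (snd c) (fst c) \<and>
     (\<forall>W \<subseteq> fst c. openin X W \<longleftrightarrow> open (snd c ` W))"

lemma chart_on_iff:
  "chart_on X c \<longleftrightarrow> openin X (fst c) \<and> open (snd c ` fst c) \<and>
     homeomorphic_map (subtopology X (fst c)) (top_of_set (snd c ` fst c)) (snd c)"
proof (intro iffI conjI)
  assume c: "chart_on X c"
  then show U: "openin X (fst c)" and o: "open (snd c ` fst c)" by (auto simp: chart_on_def)
  have top: "topspace (subtopology X (fst c)) = fst c" using openin_subset[OF U] by auto
  have W: "openin X W \<longleftrightarrow> open (snd c ` W)" if "W \<subseteq> fst c" for W using c that by (auto simp: chart_on_def)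
  show "homeomorphic_map (subtopology X (fst c)) (top_of_set (snd c ` fst c)) (snd c)"
  proof (rule bijective_open_imp_homeomorphic_map)
    show "continuous_map (subtopology X (fst c)) (top_of_set (snd c ` fst c)) (snd c)"
      unfolding continuous_map_def top
    proof (intro conjI allI impI)
      show "snd c \<in> fst c \<rightarrow> topspace (top_of_set (snd c ` fst c))" by auto
      fix T assume "openin (top_of_set (snd c ` fst c)) T"
      then have T: "open T" "T \<subseteq> snd c ` fst c" using o openin_open_eq by auto
      then have "snd c ` {x \<in> fst c. snd c x \<in> T} = T" by auto
      then have "openin X {x \<in> fst c. snd c x \<in> T}" using W[of "{x \<in> fst c. snd c x \<in> T}"] T by auto
      then show "openin (subtopology X (fst c)) {x \<in> fst c. snd c x \<in> T}"
        using openin_open_subtopology[OF U] by auto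
    qed
    show "open_map (subtopology X (fst c)) (top_of_set (snd c ` fst c)) (snd c)"
      unfolding open_map_def
    proof (intro allI impI)
      fix W' assume "openin (subtopology X (fst c)) W'"
      then have "openin X W'" "W' \<subseteq> fst c" using openin_open_subtopology[OF U] by auto
      then have "open (snd c ` W')" using W by blast
      then show "openin (top_of_set (snd c ` fst c)) (snd c ` W')"
        using o \<open>W' \<subseteq> fst c\<close> by (simp add: openin_open_eq image_mono)
    qed
    show "snd c ` topspace (subtopology X (fst c)) = topspace (top_of_set (snd c ` fst c))"
      unfolding top by simp
    show "inj_on (snd c) (topspace (subtopology X (fst c)))"
      unfolding top using c by (simp add: chart_on_def)
  qed
next
  assume a: "openin X (fst c) \<and> open (snd c ` fst c) \<and>
     homeomorphic_map (subtopology X (fst c)) (top_of_set (snd c ` fst c)) (snd c)"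
  then have U: "openin X (fst c)" and o: "open (snd c ` fst c)"
    and h: "homeomorphic_map (subtopology X (fst c)) (top_of_set (snd c ` fst c)) (snd c)" by auto
  have top: "topspace (subtopology X (fst c)) = fst c" using openin_subset[OF U] by auto
  have inj: "inj_on (snd c) (fst c)" using h unfolding homeomorphic_eq_everything_map top by blast
  show "chart_on X c"
    unfolding chart_on_def
  proof (intro conjI allI impI U inj)
    fix W assume W: "W \<subseteq> fst c"
    show "openin X W \<longleftrightarrow> open (snd c ` W)"
    proof
      assume "openin X W"
      then have "openin (subtopology X (fst c)) W" using W openin_open_subtopology[OF U] by auto
      then have "openin (top_of_set (snd c ` fst c)) (snd c ` W)"
        using homeomorphic_imp_open_map[OF h] by (auto simp: open_map_def)
      then show "open (snd c ` W)" using o openin_open_eq by blast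
    next
      assume "open (snd c ` W)"
      then have "openin (top_of_set (snd c ` fst c)) (snd c ` W)"
        using o W by (simp add: openin_open_eq image_mono)
      then have "openin (subtopology X (fst c)) {x \<in> fst c. snd c x \<in> snd c ` W}"
        using homeomorphic_imp_continuous_map[OF h] unfolding continuous_map_def top by blast
      moreover have "{x \<in> fst c. snd c x \<in> snd c ` W} = W"
        using W inj by (auto simp: inj_on_def)
      ultimately show "openin X W" using openin_open_subtopology[OF U] by auto
    qed
  qed
qed

lemma complex_manifold_chart_iff:
  "complex_manifold M \<longleftrightarrow>
     Hausdorff_space (mtop M) \<and> second_countable (mtop M) \<and>
     (\<Union>c\<in>atlas M. fst c) = topspace (mtop M) \<and> (\<forall>c\<in>atlas M. chart_on (mtop M) c) \<and>
     (\<forall>c\<in>atlas M. \<forall>d\<in>atlas M. holomorphic_vec_on (local_rep c d id) (snd c ` (fst c \<inter> fst d)))"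
  unfolding complex_manifold_def chart_on_iff by blast

section \<open>Jacobian matrices of holomorphic maps in charts\<close>

definition Dm :: "('a, 'n::finite) chart \<Rightarrow> ('b, 'm::finite) chart \<Rightarrow> ('a \<Rightarrow> 'b) \<Rightarrow> 'a \<Rightarrow> complex ^ 'n ^ 'm" where
  "Dm c d f p = matrix (frechet_derivative (local_rep c d f) (at (snd c p)))"

lemma chart_onD:
  assumes "chart_on X c"
  shows "openin X (fst c)" "inj_on (snd c) (fst c)"
    "W \<subseteq> fst c \<Longrightarrow> openin X W \<Longrightarrow> open (snd c ` W)"
    "W \<subseteq> fst c \<Longrightarrow> open (snd c ` W) \<Longrightarrow> openin X W"
    "p \<in> fst c \<Longrightarrow> inv_into (fst c) (snd c) (snd c p) = p"
    "p \<in> fst c \<Longrightarrow> local_rep c d f (snd c p) = snd d (f p)"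
  using assms by (auto simp: chart_on_def local_rep_def)

lemma complex_manifoldD:
  assumes "complex_manifold M"
  shows "c \<in> atlas M \<Longrightarrow> chart_on (mtop M) c"
    "p \<in> topspace (mtop M) \<Longrightarrow> \<exists>c\<in>atlas M. p \<in> fst c"
    "c \<in> atlas M \<Longrightarrow> p \<in> fst c \<Longrightarrow> p \<in> topspace (mtop M)"
  using assms unfolding complex_manifold_chart_iff by blast+

lemma holomorphic_map_id:
  assumes "complex_manifold M"
  shows "holomorphic_map M M id"
  using assms unfolding holomorphic_map_def complex_manifold_chart_iff
  by (auto simp: Int_def)

lemma open_rep_domain:
  assumes "complex_manifold M" "complex_manifold N" "holomorphic_map M N f" "c \<in> atlas M" "d \<in> atlas N"
  shows "openin (mtop M) {p \<in> fst c. f p \<in> fst d}" "open (snd c ` {p \<in> fst c. f p \<in> fst d})"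
proof -
  note c = complex_manifoldD(1)[OF assms(1,4)] and d = complex_manifoldD(1)[OF assms(2,5)]
  have "openin (mtop M) {p \<in> topspace (mtop M). f p \<in> fst d}"
    using assms(3) chart_onD(1)[OF d] unfolding holomorphic_map_def continuous_map_def by blast
  then have "openin (mtop M) (fst c \<inter> {p \<in> topspace (mtop M). f p \<in> fst d})"
    by (intro openin_Int chart_onD(1)[OF c])
  moreover have "fst c \<inter> {p \<in> topspace (mtop M). f p \<in> fst d} = {p \<in> fst c. f p \<in> fst d}"
    using openin_subset[OF chart_onD(1)[OF c]] by auto
  ultimately show "openin (mtop M) {p \<in> fst c. f p \<in> fst d}" by simp
  then show "open (snd c ` {p \<in> fst c. f p \<in> fst d})" by (intro chart_onD(3)[OF c]) auto
qed

lemma smooth_on_local_rep: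
  assumes "complex_manifold M" "complex_manifold N" "holomorphic_map M N f" "c \<in> atlas M" "d \<in> atlas N"
  shows "smooth_on (snd c ` {p \<in> fst c. f p \<in> fst d}) (local_rep c d f)"
  using assms(3-5) open_rep_domain(2)[OF assms] by (auto simp: holomorphic_map_def intro: holomorphic_vec_on_smooth)

lemma clinear_matrix_works: "Vector_Spaces.linear (*s) (*s) D \<Longrightarrow> (*v) (matrix D) = (D :: complex ^ 'n::finite \<Rightarrow> complex ^ 'm::finite)"
  by (rule ext) (rule matrix_works)

lemma Dm_works:
  assumes "holomorphic_map M N f" "c \<in> atlas M" "d \<in> atlas N" "p \<in> fst c" "f p \<in> fst d"
  shows "frechet_derivative (local_rep c d f) (at (snd c p)) = (*v) (Dm c d f p)"
    "(local_rep c d f has_derivative (*v) (Dm c d f p)) (at (snd c p))"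
proof -
  have "holomorphic_vec_on (local_rep c d f) (snd c ` {p \<in> fst c. f p \<in> fst d})"
    using assms(1-3) by (auto simp: holomorphic_map_def)
  moreover have "snd c p \<in> snd c ` {p \<in> fst c. f p \<in> fst d}" using assms(4,5) by auto
  ultimately obtain D where D: "(local_rep c d f has_derivative D) (at (snd c p))" "Vector_Spaces.linear (*s) (*s) D"
    unfolding holomorphic_vec_on_def by blast
  then show "frechet_derivative (local_rep c d f) (at (snd c p)) = (*v) (Dm c d f p)"
    by (simp add: Dm_def clinear_matrix_works flip: frechet_derivative_at[OF D(1)])
  then show "(local_rep c d f has_derivative (*v) (Dm c d f p)) (at (snd c p))"
    using D(1) by (simp flip: frechet_derivative_at[OF D(1)])
qed

lemma Dm_cong:
  assumes "complex_manifold M" "c \<in> atlas M" "openin (mtop M) W" "p \<in> W" "p \<in> fst c" "\<And>x. x \<in> W \<Longrightarrow> f x = g x"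
  shows "Dm c d f p = Dm c d g p"
proof -
  note c = complex_manifoldD(1)[OF assms(1,2)]
  have "frechet_derivative (local_rep c d f) (at (snd c p)) = frechet_derivative (local_rep c d g) (at (snd c p))"
  proof (rule frechet_derivative_cong)
    show "open (snd c ` (W \<inter> fst c))" by (intro chart_onD(3)[OF c]) (auto simp: assms openin_Int chart_onD(1)[OF c])
    show "snd c p \<in> snd c ` (W \<inter> fst c)" using assms by auto
    show "local_rep c d f y = local_rep c d g y" if "y \<in> snd c ` (W \<inter> fst c)" for y
      using that by (auto simp: chart_onD(6)[OF c] assms(6))
  qed
  then show ?thesis by (simp add: Dm_def)
qed

text \<open>Near \<open>p\<close> the composite factors through the chart \<open>d\<close> of the
  middle manifold, even though \<open>d\<close> need not contain the image of the whole chart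
  \<open>c\<close>.\<close>

lemma local_rep_compose:
  assumes M: "complex_manifold M" and N: "complex_manifold N"
    and f: "holomorphic_map M N f" and g: "holomorphic_map N P g"
    and c: "c \<in> atlas M" and d: "d \<in> atlas N" and e: "e \<in> atlas P"
    and p: "p \<in> fst c" "f p \<in> fst d" "g (f p) \<in> fst e"
  shows "(local_rep c e (g \<circ> f) has_derivative (*v) (Dm d e g (f p) ** Dm c d f p)) (at (snd c p))"
proof -
  note cc = complex_manifoldD(1)[OF M c] and dd = complex_manifoldD(1)[OF N d]
  have 1: "(local_rep c d f has_derivative (*v) (Dm c d f p)) (at (snd c p))"
    by (rule Dm_works(2)[OF f c d p(1,2)])
  have "(local_rep d e g has_derivative (*v) (Dm d e g (f p))) (at (local_rep c d f (snd c p)))"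
    unfolding chart_onD(6)[OF cc p(1)] by (rule Dm_works(2)[OF g d e p(2,3)])
  from has_derivative_compose[OF 1 this]
  have "((\<lambda>x. local_rep d e g (local_rep c d f x)) has_derivative (*v) (Dm d e g (f p) ** Dm c d f p)) (at (snd c p))"
    by (simp add: matrix_vector_mul_assoc)
  then show ?thesis
  proof (rule has_derivative_transform_within_open)
    show "open (snd c ` {p \<in> fst c. f p \<in> fst d})" by (rule open_rep_domain(2)[OF M N f c d])
    show "snd c p \<in> snd c ` {p \<in> fst c. f p \<in> fst d}" using p by auto
    show "local_rep d e g (local_rep c d f x) = local_rep c e (g \<circ> f) x"
      if "x \<in> snd c ` {p \<in> fst c. f p \<in> fst d}" for x
      using that by (auto simp: chart_onD(6)[OF cc] chart_onD(6)[OF dd])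
  qed
qed

lemma Dm_compose:
  assumes "complex_manifold M" "complex_manifold N" "holomorphic_map M N f" "holomorphic_map N P g"
    "c \<in> atlas M" "d \<in> atlas N" "e \<in> atlas P" "p \<in> fst c" "f p \<in> fst d" "g (f p) \<in> fst e"
  shows "Dm c e (g \<circ> f) p = Dm d e g (f p) ** Dm c d f p"
  unfolding Dm_def[of c e] frechet_derivative_at[OF local_rep_compose[OF assms], symmetric]
  by (rule matrix_of_matrix_vector_mul)

lemma holomorphic_map_compose:
  assumes M: "complex_manifold M" and N: "complex_manifold N"
    and f: "holomorphic_map M N f" and g: "holomorphic_map N P g"
  shows "holomorphic_map M P (g \<circ> f)"
  unfolding holomorphic_map_def
proof (intro conjI ballI)
  show "continuous_map (mtop M) (mtop P) (g \<circ> f)"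
    using f g by (auto simp: holomorphic_map_def intro: continuous_map_compose)
  fix c e assume c: "c \<in> atlas M" and e: "e \<in> atlas P"
  show "holomorphic_vec_on (local_rep c e (g \<circ> f)) (snd c ` {p \<in> fst c. (g \<circ> f) p \<in> fst e})"
    unfolding holomorphic_vec_on_def
  proof
    fix x assume "x \<in> snd c ` {p \<in> fst c. (g \<circ> f) p \<in> fst e}"
    then obtain p where p: "p \<in> fst c" "g (f p) \<in> fst e" "x = snd c p" by auto
    have "f p \<in> topspace (mtop N)"
      using f complex_manifoldD(3)[OF M c p(1)] by (auto simp: holomorphic_map_def continuous_map_def)
    then obtain d where d: "d \<in> atlas N" "f p \<in> fst d" using complex_manifoldD(2)[OF N] by blast
    show "\<exists>D. (local_rep c e (g \<circ> f) has_derivative D) (at x) \<and> Vector_Spaces.linear (*s) (*s) D"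
      using local_rep_compose[OF M N f g c d(1) e p(1) d(2) p(2)] p(3) matrix_vector_mul_linear_gen by blast
  qed
qed

lemma Dm_id:
  assumes "complex_manifold M" "c \<in> atlas M" "p \<in> fst c"
  shows "Dm c c id p = mat 1"
proof -
  note c = complex_manifoldD(1)[OF assms(1,2)]
  have "((\<lambda>x. x) has_derivative (\<lambda>u. u)) (at (snd c p))" by (rule has_derivative_ident)
  then have "(local_rep c c id has_derivative (\<lambda>u. u)) (at (snd c p))"
  proof (rule has_derivative_transform_within_open)
    show "open (snd c ` fst c)" by (intro chart_onD(3)[OF c] chart_onD(1)[OF c]) auto
  qed (use assms in \<open>auto simp: chart_onD(6)[OF c]\<close>)
  from frechet_derivative_at[OF this] show ?thesis
    by (simp add: Dm_def matrix_def mat_def vec_eq_iff axis_def flip: id_def)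
qed

lemma Dm_inverse:
  assumes M: "complex_manifold M" and N: "complex_manifold N"
    and f: "holomorphic_map M N f" and g: "holomorphic_map N M g"
    and inv: "\<And>x. x \<in> topspace (mtop M) \<Longrightarrow> g (f x) = x"
    and c: "c \<in> atlas M" and d: "d \<in> atlas N" and p: "p \<in> fst c" "f p \<in> fst d"
  shows "Dm d c g (f p) ** Dm c d f p = mat 1"
proof -
  have pt: "p \<in> topspace (mtop M)" by (rule complex_manifoldD(3)[OF M c p(1)])
  have "Dm c c (g \<circ> f) p = Dm d c g (f p) ** Dm c d f p"
    by (rule Dm_compose[OF M N f g c d c p]) (simp add: inv[OF pt] p)
  moreover have "Dm c c (g \<circ> f) p = Dm c c id p"
    by (rule Dm_cong[OF M c openin_topspace pt p(1)]) (simp add: inv)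
  ultimately show ?thesis by (simp add: Dm_id[OF M c p(1)])
qed

text \<open>The inverse is existential and tested on points of the manifold only, since functions
  are arbitrary elsewhere. This makes closure under composition immediate.\<close>

definition hol_auto :: "('a, 'n::finite) cmanifold \<Rightarrow> ('a \<Rightarrow> 'a) \<Rightarrow> bool" where
  "hol_auto M f \<longleftrightarrow> holomorphic_map M M f \<and> (\<exists>g. holomorphic_map M M g \<and>
     (\<forall>x\<in>topspace (mtop M). g (f x) = x \<and> f (g x) = x))"

lemma hol_auto_map: "hol_auto M f \<Longrightarrow> holomorphic_map M M f"
  by (simp add: hol_auto_def)

lemma hol_auto_topspace: "hol_auto M f \<Longrightarrow> x \<in> topspace (mtop M) \<Longrightarrow> f x \<in> topspace (mtop M)"
  by (auto simp: hol_auto_def holomorphic_map_def continuous_map_def)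

lemma hol_auto_invertible:
  fixes M :: "('a, 'n::finite) cmanifold"
  assumes M: "complex_manifold M" and f: "hol_auto M f"
    and c: "c \<in> atlas M" and d: "d \<in> atlas M" and p: "p \<in> fst c" "f p \<in> fst d"
  shows "invertible (Dm c d f p)"
proof -
  obtain g where g: "holomorphic_map M M g" "\<And>x. x \<in> topspace (mtop M) \<Longrightarrow> g (f x) = x"
    using f by (auto simp: hol_auto_def)
  from Dm_inverse[OF M M hol_auto_map[OF f] g c d p] show ?thesis
    unfolding invertible_left_inverse by blast
qed

lemma hol_auto_id: "complex_manifold M \<Longrightarrow> hol_auto M id"
  unfolding hol_auto_def using holomorphic_map_id by fastforce

lemma hol_auto_compose:
  assumes M: "complex_manifold M" and "hol_auto M f" "hol_auto M g"
  shows "hol_auto M (g \<circ> f)"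
proof -
  obtain f' g' where fg: "holomorphic_map M M f'" "\<forall>x\<in>topspace (mtop M). f' (f x) = x \<and> f (f' x) = x"
    "holomorphic_map M M g'" "\<forall>x\<in>topspace (mtop M). g' (g x) = x \<and> g (g' x) = x"
    using assms unfolding hol_auto_def by auto
  have t: "h x \<in> topspace (mtop M)" if "holomorphic_map M M h" "x \<in> topspace (mtop M)" for h x
    using that by (auto simp: holomorphic_map_def continuous_map_def)
  show ?thesis
    unfolding hol_auto_def
    using fg assms t[OF fg(3)] t[OF hol_auto_map[OF assms(2)]]
    by (intro conjI exI[of _ "f' \<circ> g'"] holomorphic_map_compose[OF M M] fg(1,3)
        hol_auto_map[OF assms(2)] hol_auto_map[OF assms(3)]) auto
qed

section \<open>Hermitian metrics as matrix fields\<close>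

type_synonym ('a, 'n) matrix_field = "('a, 'n) chart \<Rightarrow> complex ^ 'n \<Rightarrow> complex ^ 'n ^ 'n"

definition hermitian_field :: "('a, 'n::finite) cmanifold \<Rightarrow> ('a, 'n) matrix_field \<Rightarrow> bool" where
  "hermitian_field M H \<longleftrightarrow>
     (\<forall>c\<in>atlas M. (\<forall>x\<in>snd c ` fst c. hpd (H c x)) \<and> smooth_on (snd c ` fst c) (H c)) \<and>
     (\<forall>c\<in>atlas M. \<forall>d\<in>atlas M. \<forall>p\<in>fst c \<inter> fst d.
        H c (snd c p) = adj (Dm c d id p) ** H d (snd d p) ** Dm c d id p)"

text \<open>Closedness is replaced by the divergence condition, which is linear in
  \<open>ldual\<close>; \<open>closed_iff_divfree\<close> shows that both agree.\<close>

definition balanced_field :: "('a, 'n::finite) cmanifold \<Rightarrow> ('a, 'n) matrix_field \<Rightarrow> bool" where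
  "balanced_field M H \<longleftrightarrow> hermitian_field M H \<and>
     (\<forall>c\<in>atlas M. \<forall>x\<in>snd c ` fst c. divfree (\<lambda>y. ldual (H c y)) x)"

definition metric_of :: "('a, 'n::finite) matrix_field \<Rightarrow> ('a, 'n) sesqui_field" where
  "metric_of H c x u v = cip (H c x *v u) v"

lemma fundamental_form_metric_of: "fundamental_form (metric_of H) c x = (\<lambda>v. om (H c x) (v 0) (v 1))"
  by (simp add: fundamental_form_def metric_of_def om_def fun_eq_iff)

lemma cip_pullback: "cip ((adj D ** A ** D) *v u) v = cip (A *v (D *v u)) (D *v v)"
proof -
  have "(adj D ** A ** D) *v u = adj D *v (A *v (D *v u))"
    by (simp add: matrix_vector_mul_assoc matrix_mul_assoc)
  then show ?thesis by (simp add: cip_adj[of "adj D"])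
qed

lemma cip_axis: "cip u (axis k 1) = u $ k"
  by (simp add: cip_def axis_def if_distrib cong: if_cong)

lemma matrix_eq_cip: "(\<And>u v. cip (A *v u) v = cip (B *v u) v) \<Longrightarrow> A = B"
  by (metis cip_axis matrix_vector_axis vec_eq_iff)

lemma closed_iff_divfree:
  fixes M :: "('a, 'n::finite) cmanifold"
  assumes M: "complex_manifold M" and H: "hermitian_field M H" and N: "CARD('n) = Suc k"
    and c: "c \<in> atlas M" and x: "x \<in> snd c ` fst c"
  shows "(\<forall>v. ext_deriv (2 * k) (\<lambda>y. om_power (om (H c y)) k) x v = 0) \<longleftrightarrow> divfree (\<lambda>y. ldual (H c y)) x"
proof -
  have o: "open (snd c ` fst c)"
    using complex_manifoldD(1)[OF M c] chart_onD(1,3) by blast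
  have H': "hpd (H c y)" if "y \<in> snd c ` fst c" for y using H c that by (auto simp: hermitian_field_def)
  have "smooth_on (snd c ` fst c) (\<lambda>y. ldual (H c y))"
    by (rule smooth_on_ldual[OF o _ H']) (use H c in \<open>auto simp: hermitian_field_def\<close>)
  show ?thesis
    by (rule ext_deriv_om_power_eq_0_iff[OF N o x H' smooth_on_has_derivative[OF \<open>smooth_on _ _\<close> x]])
qed

lemma balanced_metric_imp_field:
  fixes M :: "('a, 'n::finite) cmanifold"
  assumes M: "complex_manifold M" and h: "balanced_metric M h"
  shows "\<exists>H. balanced_field M H"
proof -
  obtain k where N: "CARD('n) = Suc k" using gr0_implies_Suc[OF zero_less_card_finite[where 'a = 'n]] by blast
  \<comment> \<open>The column index belongs to the linear argument of \<open>h\<close>, so that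
    \<open>cip\<close> of \<open>H c x\<close> applied to u with v reproduces
    \<open>h\<close>.\<close>
  define H where "H c x = (\<chi> k j. h c x (axis j 1) (axis k 1))" for c x
  have h': "hermitian_metric M h" using h by (simp add: balanced_metric_def)
  have lin: "Vector_Spaces.linear (*s) (*) (\<lambda>u. h c x u v)" and sym: "h c x v u = cnj (h c x u v)"
    and pos: "u \<noteq> 0 \<Longrightarrow> 0 < Re (h c x u u)"
    if "c \<in> atlas M" "x \<in> snd c ` fst c" for c x u v
    using h' that unfolding hermitian_metric_def by blast+
  have rep: "h c x u v = cip (H c x *v u) v" if cx: "c \<in> atlas M" "x \<in> snd c ` fst c" for c x u v
  proof -
    have 1: "h c x u w = (\<Sum>j\<in>UNIV. u $ j * h c x (axis j 1) w)" for u w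
    proof -
      interpret Vector_Spaces.linear "(*s)" "(*)" "\<lambda>u. h c x u w" by (rule lin[OF cx])
      have "u = (\<Sum>j\<in>UNIV. u $ j *s axis j 1)"
        by (simp add: vec_eq_iff axis_def if_distrib cong: if_cong)
      then have "h c x u w = h c x (\<Sum>j\<in>UNIV. u $ j *s axis j 1) w"
        by (rule arg_cong[where f = "\<lambda>u. h c x u w"])
      then show ?thesis by (simp add: sum scale)
    qed
    have 2: "h c x u (axis l 1) = (H c x *v u) $ l" for l
      unfolding 1[of u] by (simp add: H_def matrix_vector_mult_def mult.commute)
    have "h c x u v = cnj (h c x v u)" by (rule sym[OF cx])
    also have "\<dots> = (\<Sum>l\<in>UNIV. cnj (v $ l) * cnj (h c x (axis l 1) u))" unfolding 1[of v] by simp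
    also have "\<dots> = (\<Sum>l\<in>UNIV. cnj (v $ l) * ((H c x *v u) $ l))"
      by (intro sum.cong refl arg_cong2[where f = "(*)"] trans[OF sym[OF cx, symmetric] 2])
    finally show ?thesis by (simp add: cip_def mult.commute)
  qed
  have hf: "hermitian_field M H"
    unfolding hermitian_field_def
  proof (intro conjI ballI)
    fix c assume c: "c \<in> atlas M"
    show "smooth_on (snd c ` fst c) (H c)"
      unfolding H_def
    proof (intro smooth_on_vec_lambda chart_onD(3)[OF complex_manifoldD(1)[OF M c]]
        chart_onD(1)[OF complex_manifoldD(1)[OF M c]] order_refl)
      show "smooth_on (snd c ` fst c) (\<lambda>x. h c x (axis j 1) (axis i 1))" for i j
        using h' c by (auto simp: hermitian_metric_def)
    qed
    {
      fix x assume x: "x \<in> snd c ` fst c"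
      have "adj (H c x) = H c x"
        by (simp add: adj_def H_def vec_eq_iff sym[OF c x, symmetric])
      then show "hpd (H c x)" using pos[OF c x] rep[OF c x] by (simp add: hpd_def)
    }
    fix d p assume d: "d \<in> atlas M" and p: "p \<in> fst c \<inter> fst d"
    have fr: "frechet_derivative (local_rep c d id) (at (snd c p)) = (*v) (Dm c d id p)"
      by (rule Dm_works(1)[OF holomorphic_map_id[OF M] c d]) (use p in auto)
    show "H c (snd c p) = adj (Dm c d id p) ** H d (snd d p) ** Dm c d id p"
    proof (rule matrix_eq_cip)
      fix u v
      have "h d (snd d p) (Dm c d id p *v u) (Dm c d id p *v v) = h c (snd c p) u v"
        using h' c d p fr unfolding hermitian_metric_def Let_def by metis
      then show "cip (H c (snd c p) *v u) v = cip ((adj (Dm c d id p) ** H d (snd d p) ** Dm c d id p) *v u) v"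
        using rep[OF c, of "snd c p"] rep[OF d, of "snd d p"] p by (simp add: cip_pullback)
    qed
  qed
  have "divfree (\<lambda>y. ldual (H c y)) x" if c: "c \<in> atlas M" and x: "x \<in> snd c ` fst c" for c x
    unfolding closed_iff_divfree[OF M hf N c x, symmetric]
  proof
    fix v
    have o: "open (snd c ` fst c)" using complex_manifoldD(1)[OF M c] chart_onD(1,3) by blast
    have eq: "two_form_power (fundamental_form h c y) k = om_power (om (H c y)) k" if "y \<in> snd c ` fst c" for y
    proof -
      have "fundamental_form h c y = (\<lambda>v. om (H c y) (v 0) (v 1))"
        by (simp add: fun_eq_iff fundamental_form_def om_def rep[OF c that])
      then show ?thesis by (simp only:)
    qed
    have "closed_form M (2 * k) (\<lambda>c x. two_form_power (fundamental_form h c x) k)"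
      using h by (simp add: balanced_metric_def N)
    then have "ext_deriv (2 * k) (\<lambda>y. two_form_power (fundamental_form h c y) k) x v = 0"
      using c x unfolding closed_form_def by blast
    moreover have "ext_deriv (2 * k) (\<lambda>y. two_form_power (fundamental_form h c y) k) x v
        = ext_deriv (2 * k) (\<lambda>y. om_power (om (H c y)) k) x v"
      unfolding ext_deriv_def
      by (intro sum.cong refl arg_cong2[where f = "(*)"] fun_cong[OF frechet_derivative_cong[OF o x]]) (simp add: eq)
    ultimately show "ext_deriv (2 * k) (\<lambda>y. om_power (om (H c y)) k) x v = 0" by simp
  qed
  with hf show ?thesis unfolding balanced_field_def by blast
qed

lemma balanced_field_imp_metric:
  fixes M :: "('a, 'n::finite) cmanifold"
  assumes M: "complex_manifold M" and H: "balanced_field M H"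
  shows "balanced_metric M (metric_of H)"
proof -
  obtain k where N: "CARD('n) = Suc k" using gr0_implies_Suc[OF zero_less_card_finite[where 'a = 'n]] by blast
  have hf: "hermitian_field M H" using H by (simp add: balanced_field_def)
  have o: "open (snd c ` fst c)" if "c \<in> atlas M" for c
    using complex_manifoldD(1)[OF M that] chart_onD(1,3) by blast
  have sm: "smooth_on (snd c ` fst c) (H c)" and hp: "x \<in> snd c ` fst c \<Longrightarrow> hpd (H c x)"
    if "c \<in> atlas M" for c x using hf that by (auto simp: hermitian_field_def)
  have tr: "H c (snd c p) = adj (Dm c d id p) ** H d (snd d p) ** Dm c d id p"
    if "c \<in> atlas M" "d \<in> atlas M" "p \<in> fst c" "p \<in> fst d" for c d p
    using hf that unfolding hermitian_field_def by blast
  have fr: "frechet_derivative (local_rep c d id) (at (snd c p)) = (*v) (Dm c d id p)"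
    if "c \<in> atlas M" "d \<in> atlas M" "p \<in> fst c" "p \<in> fst d" for c d p
    by (rule Dm_works(1)[OF holomorphic_map_id[OF M] that(1-3)]) (use that in simp)
  have "hermitian_metric M (metric_of H)"
    unfolding hermitian_metric_def
  proof (intro conjI ballI allI impI)
    fix c x assume c: "c \<in> atlas M" and x: "x \<in> snd c ` fst c"
    show "Vector_Spaces.linear (*s) (*) (\<lambda>u. metric_of H c x u v)" for v
      by unfold_locales (simp_all add: metric_of_def matrix_vector_right_distrib cip_add_left
          vector_scalar_commute cip_smult_left algebra_simps)
    show "metric_of H c x v u = cnj (metric_of H c x u v)" for u v
    proof -
      have "adj (H c x) = H c x" using hp[OF c x] by (simp add: hpd_def)
      then show ?thesis
        unfolding metric_of_def using cip_adj[of "H c x" v u] cip_commute[of v "H c x *v u"] by simp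
    qed
    show "0 < Re (metric_of H c x u u)" if "u \<noteq> 0" for u
      using hp[OF c x] that by (simp add: hpd_def metric_of_def)
  next
    fix c u v assume c: "c \<in> atlas M"
    show "smooth_on (snd c ` fst c) (\<lambda>x. metric_of H c x u v)"
      unfolding metric_of_def
      by (intro smooth_on_cip smooth_on_matrix_vector smooth_on_const o[OF c] sm[OF c])
  next
    fix c d p u v assume "c \<in> atlas M" "d \<in> atlas M" "p \<in> fst c \<inter> fst d"
    then have a: "c \<in> atlas M" "d \<in> atlas M" "p \<in> fst c" "p \<in> fst d" by auto
    show "let D = frechet_derivative (local_rep c d id) (at (snd c p))
        in metric_of H d (snd d p) (D u) (D v) = metric_of H c (snd c p) u v"
      unfolding Let_def fr[OF a] metric_of_def tr[OF a] cip_pullback ..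
  qed
  moreover have "closed_form M (2 * k) (\<lambda>c x. two_form_power (fundamental_form (metric_of H) c x) k)"
    unfolding closed_form_def differential_form_def fundamental_form_metric_of
  proof (intro conjI ballI allI)
    fix c assume c: "c \<in> atlas M"
    show "alternating_form (2 * k) (om_power (om (H c x)) k)" for x
      by (rule alternating_om_power[OF bilinear_om])
    show "smooth_on (snd c ` fst c) (\<lambda>x. om_power (om (H c x)) k v)" for v
      by (intro smooth_on_om_power smooth_on_om o[OF c] sm[OF c])
    show "ext_deriv (2 * k) (\<lambda>x. om_power (om (H c x)) k) x v = 0" if x: "x \<in> snd c ` fst c" for x v
      using closed_iff_divfree[OF M hf N c x] H c x by (auto simp: balanced_field_def)
  next
    show "pullback_eq M M id (\<lambda>c x. om_power (om (H c x)) k) (\<lambda>c x. om_power (om (H c x)) k)"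
      unfolding pullback_eq_def
    proof (intro ballI impI allI)
      fix c d p v assume "c \<in> atlas M" "d \<in> atlas M" "p \<in> fst c" "id p \<in> fst d"
      then have a: "c \<in> atlas M" "d \<in> atlas M" "p \<in> fst c" "p \<in> fst d" by auto
      have "om (H c (snd c p)) = (\<lambda>u v. om (H d (snd d p)) (Dm c d id p *v u) (Dm c d id p *v v))"
        unfolding tr[OF a] by (intro ext om_pullback)
      then have "om_power (om (H c (snd c p))) k v =
          om_power (\<lambda>u v. om (H d (snd d p)) (Dm c d id p *v u) (Dm c d id p *v v)) k v" by (simp only:)
      also have "\<dots> = om_power (om (H d (snd d p))) k (\<lambda>i. Dm c d id p *v v i)" by (rule om_power_natural)
      finally show "om_power (om (H d (snd d (id p)))) k
          (\<lambda>i. frechet_derivative (local_rep c d id) (at (snd c p)) (v i)) = om_power (om (H c (snd c p))) k v"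
        unfolding fr[OF a] id_apply by simp
    qed
  qed
  ultimately show ?thesis unfolding balanced_metric_def using N by simp
qed

section \<open>Pulling back balanced metrics\<close>

text \<open>The chart around f p is an arbitrary choice. The transformation law of \<open>H\<close>
  makes the value independent of it, see \<open>pullback_field_eq\<close>.\<close>

definition pullback_field :: "('a, 'n::finite) cmanifold \<Rightarrow> ('a \<Rightarrow> 'a) \<Rightarrow> ('a, 'n) matrix_field \<Rightarrow> ('a, 'n) matrix_field" where
  "pullback_field M f H c x =
     (let p = inv_into (fst c) (snd c) x; d = SOME d. d \<in> atlas M \<and> f p \<in> fst d
      in adj (Dm c d f p) ** H d (snd d (f p)) ** Dm c d f p)"

lemma hermitian_fieldD:
  assumes "hermitian_field M H"
  shows "c \<in> atlas M \<Longrightarrow> x \<in> snd c ` fst c \<Longrightarrow> hpd (H c x)"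
    "c \<in> atlas M \<Longrightarrow> smooth_on (snd c ` fst c) (H c)"
    "c \<in> atlas M \<Longrightarrow> d \<in> atlas M \<Longrightarrow> p \<in> fst c \<Longrightarrow> p \<in> fst d \<Longrightarrow>
       H c (snd c p) = adj (Dm c d id p) ** H d (snd d p) ** Dm c d id p"
  using assms unfolding hermitian_field_def by blast+

lemma pullback_mult: "adj E ** (adj D ** A ** D) ** E = adj (D ** E) ** A ** (D ** E)"
  by (simp add: adj_mult matrix_mul_assoc)

lemma pullback_field_eq:
  assumes M: "complex_manifold M" and H: "hermitian_field M H" and f: "hol_auto M f"
    and c: "c \<in> atlas M" and d: "d \<in> atlas M" and p: "p \<in> fst c" "f p \<in> fst d"
  shows "pullback_field M f H c (snd c p) = adj (Dm c d f p) ** H d (snd d (f p)) ** Dm c d f p"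
proof -
  define d' where "d' = (SOME d. d \<in> atlas M \<and> f p \<in> fst d)"
  have d': "d' \<in> atlas M" "f p \<in> fst d'"
    using someI[of "\<lambda>d. d \<in> atlas M \<and> f p \<in> fst d" d] d p by (auto simp: d'_def)
  have pt: "inv_into (fst c) (snd c) (snd c p) = p" by (rule chart_onD(5)[OF complex_manifoldD(1)[OF M c] p(1)])
  have D: "Dm c d f p = Dm d' d id (f p) ** Dm c d' f p"
    using Dm_compose[OF M M hol_auto_map[OF f] holomorphic_map_id[OF M] c d'(1) d p(1) d'(2)] p(2) by simp
  have "pullback_field M f H c (snd c p) = adj (Dm c d' f p) ** H d' (snd d' (f p)) ** Dm c d' f p"
    unfolding pullback_field_def pt Let_def d'_def ..
  also have "\<dots> = adj (Dm c d f p) ** H d (snd d (f p)) ** Dm c d f p"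
    unfolding hermitian_fieldD(3)[OF H d'(1) d d'(2) p(2)] pullback_mult D ..
  finally show ?thesis .
qed

lemma pullback_field_compose:
  assumes M: "complex_manifold M" and H: "hermitian_field M H" and f: "hol_auto M f" and g: "hol_auto M g"
    and c: "c \<in> atlas M" and d: "d \<in> atlas M" and p: "p \<in> fst c" "f p \<in> fst d"
  shows "pullback_field M (g \<circ> f) H c (snd c p) =
    adj (Dm c d f p) ** pullback_field M g H d (snd d (f p)) ** Dm c d f p"
proof -
  have "g (f p) \<in> topspace (mtop M)"
    by (intro hol_auto_topspace[OF g] complex_manifoldD(3)[OF M d p(2)])
  then obtain e where e: "e \<in> atlas M" "g (f p) \<in> fst e" using complex_manifoldD(2)[OF M] by blast
  have "pullback_field M (g \<circ> f) H c (snd c p) =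
      adj (Dm c e (g \<circ> f) p) ** H e (snd e (g (f p))) ** Dm c e (g \<circ> f) p"
    using pullback_field_eq[OF M H hol_auto_compose[OF M f g] c e(1) p(1)] e(2) by simp
  then show ?thesis
    unfolding pullback_field_eq[OF M H g d e(1) p(2) e(2)] pullback_mult
      Dm_compose[OF M M hol_auto_map[OF f] hol_auto_map[OF g] c d e(1) p e(2)] .
qed

lemma smooth_on_matrix_mult:
  fixes A :: "'a::real_normed_vector \<Rightarrow> complex ^ 'n::finite ^ 'm::finite" and B :: "'a \<Rightarrow> complex ^ 'k::finite ^ 'n"
  assumes S: "open S" and "smooth_on S A" "smooth_on S B"
  shows "smooth_on S (\<lambda>x. A x ** B x)"
  unfolding matrix_matrix_mult_def
  using assms by (intro smooth_on_vec_lambda[OF S] smooth_on_sum smooth_on_mult smooth_on_vec_nth)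

lemma smooth_on_adj:
  fixes A :: "'a::real_normed_vector \<Rightarrow> complex ^ 'n::finite ^ 'm::finite"
  assumes S: "open S" and "smooth_on S A"
  shows "smooth_on S (\<lambda>x. adj (A x))"
  unfolding adj_def
  using assms by (intro smooth_on_vec_lambda[OF S] smooth_on_linear_compose[OF S bounded_linear_cnj] smooth_on_vec_nth)

lemma smooth_on_matrix_derivative:
  fixes f :: "complex ^ 'n::finite \<Rightarrow> complex ^ 'm::finite"
  assumes S: "open S" and "smooth_on S f"
  shows "smooth_on S (\<lambda>x. matrix (frechet_derivative f (at x)))"
  unfolding matrix_def
  using assms by (intro smooth_on_vec_lambda[OF S] smooth_on_vec_nth smooth_on_frechet)

text \<open>Invariance is proved for forms: closedness of \<omega>^k passes to the pullback by
  naturality of d, and \<open>closed_iff_divfree\<close> translates to and from the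
  divergence.\<close>

lemma balanced_pullback_field:
  fixes M :: "('a, 'n::finite) cmanifold"
  assumes M: "complex_manifold M" and H: "balanced_field M H" and f: "hol_auto M f"
  shows "balanced_field M (pullback_field M f H)"
proof -
  obtain k where N: "CARD('n) = Suc k" using gr0_implies_Suc[OF zero_less_card_finite[where 'a = 'n]] by blast
  have hf: "hermitian_field M H" using H by (simp add: balanced_field_def)
  define Hf where "Hf = pullback_field M f H"
  have loc: "\<exists>d. d \<in> atlas M \<and> f p \<in> fst d" if "c \<in> atlas M" "p \<in> fst c" for c p
    using complex_manifoldD(2)[OF M hol_auto_topspace[OF f complex_manifoldD(3)[OF M that]]] by blast
  define dom :: "('a, 'n) chart \<Rightarrow> ('a, 'n) chart \<Rightarrow> (complex ^ 'n) set" where "dom c d = snd c ` {p \<in> fst c. f p \<in> fst d}" for c d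
  have dom: "open (dom c d)" if "c \<in> atlas M" "d \<in> atlas M" for c d
    unfolding dom_def by (rule open_rep_domain(2)[OF M M hol_auto_map[OF f] that])
  have oc: "open (snd c ` fst c)" if "c \<in> atlas M" for c
    using complex_manifoldD(1)[OF M that] chart_onD(1,3) by blast
  have Geq: "Hf c y = adj (matrix (frechet_derivative (local_rep c d f) (at y))) ** H d (local_rep c d f y) **
      matrix (frechet_derivative (local_rep c d f) (at y))"
    and Gmem: "local_rep c d f y \<in> snd d ` fst d"
    and Gder: "frechet_derivative (local_rep c d f) (at y) = (*v) (matrix (frechet_derivative (local_rep c d f) (at y)))"
    if cd: "c \<in> atlas M" "d \<in> atlas M" and y: "y \<in> dom c d" for c d y
  proof -
    from y obtain p where p: "p \<in> fst c" "f p \<in> fst d" "y = snd c p" by (auto simp: dom_def)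
    have r: "local_rep c d f y = snd d (f p)"
      unfolding p(3) by (rule chart_onD(6)[OF complex_manifoldD(1)[OF M cd(1)] p(1)])
    show "Hf c y = adj (matrix (frechet_derivative (local_rep c d f) (at y))) ** H d (local_rep c d f y) **
      matrix (frechet_derivative (local_rep c d f) (at y))"
      unfolding r unfolding p(3) Hf_def using pullback_field_eq[OF M hf f cd p(1,2)] by (simp add: Dm_def)
    show "local_rep c d f y \<in> snd d ` fst d" using r p by auto
    show "frechet_derivative (local_rep c d f) (at y) = (*v) (matrix (frechet_derivative (local_rep c d f) (at y)))"
      using Dm_works(1)[OF hol_auto_map[OF f] cd p(1,2)] unfolding Dm_def p(3) .
  qed
  have Gsm: "smooth_on (dom c d) (local_rep c d f)" if cd: "c \<in> atlas M" "d \<in> atlas M" for c d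
    unfolding dom_def by (rule smooth_on_local_rep[OF M M hol_auto_map[OF f] cd])
  have herm: "hermitian_field M Hf"
    unfolding hermitian_field_def
  proof (intro conjI ballI)
    fix c assume c: "c \<in> atlas M"
    {
      fix x assume "x \<in> snd c ` fst c"
      then obtain p where p: "p \<in> fst c" "x = snd c p" by auto
      from loc[OF c p(1)] obtain d where d: "d \<in> atlas M" "f p \<in> fst d" by blast
      show "hpd (Hf c x)"
        unfolding Hf_def p(2) pullback_field_eq[OF M hf f c d(1) p(1) d(2)]
        by (rule hpd_pullback[OF hermitian_fieldD(1)[OF hf d(1)] hol_auto_invertible[OF M f c d(1) p(1) d(2)]])
          (use d in auto)
    }
    show "smooth_on (snd c ` fst c) (Hf c)"
    proof (rule smooth_on_local)
      fix x assume "x \<in> snd c ` fst c"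
      then obtain p where p: "p \<in> fst c" "x = snd c p" by auto
      from loc[OF c p(1)] obtain d where d: "d \<in> atlas M" "f p \<in> fst d" by blast
      have HG: "smooth_on (dom c d) (\<lambda>y. H d (local_rep c d f y))"
        by (rule smooth_on_compose[OF dom[OF c d(1)] oc[OF d(1)] _ hermitian_fieldD(2)[OF hf d(1)] Gsm[OF c d(1)]])
          (use Gmem[OF c d(1)] in blast)
      have md: "smooth_on (dom c d) (\<lambda>y. matrix (frechet_derivative (local_rep c d f) (at y)))"
        by (rule smooth_on_matrix_derivative[OF dom[OF c d(1)] Gsm[OF c d(1)]])
      have "smooth_on (dom c d) (\<lambda>y. adj (matrix (frechet_derivative (local_rep c d f) (at y))) **
          H d (local_rep c d f y) ** matrix (frechet_derivative (local_rep c d f) (at y)))"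
        by (intro smooth_on_matrix_mult smooth_on_adj dom[OF c d(1)] HG md)
      then have "smooth_on (dom c d) (Hf c)"
        by (rule smooth_on_cong[OF dom[OF c d(1)], rotated]) (simp add: Geq[OF c d(1)])
      then show "\<exists>U. open U \<and> x \<in> U \<and> smooth_on (snd c ` fst c \<inter> U) (Hf c)"
        using dom[OF c d(1)] p d smooth_on_subset[of "dom c d" "Hf c" "snd c ` fst c \<inter> dom c d"]
        by (intro exI[of _ "dom c d"]) (auto simp: dom_def)
    qed
    fix d p assume d: "d \<in> atlas M" and p: "p \<in> fst c \<inter> fst d"
    show "Hf c (snd c p) = adj (Dm c d id p) ** Hf d (snd d p) ** Dm c d id p"
      using pullback_field_compose[OF M hf hol_auto_id[OF M] f c d, of p] p by (simp add: Hf_def)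
  qed
  have "divfree (\<lambda>y. ldual (Hf c y)) x" if c: "c \<in> atlas M" and x: "x \<in> snd c ` fst c" for c x
    unfolding closed_iff_divfree[OF M herm N c x, symmetric]
  proof
    fix v
    obtain p where p: "p \<in> fst c" "x = snd c p" using x by auto
    from loc[OF c p(1)] obtain d where d: "d \<in> atlas M" "f p \<in> fst d" by blast
    define G where "G = local_rep c d f"
    have xd: "x \<in> dom c d" using p d by (auto simp: dom_def)
    have eq: "om_power (om (Hf c y)) k w = om_power (om (H d (G y))) k (\<lambda>i. frechet_derivative G (at y) (w i))"
      if "y \<in> dom c d" for y w
    proof -
      have "om (Hf c y) = (\<lambda>u v. om (H d (G y)) (frechet_derivative G (at y) u) (frechet_derivative G (at y) v))"
      proof -
        define D where "D = matrix (frechet_derivative (local_rep c d f) (at y))"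
        show ?thesis
          unfolding G_def Geq[OF c d(1) that, folded D_def] Gder[OF c d(1) that, folded D_def] by (intro ext om_pullback)
      qed
      then have "om_power (om (Hf c y)) k w =
          om_power (\<lambda>u v. om (H d (G y)) (frechet_derivative G (at y) u) (frechet_derivative G (at y) v)) k w"
        by (simp only:)
      then show ?thesis by (simp only: om_power_natural)
    qed
    have "ext_deriv (2 * k) (\<lambda>y. om_power (om (Hf c y)) k) x v =
        ext_deriv (2 * k) (\<lambda>y v. om_power (om (H d (G y))) k (\<lambda>i. frechet_derivative G (at y) (v i))) x v"
      unfolding ext_deriv_def
      by (intro sum.cong refl arg_cong2[where f = "(*)"] fun_cong[OF frechet_derivative_cong[OF dom[OF c d(1)] xd]]) (rule eq)
    also have "\<dots> = ext_deriv (2 * k) (\<lambda>z. om_power (om (H d z)) k) (G x) (\<lambda>i. frechet_derivative G (at x) (v i))"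
    proof (rule ext_deriv_pullback[OF dom[OF c d(1)] xd Gsm[OF c d(1), folded G_def] oc[OF d(1)]])
      show "G ` dom c d \<subseteq> snd d ` fst d" using Gmem[OF c d(1)] by (auto simp: G_def)
      show "alternating_form (2 * k) (om_power (om (H d z)) k)" for z
        by (rule alternating_om_power[OF bilinear_om])
      show "(\<lambda>z. om_power (om (H d z)) k w) differentiable (at z)" if "z \<in> snd d ` fst d" for z w
      proof -
        have "smooth_on (snd d ` fst d) (\<lambda>z. om_power (om (H d z)) k w)"
          by (intro smooth_on_om_power smooth_on_om oc[OF d(1)] hermitian_fieldD(2)[OF hf d(1)])
        from smooth_on_has_derivative[OF this that] show ?thesis unfolding differentiable_def by blast
      qed
    qed
    also have "\<dots> = 0"
    proof -
      have z: "G x \<in> snd d ` fst d" using Gmem[OF c d(1) xd] by (simp add: G_def)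
      have "divfree (\<lambda>y. ldual (H d y)) (G x)" using H d(1) z unfolding balanced_field_def by blast
      then show ?thesis using closed_iff_divfree[OF M hf N d(1) z] by blast
    qed
    finally show "ext_deriv (2 * k) (\<lambda>y. om_power (om (Hf c y)) k) x v = 0" .
  qed
  with herm show ?thesis by (simp add: balanced_field_def Hf_def)
qed

section \<open>Quotients by properly discontinuous actions\<close>

lemma istopology_quotient:
  "istopology (\<lambda>U. U \<subseteq> q ` topspace X \<and> openin X {x \<in> topspace X. q x \<in> U})"
  unfolding istopology_def
proof (intro conjI allI impI)
  fix S T assume "S \<subseteq> q ` topspace X \<and> openin X {x \<in> topspace X. q x \<in> S}"
    "T \<subseteq> q ` topspace X \<and> openin X {x \<in> topspace X. q x \<in> T}"
  moreover have "{x \<in> topspace X. q x \<in> S \<inter> T} = {x \<in> topspace X. q x \<in> S} \<inter> {x \<in> topspace X. q x \<in> T}" by auto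
  ultimately show "S \<inter> T \<subseteq> q ` topspace X" "openin X {x \<in> topspace X. q x \<in> S \<inter> T}"
    by (auto simp del: Int_iff)
next
  fix K assume K: "\<forall>U\<in>K. U \<subseteq> q ` topspace X \<and> openin X {x \<in> topspace X. q x \<in> U}"
  then show "\<Union> K \<subseteq> q ` topspace X" by blast
  have "{x \<in> topspace X. q x \<in> \<Union> K} = (\<Union>U\<in>K. {x \<in> topspace X. q x \<in> U})" by auto
  then show "openin X {x \<in> topspace X. q x \<in> \<Union> K}" using K by auto
qed

lemma openin_quotient_topology:
  "openin (quotient_topology X q) U \<longleftrightarrow> U \<subseteq> q ` topspace X \<and> openin X {x \<in> topspace X. q x \<in> U}"
  unfolding quotient_topology_def by (simp add: topology_inverse'[OF istopology_quotient])

lemma topspace_quotient_topology: "topspace (quotient_topology X q) = q ` topspace X"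
proof
  show "topspace (quotient_topology X q) \<subseteq> q ` topspace X"
    using openin_topspace[of "quotient_topology X q"] unfolding openin_quotient_topology by blast
  have "openin (quotient_topology X q) (q ` topspace X)"
  proof -
    have "{x \<in> topspace X. q x \<in> q ` topspace X} = topspace X" by auto
    then show ?thesis by (simp add: openin_quotient_topology)
  qed
  then show "q ` topspace X \<subseteq> topspace (quotient_topology X q)" by (rule openin_subset)
qed

text \<open>The index type carries no group structure; all that matters is that \<open>q\<close>
  collects orbits and is constant along them. \<open>separated\<close> yields the Hausdorff
  property, and \<open>discontinuous\<close> yields open sets on which \<open>q\<close> is
  injective.\<close>

locale quotient_action =
  fixes N :: "('x, 'm::finite) cmanifold" and act :: "'g \<Rightarrow> 'x \<Rightarrow> 'x" and q :: "'x \<Rightarrow> 'x set"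
  assumes N: "complex_manifold N" and hol: "\<And>g. hol_auto N (act g)"
    and q: "\<And>x. q x = range (\<lambda>g. act g x)"
    and q_act: "\<And>g x. x \<in> topspace (mtop N) \<Longrightarrow> q (act g x) = q x"
    and q_refl: "\<And>x. x \<in> topspace (mtop N) \<Longrightarrow> x \<in> q x"
    and separated: "\<And>x y. x \<in> topspace (mtop N) \<Longrightarrow> y \<in> topspace (mtop N) \<Longrightarrow> q x \<noteq> q y \<Longrightarrow>
      \<exists>U V. openin (mtop N) U \<and> openin (mtop N) V \<and> x \<in> U \<and> y \<in> V \<and> (\<forall>g. \<forall>u\<in>U. act g u \<notin> V)"
    and discontinuous: "\<And>x. x \<in> topspace (mtop N) \<Longrightarrow>
      \<exists>U. openin (mtop N) U \<and> x \<in> U \<and> (\<forall>g. \<forall>u\<in>U. act g u \<in> U \<longrightarrow> act g u = u)"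
begin

abbreviation "X \<equiv> mtop N"
abbreviation "S \<equiv> quotient_manifold N q"

lemma q_eqD: "x \<in> topspace X \<Longrightarrow> y \<in> topspace X \<Longrightarrow> q x = q y \<Longrightarrow> \<exists>g. y = act g x"
  using q_refl[of y] q[of x] by auto

lemma mtop_S: "mtop S = quotient_topology X q"
  by (simp add: quotient_manifold_def)

lemma atlas_S: "atlas S = {(q ` W, snd c \<circ> inv_into W q) | c W.
    c \<in> atlas N \<and> openin X W \<and> W \<subseteq> fst c \<and> inj_on q W}"
  by (simp add: quotient_manifold_def)

text \<open>The saturation of \<open>W\<close> is the union of its preimages under the maps
  \<open>act g\<close>, each of them open by continuity.\<close>

lemma open_q:
  assumes "openin X W"
  shows "openin (mtop S) (q ` W)"
proof -
  have W: "W \<subseteq> topspace X" using assms by (rule openin_subset)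
  have "{x \<in> topspace X. q x \<in> q ` W} = (\<Union>g. {x \<in> topspace X. act g x \<in> W})"
  proof (intro set_eqI iffI)
    fix x assume "x \<in> {x \<in> topspace X. q x \<in> q ` W}"
    then obtain w where w: "x \<in> topspace X" "w \<in> W" "q x = q w" by auto
    then obtain g where "w = act g x" using q_eqD W by blast
    then show "x \<in> (\<Union>g. {x \<in> topspace X. act g x \<in> W})" using w by auto
  next
    fix x assume "x \<in> (\<Union>g. {x \<in> topspace X. act g x \<in> W})"
    then obtain g where g: "x \<in> topspace X" "act g x \<in> W" by auto
    then have "q x = q (act g x)" using q_act by simp
    then show "x \<in> {x \<in> topspace X. q x \<in> q ` W}" using g by auto
  qed
  moreover have "openin X {x \<in> topspace X. act g x \<in> W}" for g
    using hol_auto_map[OF hol[of g]] assms unfolding holomorphic_map_def continuous_map_def by blast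
  ultimately show ?thesis using W unfolding mtop_S openin_quotient_topology by auto
qed

lemma chart_S:
  assumes c: "c \<in> atlas N" and W: "openin X W" "W \<subseteq> fst c" "inj_on q W"
  shows "chart_on (mtop S) (q ` W, snd c \<circ> inv_into W q)"
    "(snd c \<circ> inv_into W q) ` q ` W = snd c ` W"
    "\<And>w. w \<in> W \<Longrightarrow> inv_into (q ` W) (snd c \<circ> inv_into W q) (snd c w) = q w"
proof -
  note cc = complex_manifoldD(1)[OF N c]
  have inv: "inv_into W q (q w) = w" if "w \<in> W" for w using W(3) that by simp
  show im: "(snd c \<circ> inv_into W q) ` q ` W = snd c ` W"
    by (force simp: inv image_iff)
  have inj: "inj_on (snd c \<circ> inv_into W q) (q ` W)"
    using chart_onD(2)[OF cc] W(2) by (auto simp: inj_on_def inv subset_iff)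
  show "inv_into (q ` W) (snd c \<circ> inv_into W q) (snd c w) = q w" if "w \<in> W" for w
    using inv_into_f_f[OF inj, of "q w"] that by (simp add: inv)
  show "chart_on (mtop S) (q ` W, snd c \<circ> inv_into W q)"
    unfolding chart_on_def fst_conv snd_conv
  proof (intro conjI allI impI inj open_q W(1))
    fix W' assume W': "W' \<subseteq> q ` W"
    define Z where "Z = {w \<in> W. q w \<in> W'}"
    have qZ: "q ` Z = W'" using W' by (auto simp: Z_def)
    have Z': "inv_into W q ` W' = Z" unfolding qZ[symmetric] by (force simp: Z_def inv image_iff)
    have im: "(snd c \<circ> inv_into W q) ` W' = snd c ` Z" unfolding image_comp[symmetric] Z' ..
    have ZW: "Z \<subseteq> W" by (auto simp: Z_def)
    have "openin (mtop S) W' \<longleftrightarrow> openin X Z"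
    proof
      assume "openin (mtop S) W'"
      then have "openin X {x \<in> topspace X. q x \<in> W'}" by (simp add: mtop_S openin_quotient_topology)
      then have "openin X (W \<inter> {x \<in> topspace X. q x \<in> W'})" using W(1) by blast
      moreover have "W \<inter> {x \<in> topspace X. q x \<in> W'} = Z" using openin_subset[OF W(1)] by (auto simp: Z_def)
      ultimately show "openin X Z" by simp
    next
      assume "openin X Z"
      then show "openin (mtop S) W'" using open_q qZ by metis
    qed
    also have "\<dots> \<longleftrightarrow> open (snd c ` Z)"
      using chart_onD(3,4)[OF cc, of Z] ZW W(2) by blast
    finally show "openin (mtop S) W' = open ((snd c \<circ> inv_into W q) ` W')" unfolding im .
  qed
qed

text \<open>A transition map of the quotient is locally the expression of a single
  \<open>act g\<close>: the two representatives of a common point lie in one orbit. So holomorphy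
  and invariance under the action pass to the quotient charts.\<close>

lemma local_rep_S:
  assumes c1: "c1 \<in> atlas N" and W1: "openin X W1" "W1 \<subseteq> fst c1" "inj_on q W1"
    and c2: "c2 \<in> atlas N" and W2: "openin X W2" "W2 \<subseteq> fst c2" "inj_on q W2"
    and w: "w \<in> W1" "q w \<in> q ` W2"
  shows "\<exists>g U. act g w \<in> W2 \<and> open U \<and> snd c1 w \<in> U \<and>
    (\<forall>y\<in>U. local_rep c1 c2 (act g) y =
      local_rep (q ` W1, snd c1 \<circ> inv_into W1 q) (q ` W2, snd c2 \<circ> inv_into W2 q) id y)"
proof -
  note cc1 = complex_manifoldD(1)[OF N c1]
  from w(2) obtain w2 where w2: "w2 \<in> W2" "q w = q w2" by auto
  then obtain g where g: "w2 = act g w"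
    using q_eqD openin_subset[OF W1(1)] openin_subset[OF W2(1)] w(1) by blast
  \<comment> \<open>On this neighbourhood of \<open>w\<close> the same \<open>g\<close> leads into
    \<open>W2\<close>, where \<open>q\<close> is injective.\<close>
  define Z where "Z = W1 \<inter> {x \<in> topspace X. act g x \<in> W2}"
  have Z: "openin X Z"
    using hol_auto_map[OF hol[of g]] W1(1) W2(1) unfolding Z_def holomorphic_map_def continuous_map_def by blast
  have "local_rep c1 c2 (act g) y =
      local_rep (q ` W1, snd c1 \<circ> inv_into W1 q) (q ` W2, snd c2 \<circ> inv_into W2 q) id y"
    if "y \<in> snd c1 ` Z" for y
  proof -
    from that obtain z where z: "z \<in> W1" "z \<in> topspace X" "act g z \<in> W2" "y = snd c1 z" by (auto simp: Z_def)
    have "local_rep c1 c2 (act g) y = snd c2 (act g z)"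
      unfolding z(4) by (rule chart_onD(6)[OF cc1]) (use z W1 in auto)
    moreover have "inv_into W2 q (q z) = act g z"
      using inv_into_f_f[OF W2(3) z(3)] q_act[OF z(2), of g] by simp
    ultimately show ?thesis
      unfolding local_rep_def z(4) by (simp add: chart_S(3)[OF c1 W1 z(1)])
  qed
  moreover have "open (snd c1 ` Z)" by (rule chart_onD(3)[OF cc1 _ Z]) (use W1 in \<open>auto simp: Z_def\<close>)
  moreover have "snd c1 w \<in> snd c1 ` Z" using w w2 g openin_subset[OF W1(1)] by (auto simp: Z_def)
  ultimately show ?thesis using w2 g by blast
qed

lemma complex_manifold_S: "complex_manifold S"
  unfolding complex_manifold_chart_iff
proof (intro conjI ballI)
  show "Hausdorff_space (mtop S)"
    unfolding Hausdorff_space_def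
  proof (intro allI impI)
    fix a b assume "a \<in> topspace (mtop S) \<and> b \<in> topspace (mtop S) \<and> a \<noteq> b"
    then obtain x y where xy: "x \<in> topspace X" "y \<in> topspace X" "a = q x" "b = q y" "q x \<noteq> q y"
      by (auto simp: mtop_S topspace_quotient_topology)
    from separated[OF xy(1,2,5)] obtain U V where UV: "openin X U" "openin X V" "x \<in> U" "y \<in> V"
      "\<And>g u. u \<in> U \<Longrightarrow> act g u \<notin> V" by blast
    have "disjnt (q ` U) (q ` V)"
      unfolding disjnt_iff
    proof (intro allI notI)
      fix z assume "z \<in> q ` U \<and> z \<in> q ` V"
      then obtain u v where "u \<in> U" "v \<in> V" "q u = q v" by blast
      then show False using q_eqD[of u v] UV(5) openin_subset[OF UV(1)] openin_subset[OF UV(2)] by blast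
    qed
    then show "\<exists>U V. openin (mtop S) U \<and> openin (mtop S) V \<and> a \<in> U \<and> b \<in> V \<and> disjnt U V"
      using open_q UV xy by blast
  qed
  show "second_countable (mtop S)"
  proof (rule second_countable_open_map_image)
    show "continuous_map X (mtop S) q"
      unfolding continuous_map_def mtop_S topspace_quotient_topology openin_quotient_topology by auto
    show "open_map X (mtop S) q" using open_q by (auto simp: open_map_def)
    show "q ` topspace X = topspace (mtop S)" by (simp add: mtop_S topspace_quotient_topology)
    show "second_countable X" using N by (simp add: complex_manifold_def)
  qed
  show "(\<Union>c\<in>atlas S. fst c) = topspace (mtop S)"
  proof
    show "(\<Union>c\<in>atlas S. fst c) \<subseteq> topspace (mtop S)"
      unfolding atlas_S mtop_S topspace_quotient_topology using openin_subset by fastforce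
    show "topspace (mtop S) \<subseteq> (\<Union>c\<in>atlas S. fst c)"
    proof
      fix a assume "a \<in> topspace (mtop S)"
      then obtain x where x: "x \<in> topspace X" "a = q x" by (auto simp: mtop_S topspace_quotient_topology)
      obtain c where c: "c \<in> atlas N" "x \<in> fst c" using complex_manifoldD(2)[OF N x(1)] by blast
      from discontinuous[OF x(1)] obtain U where U: "openin X U" "x \<in> U"
        "\<And>g u. u \<in> U \<Longrightarrow> act g u \<in> U \<Longrightarrow> act g u = u" by blast
      have "inj_on q (U \<inter> fst c)"
      proof (rule inj_onI)
        fix u v assume "u \<in> U \<inter> fst c" "v \<in> U \<inter> fst c" "q u = q v"
        moreover from this obtain g where "v = act g u" using q_eqD[of u v] openin_subset[OF U(1)] by blast
        ultimately show "u = v" using U(3)[of u g] by simp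
      qed
      moreover have "openin X (U \<inter> fst c)"
        using U(1) chart_onD(1)[OF complex_manifoldD(1)[OF N c(1)]] by blast
      ultimately have "(q ` (U \<inter> fst c), snd c \<circ> inv_into (U \<inter> fst c) q) \<in> atlas S"
        unfolding atlas_S using c(1) by blast
      then show "a \<in> (\<Union>c\<in>atlas S. fst c)" using x U(2) c(2) by force
    qed
  qed
  show "chart_on (mtop S) k" if "k \<in> atlas S" for k
    using that chart_S(1) unfolding atlas_S by blast
  fix k1 k2 assume "k1 \<in> atlas S" "k2 \<in> atlas S"
  then obtain c1 W1 c2 W2 where k1: "k1 = (q ` W1, snd c1 \<circ> inv_into W1 q)" "c1 \<in> atlas N" "openin X W1" "W1 \<subseteq> fst c1" "inj_on q W1"
    and k2: "k2 = (q ` W2, snd c2 \<circ> inv_into W2 q)" "c2 \<in> atlas N" "openin X W2" "W2 \<subseteq> fst c2" "inj_on q W2"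
    unfolding atlas_S by blast
  show "holomorphic_vec_on (local_rep k1 k2 id) (snd k1 ` (fst k1 \<inter> fst k2))"
    unfolding holomorphic_vec_on_def
  proof
    fix x assume "x \<in> snd k1 ` (fst k1 \<inter> fst k2)"
    then obtain a where a: "a \<in> q ` W1" "a \<in> q ` W2" "x = snd c1 (inv_into W1 q a)"
      unfolding k1(1) k2(1) by auto
    then obtain w where w': "w \<in> W1" "a = q w" by blast
    have w: "w \<in> W1" "q w \<in> q ` W2" "x = snd c1 w"
      using w' a inv_into_f_f[OF k1(5) w'(1)] by simp_all
    from local_rep_S[OF k1(2-5) k2(2-5) w(1,2)] obtain g U where g: "act g w \<in> W2" "open U" "x \<in> U"
      "\<And>y. y \<in> U \<Longrightarrow> local_rep c1 c2 (act g) y = local_rep k1 k2 id y"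
      unfolding k1(1) k2(1) w(3) by blast
    have "(local_rep c1 c2 (act g) has_derivative (*v) (Dm c1 c2 (act g) w)) (at x)"
      unfolding w(3) by (rule Dm_works(2)[OF hol_auto_map[OF hol] k1(2) k2(2)]) (use w g k1 k2 in auto)
    then have "(local_rep k1 k2 id has_derivative (*v) (Dm c1 c2 (act g) w)) (at x)"
      by (rule has_derivative_transform_within_open[OF _ g(2,3,4)])
    then show "\<exists>D. (local_rep k1 k2 id has_derivative D) (at x) \<and> Vector_Spaces.linear (*s) (*s) D"
      using matrix_vector_mul_linear_gen by blast
  qed
qed

text \<open>Quotient charts have the same coordinate images as pieces of charts upstairs, so
  \<open>H\<close> is reused unchanged. Invariance is precisely compatibility with the new
  transition maps.\<close>

lemma balanced_S:
  assumes H: "balanced_field N H"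
    and inv: "\<And>g c d p. c \<in> atlas N \<Longrightarrow> d \<in> atlas N \<Longrightarrow> p \<in> fst c \<Longrightarrow> act g p \<in> fst d \<Longrightarrow>
      H c (snd c p) = adj (Dm c d (act g) p) ** H d (snd d (act g p)) ** Dm c d (act g) p"
  shows "balanced_manifold S"
proof -
  have hf: "hermitian_field N H" using H by (simp add: balanced_field_def)
  define rep where "rep k c W \<longleftrightarrow> k = (q ` W, snd c \<circ> inv_into W q) \<and> c \<in> atlas N \<and> openin X W \<and> W \<subseteq> fst c \<and> inj_on q W"
    for k c W
  \<comment> \<open>A quotient chart may arise from several charts of \<open>N\<close>; one is
    fixed, and the compatibility law is checked for these choices.\<close>
  define cof where "cof k = (SOME c. \<exists>W. rep k c W)" for k
  define HS where "HS k = H (cof k)" for k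
  have repex: "\<exists>W. rep k (cof k) W" if "k \<in> atlas S" for k
  proof -
    from that have "\<exists>c W. rep k c W" unfolding atlas_S rep_def by blast
    then show ?thesis unfolding cof_def by (rule someI_ex)
  qed
  have im: "snd k ` fst k = snd c ` W" if "rep k c W" for k c W
    using that chart_S(2)[of c W] by (simp add: rep_def)
  have sub: "snd k ` fst k \<subseteq> snd (cof k) ` fst (cof k)" if k: "k \<in> atlas S" for k
  proof -
    from repex[OF k] obtain W where W: "rep k (cof k) W" by blast
    show ?thesis unfolding im[OF W] using W by (auto simp: rep_def)
  qed
  have cofN: "cof k \<in> atlas N" if "k \<in> atlas S" for k using repex[OF that] by (auto simp: rep_def)
  have "hermitian_field S HS"
    unfolding hermitian_field_def
  proof (intro conjI ballI)
    fix k assume k: "k \<in> atlas S"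
    show "hpd (HS k x)" if "x \<in> snd k ` fst k" for x
      unfolding HS_def using hermitian_fieldD(1)[OF hf cofN[OF k]] sub[OF k] that by blast
    show "smooth_on (snd k ` fst k) (HS k)"
      unfolding HS_def by (rule smooth_on_subset[OF hermitian_fieldD(2)[OF hf cofN[OF k]] sub[OF k]])
    fix k2 a assume k2: "k2 \<in> atlas S" and a: "a \<in> fst k \<inter> fst k2"
    from repex[OF k] obtain W1 where r1: "rep k (cof k) W1" by blast
    from repex[OF k2] obtain W2 where r2: "rep k2 (cof k2) W2" by blast
    have k1': "k = (q ` W1, snd (cof k) \<circ> inv_into W1 q)" and W1: "openin X W1" "W1 \<subseteq> fst (cof k)" "inj_on q W1"
      using r1 by (auto simp: rep_def)
    have k2': "k2 = (q ` W2, snd (cof k2) \<circ> inv_into W2 q)" and W2: "openin X W2" "W2 \<subseteq> fst (cof k2)" "inj_on q W2"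
      using r2 by (auto simp: rep_def)
    have fk: "fst k = q ` W1" "fst k2 = q ` W2" "snd k = snd (cof k) \<circ> inv_into W1 q" "snd k2 = snd (cof k2) \<circ> inv_into W2 q"
      using k1' k2' by (metis fst_conv, metis fst_conv, metis snd_conv, metis snd_conv)
    from a obtain w where w: "w \<in> W1" "q w \<in> q ` W2" "a = q w" unfolding fk by blast
    have ka: "snd k a = snd (cof k) w" unfolding fk w(3) using W1(3) w(1) by simp
    from local_rep_S[OF cofN[OF k] W1 cofN[OF k2] W2 w(1,2)] obtain g U where
      g: "act g w \<in> W2" "open U" "snd (cof k) w \<in> U"
      and eq: "\<And>y. y \<in> U \<Longrightarrow> local_rep (cof k) (cof k2) (act g) y = local_rep k k2 id y"
      unfolding k1'[symmetric] k2'[symmetric] by blast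
    have wX: "w \<in> topspace X" using w(1) openin_subset[OF W1(1)] by blast
    have k2a: "snd k2 a = snd (cof k2) (act g w)"
      unfolding fk w(3) using inv_into_f_f[OF W2(3) g(1)] q_act[OF wX, of g] by simp
    have D: "Dm k k2 id a = Dm (cof k) (cof k2) (act g) w"
      unfolding Dm_def ka using frechet_derivative_cong[OF g(2,3) eq] by simp
    show "HS k (snd k a) = adj (Dm k k2 id a) ** HS k2 (snd k2 a) ** Dm k k2 id a"
      unfolding D ka k2a HS_def by (rule inv[OF cofN[OF k] cofN[OF k2]]) (use w g W1 W2 in auto)
  qed
  moreover have "divfree (\<lambda>y. ldual (HS k y)) x" if k: "k \<in> atlas S" and x: "x \<in> snd k ` fst k" for k x
    using H cofN[OF k] sub[OF k] x unfolding balanced_field_def HS_def by blast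
  ultimately have "balanced_field S HS" by (simp add: balanced_field_def)
  then show ?thesis
    unfolding balanced_manifold_def using complex_manifold_S balanced_field_imp_metric[OF complex_manifold_S] by blast
qed

end

section \<open>The product with the plane\<close>

definition plane_chart :: "('a, 'n::finite) chart \<Rightarrow> ('a \<times> complex, 'n option) chart" where
  "plane_chart c = (fst c \<times> UNIV, \<lambda>(p, z). mkv (snd c p) z)"

definition shift_map :: "('a \<Rightarrow> 'a) \<Rightarrow> complex \<Rightarrow> 'a \<times> complex \<Rightarrow> 'a \<times> complex" where
  "shift_map f \<tau> = (\<lambda>(p, z). (f p, z + \<tau>))"

lemma times_plane_simps:
  "mtop (times_plane M) = prod_topology (mtop M) euclidean"
  "atlas (times_plane M) = plane_chart ` atlas M"
  by (auto simp: times_plane_def plane_chart_def mkv_def split_def image_iff)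

lemma topspace_times_plane: "topspace (mtop (times_plane M)) = topspace (mtop M) \<times> UNIV"
  by (simp add: times_plane_simps)

lemma plane_chart_simps [simp]:
  "fst (plane_chart c) = fst c \<times> UNIV" "snd (plane_chart c) (p, z) = mkv (snd c p) z"
  by (simp_all add: plane_chart_def)

lemma mkv_eq_iff [simp]: "mkv u a = mkv w b \<longleftrightarrow> u = w \<and> a = b"
  by (metis mkv_nth(1) wpart_mkv)

lemma linear_mkv_right: "linear (\<lambda>z. mkv 0 z)"
  by (rule linearI) (auto simp: vec_eq_iff mkv_def split: option.split)

lemma mkv_split: "mkv w z = mkv w 0 + mkv 0 z"
  by (auto simp: vec_eq_iff mkv_def split: option.split)

lemma bounded_linear_wpart: "bounded_linear wpart"
  using linear_wpart by (rule linear_conv_bounded_linear[THEN iffD1])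

lemma continuous_on_mkv: "continuous_on UNIV (\<lambda>(w, z). mkv w z)"
proof -
  have "continuous_on UNIV (\<lambda>x. mkv (fst x) 0 + mkv 0 (snd x))"
    by (intro continuous_on_add linear_continuous_on_compose[OF continuous_on_fst[OF continuous_on_id] linear_mkv]
        linear_continuous_on_compose[OF continuous_on_snd[OF continuous_on_id] linear_mkv_right])
  then show ?thesis by (simp add: split_def mkv_split[symmetric])
qed

lemma open_parts:
  assumes "open A" "open B"
  shows "open {y :: complex ^ ('n::finite option). wpart y \<in> A \<and> y $ None \<in> B}"
proof -
  have "open (wpart -` A \<inter> (\<lambda>y. y $ None) -` B :: (complex ^ ('n option)) set)"
    using assms by (intro open_Int continuous_open_vimage linear_continuous_at bounded_linear_wpart bounded_linear_vec_nth) auto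
  moreover have "wpart -` A \<inter> (\<lambda>y. y $ None) -` B = {y :: complex ^ ('n option). wpart y \<in> A \<and> y $ None \<in> B}" by auto
  ultimately show ?thesis by simp
qed

lemma chart_on_plane_chart:
  fixes c :: "('a, 'n::finite) chart"
  assumes c: "chart_on X c"
  shows "chart_on (prod_topology X euclidean) (plane_chart c)"
  unfolding chart_on_def plane_chart_simps(1)
proof (intro conjI allI impI)
  show "openin (prod_topology X euclidean) (fst c \<times> UNIV)"
    using chart_onD(1)[OF c] by (simp add: openin_prod_Times_iff)
  show inj: "inj_on (snd (plane_chart c)) (fst c \<times> UNIV)"
    using chart_onD(2)[OF c] by (auto simp: inj_on_def)
  fix W :: "('a \<times> complex) set" assume W: "W \<subseteq> fst c \<times> UNIV"
  show "openin (prod_topology X euclidean) W \<longleftrightarrow> open (snd (plane_chart c) ` W)"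
  proof
    assume o: "openin (prod_topology X euclidean) W"
    show "open (snd (plane_chart c) ` W)"
    proof (subst open_subopen, intro ballI)
      fix y assume "y \<in> snd (plane_chart c) ` W"
      then obtain p z where pz: "(p, z) \<in> W" "y = mkv (snd c p) z" by auto
      have "\<exists>A B. openin X A \<and> openin euclidean B \<and> p \<in> A \<and> z \<in> B \<and> A \<times> B \<subseteq> W"
        using iffD1[OF openin_prod_topology_alt o] pz(1) by simp
      then obtain A B where AB: "openin X A" "open B" "p \<in> A" "z \<in> B" "A \<times> B \<subseteq> W"
        by (elim exE conjE) (simp only: open_openin[symmetric])
      have "open (snd c ` (A \<inter> fst c))"
        by (rule chart_onD(3)[OF c]) (auto intro: AB chart_onD(1)[OF c])
      then have "open {y :: complex ^ ('n option). wpart y \<in> snd c ` (A \<inter> fst c) \<and> y $ None \<in> B}"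
        using AB(2) by (rule open_parts)
      moreover have "y \<in> {y. wpart y \<in> snd c ` (A \<inter> fst c) \<and> y $ None \<in> B}" using pz AB W by auto
      moreover have "{y. wpart y \<in> snd c ` (A \<inter> fst c) \<and> y $ None \<in> B} \<subseteq> snd (plane_chart c) ` W"
      proof
        fix y' :: "complex ^ ('n option)" assume "y' \<in> {y. wpart y \<in> snd c ` (A \<inter> fst c) \<and> y $ None \<in> B}"
        then obtain p' where p': "p' \<in> A" "wpart y' = snd c p'" "y' $ None \<in> B" by auto
        then have "y' = snd (plane_chart c) (p', y' $ None)" using mkv_parts[of y'] by simp
        then show "y' \<in> snd (plane_chart c) ` W" using AB(5) p' by blast
      qed
      ultimately show "\<exists>T. open T \<and> y \<in> T \<and> T \<subseteq> snd (plane_chart c) ` W" by blast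
    qed
  next
    assume o: "open (snd (plane_chart c) ` W)"
    show "openin (prod_topology X euclidean) W"
      unfolding openin_prod_topology_alt
    proof (intro allI impI)
      fix p z assume pz: "(p, z) \<in> W"
      have "open ((\<lambda>(w, z). mkv w z) -` (snd (plane_chart c) ` W))"
        by (rule open_vimage[OF o continuous_on_mkv])
      moreover have "(snd c p, z) \<in> (\<lambda>(w, z). mkv w z) -` (snd (plane_chart c) ` W)" using pz by force
      ultimately obtain P B where PB: "open P" "open B" "snd c p \<in> P" "z \<in> B"
        "P \<times> B \<subseteq> (\<lambda>(w, z). mkv w z) -` (snd (plane_chart c) ` W)"
        by (rule open_prod_elim) auto
      define A where "A = {p \<in> fst c. snd c p \<in> P}"
      have "snd c ` A = P \<inter> snd c ` fst c" by (auto simp: A_def)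
      moreover have "open (snd c ` fst c)" by (rule chart_onD(3)[OF c order_refl chart_onD(1)[OF c]])
      ultimately have "openin X A" using chart_onD(4)[OF c, of A] PB(1) by (auto simp: A_def)
      moreover have "A \<times> B \<subseteq> W"
      proof
        fix x assume "x \<in> A \<times> B"
        then obtain p' z' where x: "x = (p', z')" "p' \<in> fst c" "snd c p' \<in> P" "z' \<in> B" by (auto simp: A_def)
        then have "(snd c p', z') \<in> (\<lambda>(w, z). mkv w z) -` (snd (plane_chart c) ` W)" using PB(5) by blast
        then obtain p'' z'' where w: "(p'', z'') \<in> W" "mkv (snd c p') z' = mkv (snd c p'') z''" by auto
        then have "p' = p''" "z' = z''" using chart_onD(2)[OF c] x(2) W by (auto simp: inj_on_def)
        then show "x \<in> W" using w x by simp
      qed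
      ultimately show "\<exists>U V. openin X U \<and> openin euclidean V \<and> p \<in> U \<and> z \<in> V \<and> U \<times> V \<subseteq> W"
        using PB pz W by (intro exI[of _ A] exI[of _ B]) (auto simp: A_def)
    qed
  qed
qed

text \<open>The translation of the plane has derivative 1, so the Jacobian is block
  diagonal.\<close>

lemma local_rep_shift_map:
  fixes M :: "('a, 'n::finite) cmanifold"
  assumes M: "complex_manifold M" and f: "holomorphic_map M M f"
    and c: "c \<in> atlas M" and d: "d \<in> atlas M" and p: "p \<in> fst c" "f p \<in> fst d"
  shows "(local_rep (plane_chart c) (plane_chart d) (shift_map f \<tau>) has_derivative
    (*v) (blk (Dm c d f p) 1)) (at (mkv (snd c p) z))"
proof -
  note cc = complex_manifoldD(1)[OF M c]
  have o: "open (snd c ` {p \<in> fst c. f p \<in> fst d})" by (rule open_rep_domain(2)[OF M M f c d])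
  have "((\<lambda>y. local_rep c d f (wpart y)) has_derivative (\<lambda>h. Dm c d f p *v wpart h)) (at (mkv (snd c p) z))"
    using has_derivative_compose[OF bounded_linear_imp_has_derivative[OF bounded_linear_wpart], of "local_rep c d f" _ "mkv (snd c p) z" UNIV]
      Dm_works(2)[OF f c d p] by simp
  then have 1: "((\<lambda>y. mkv (local_rep c d f (wpart y)) 0) has_derivative (\<lambda>h. mkv (Dm c d f p *v wpart h) 0)) (at (mkv (snd c p) z))"
    by (rule bounded_linear.has_derivative[OF linear_conv_bounded_linear[THEN iffD1, OF linear_mkv]])
  have "((\<lambda>y. y $ None + \<tau>) has_derivative (\<lambda>h. h $ None)) (at (mkv (snd c p) z))"
    by (auto intro!: derivative_eq_intros bounded_linear_imp_has_derivative bounded_linear_vec_nth)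
  then have "((\<lambda>y. mkv 0 (y $ None + \<tau>)) has_derivative (\<lambda>h. mkv 0 (h $ None))) (at (mkv (snd c p) z))"
    by (rule bounded_linear.has_derivative[OF linear_conv_bounded_linear[THEN iffD1, OF linear_mkv_right]])
  from has_derivative_add[OF 1 this]
  have "((\<lambda>y. mkv (local_rep c d f (wpart y)) (y $ None + \<tau>)) has_derivative
      (*v) (blk (Dm c d f p) 1)) (at (mkv (snd c p) z))"
    by (simp add: mkv_split[symmetric] blk_mult_vec[abs_def])
  then show ?thesis
  proof (rule has_derivative_transform_within_open)
    show "open {y :: complex ^ ('n option). wpart y \<in> snd c ` {p \<in> fst c. f p \<in> fst d} \<and> y $ None \<in> UNIV}"
      by (rule open_parts[OF o open_UNIV])
    show "mkv (snd c p) z \<in> {y. wpart y \<in> snd c ` {p \<in> fst c. f p \<in> fst d} \<and> y $ None \<in> UNIV}" using p by auto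
    fix y :: "complex ^ ('n option)" assume "y \<in> {y. wpart y \<in> snd c ` {p \<in> fst c. f p \<in> fst d} \<and> y $ None \<in> UNIV}"
    then obtain p' where p': "p' \<in> fst c" "f p' \<in> fst d" "wpart y = snd c p'" by auto
    then have y: "y = snd (plane_chart c) (p', y $ None)" using mkv_parts[of y] by simp
    have "local_rep (plane_chart c) (plane_chart d) (shift_map f \<tau>) y = snd (plane_chart d) (shift_map f \<tau> (p', y $ None))"
      by (subst y, rule chart_onD(6)[OF chart_on_plane_chart[OF cc]]) (use p' in simp)
    also have "\<dots> = mkv (local_rep c d f (wpart y)) (y $ None + \<tau>)"
      by (simp add: shift_map_def p'(3) chart_onD(6)[OF cc p'(1)])
    finally show "mkv (local_rep c d f (wpart y)) (y $ None + \<tau>) = local_rep (plane_chart c) (plane_chart d) (shift_map f \<tau>) y" ..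
  qed
qed

lemma holomorphic_vec_on_shift_map:
  assumes "complex_manifold M" "holomorphic_map M M f" "c \<in> atlas M" "d \<in> atlas M"
  shows "holomorphic_vec_on (local_rep (plane_chart c) (plane_chart d) (shift_map f \<tau>))
    (snd (plane_chart c) ` {x \<in> fst (plane_chart c). shift_map f \<tau> x \<in> fst (plane_chart d)})"
  unfolding holomorphic_vec_on_def
proof
  fix y assume "y \<in> snd (plane_chart c) ` {x \<in> fst (plane_chart c). shift_map f \<tau> x \<in> fst (plane_chart d)}"
  then obtain p z where p: "p \<in> fst c" "f p \<in> fst d" "y = mkv (snd c p) z" by (auto simp: shift_map_def)
  show "\<exists>D. (local_rep (plane_chart c) (plane_chart d) (shift_map f \<tau>) has_derivative D) (at y) \<and> Vector_Spaces.linear (*s) (*s) D"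
    unfolding p(3)
    by (intro exI[of _ "(*v) (blk (Dm c d f p) 1)"] conjI local_rep_shift_map[OF assms p(1,2)] matrix_vector_mul_linear_gen)
qed

section \<open>The product as a complex manifold\<close>

lemma second_countable_prod_topology:
  assumes "second_countable X" "second_countable Y"
  shows "second_countable (prod_topology X Y)"
proof -
  obtain A where A: "countable A" "\<forall>V\<in>A. openin X V"
    "\<forall>U x. openin X U \<and> x \<in> U \<longrightarrow> (\<exists>V\<in>A. x \<in> V \<and> V \<subseteq> U)"
    using assms(1) unfolding second_countable_def by (elim exE conjE)
  obtain B where B: "countable B" "\<forall>V\<in>B. openin Y V"
    "\<forall>U x. openin Y U \<and> x \<in> U \<longrightarrow> (\<exists>V\<in>B. x \<in> V \<and> V \<subseteq> U)"
    using assms(2) unfolding second_countable_def by (elim exE conjE)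
  show ?thesis
    unfolding second_countable_def
  proof (intro exI[of _ "(\<lambda>(a, b). a \<times> b) ` (A \<times> B)"] conjI ballI allI impI)
    show "countable ((\<lambda>(a, b). a \<times> b) ` (A \<times> B))" using A(1) B(1) by simp
    show "openin (prod_topology X Y) V" if "V \<in> (\<lambda>(a, b). a \<times> b) ` (A \<times> B)" for V
      using that A(2) B(2) by (auto simp: openin_prod_Times_iff)
    fix U w assume Uw: "openin (prod_topology X Y) U \<and> w \<in> U"
    obtain x y where w: "w = (x, y)" by (cases w)
    have "\<exists>P Q. openin X P \<and> openin Y Q \<and> x \<in> P \<and> y \<in> Q \<and> P \<times> Q \<subseteq> U"
      using iffD1[OF openin_prod_topology_alt conjunct1[OF Uw]] Uw w by simp
    then obtain P Q where PQ: "openin X P" "openin Y Q" "x \<in> P" "y \<in> Q" "P \<times> Q \<subseteq> U"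
      by (elim exE conjE)
    obtain a where a: "a \<in> A" "x \<in> a" "a \<subseteq> P" using A(3) PQ(1,3) by blast
    obtain b where b: "b \<in> B" "y \<in> b" "b \<subseteq> Q" using B(3) PQ(2,4) by blast
    from a b show "\<exists>V\<in>(\<lambda>(a, b). a \<times> b) ` (A \<times> B). w \<in> V \<and> V \<subseteq> U"
      using PQ(5) w by (intro bexI[of _ "a \<times> b"]) auto
  qed
qed

lemma second_countable_euclidean: "second_countable (euclidean :: 'a::second_countable_topology topology)"
proof -
  obtain B :: "'a set set" where B: "countable B" "topological_basis B"
    using ex_countable_basis by blast
  have "\<exists>V\<in>B. x \<in> V \<and> V \<subseteq> U" if "open U" "x \<in> U" for U x
    by (rule topological_basisE[OF B(2) that]) blast
  then show ?thesis
    unfolding second_countable_def using B(1) topological_basis_open[OF B(2)]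
    by (intro exI[of _ B]) simp
qed

lemma complex_manifold_times_plane:
  fixes M :: "('a, 'n::finite) cmanifold"
  assumes M: "complex_manifold M"
  shows "complex_manifold (times_plane M)"
  unfolding complex_manifold_chart_iff times_plane_simps
proof (intro conjI ballI)
  have H: "Hausdorff_space (mtop M)" "second_countable (mtop M)" using M by (auto simp: complex_manifold_def)
  show "Hausdorff_space (prod_topology (mtop M) (euclidean :: complex topology))"
    unfolding Hausdorff_space_prod_topology using H(1) Hausdorff_space_euclidean by blast
  show "second_countable (prod_topology (mtop M) (euclidean :: complex topology))"
    by (intro second_countable_prod_topology H(2) second_countable_euclidean)
  show "(\<Union>c\<in>plane_chart ` atlas M. fst c) = topspace (prod_topology (mtop M) euclidean)"
    using M unfolding complex_manifold_def by (auto simp: set_eq_iff)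
  show "chart_on (prod_topology (mtop M) euclidean) k" if "k \<in> plane_chart ` atlas M" for k
    using that chart_on_plane_chart[OF complex_manifoldD(1)[OF M]] by auto
  fix k l assume "k \<in> plane_chart ` atlas M" "l \<in> plane_chart ` atlas M"
  then obtain c d where cd: "c \<in> atlas M" "d \<in> atlas M" "k = plane_chart c" "l = plane_chart d" by blast
  have "shift_map id 0 = (id :: 'a \<times> complex \<Rightarrow> 'a \<times> complex)" by (auto simp: shift_map_def)
  then show "holomorphic_vec_on (local_rep k l id) (snd k ` (fst k \<inter> fst l))"
    using holomorphic_vec_on_shift_map[OF M holomorphic_map_id[OF M] cd(1,2), of 0] cd(3,4)
    by (simp add: Int_def)
qed

lemma hol_auto_shift_map:
  assumes M: "complex_manifold M" and f: "hol_auto M f"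
  shows "hol_auto (times_plane M) (shift_map f \<tau>)"
proof -
  have hol: "holomorphic_map (times_plane M) (times_plane M) (shift_map f \<tau>)" if f: "holomorphic_map M M f" for f \<tau>
    unfolding holomorphic_map_def times_plane_simps
  proof (intro conjI ballI)
    have "continuous_map (prod_topology (mtop M) euclidean) (mtop M) (f \<circ> fst)"
      using f by (intro continuous_map_compose[OF continuous_map_fst]) (simp add: holomorphic_map_def)
    moreover have "continuous_map (prod_topology (mtop M) euclidean) euclidean ((\<lambda>z. z + \<tau>) \<circ> snd)"
      by (intro continuous_map_compose[OF continuous_map_snd]) (auto intro: continuous_intros)
    ultimately have "continuous_map (prod_topology (mtop M) euclidean) (prod_topology (mtop M) euclidean)
        (\<lambda>x. ((f \<circ> fst) x, ((\<lambda>z. z + \<tau>) \<circ> snd) x))"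
      by (simp only: continuous_map_paired)
    then show "continuous_map (prod_topology (mtop M) euclidean) (prod_topology (mtop M) euclidean) (shift_map f \<tau>)"
      by (simp add: shift_map_def split_def)
    fix k l assume "k \<in> plane_chart ` atlas M" "l \<in> plane_chart ` atlas M"
    then show "holomorphic_vec_on (local_rep k l (shift_map f \<tau>)) (snd k ` {p \<in> fst k. shift_map f \<tau> p \<in> fst l})"
      using holomorphic_vec_on_shift_map[OF M f] by blast
  qed
  obtain g where g: "holomorphic_map M M g" "\<forall>x\<in>topspace (mtop M). g (f x) = x \<and> f (g x) = x"
    using f by (auto simp: hol_auto_def)
  show ?thesis
    unfolding hol_auto_def topspace_times_plane
  proof (intro conjI exI[of _ "shift_map g (- \<tau>)"] hol hol_auto_map[OF f] g(1) ballI)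
    fix x assume "x \<in> topspace (mtop M) \<times> (UNIV :: complex set)"
    then show "shift_map g (- \<tau>) (shift_map f \<tau> x) = x" "shift_map f \<tau> (shift_map g (- \<tau>) x) = x"
      using g(2) by (auto simp: shift_map_def)
  qed
qed

lemma Dm_shift_map:
  assumes M: "complex_manifold M" and f: "holomorphic_map M M f" and "c \<in> atlas M" "d \<in> atlas M" "p \<in> fst c" "f p \<in> fst d"
  shows "Dm (plane_chart c) (plane_chart d) (shift_map f \<tau>) (p, z) = blk (Dm c d f p) 1"
  unfolding Dm_def[of "plane_chart c"] plane_chart_simps(2)
    frechet_derivative_at[OF local_rep_shift_map[OF assms], symmetric]
  by (rule matrix_of_matrix_vector_mul)

section \<open>Integer iterates\<close>

context
  fixes A :: "'a set" and f :: "'a \<Rightarrow> 'a"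
  assumes f: "bij_betw f A A"
begin

lemma inv_into_bij: "x \<in> A \<Longrightarrow> inv_into A f (f x) = x" "x \<in> A \<Longrightarrow> f (inv_into A f x) = x"
  "x \<in> A \<Longrightarrow> f x \<in> A" "x \<in> A \<Longrightarrow> inv_into A f x \<in> A"
  using f bij_betw_inv_into_left[OF f] bij_betw_inv_into_right[OF f] bij_betw_inv_into[OF f]
  by (auto simp: bij_betw_def)

lemma int_iterate_mem: "x \<in> A \<Longrightarrow> int_iterate A f a x \<in> A"
proof -
  assume x: "x \<in> A"
  have "(f ^^ n) x \<in> A" "(inv_into A f ^^ n) x \<in> A" for n
    using x by (induction n) (auto simp: inv_into_bij)
  then show ?thesis by (simp add: int_iterate_def)
qed

lemma int_iterate_step: "x \<in> A \<Longrightarrow> int_iterate A f (a + 1) x = f (int_iterate A f a x)"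
proof (cases "0 \<le> a")
  case True
  then have "nat (a + 1) = Suc (nat a)" by simp
  then show ?thesis using True by (simp add: int_iterate_def)
next
  case False
  assume x: "x \<in> A"
  obtain m where m: "nat (- a) = Suc m" using False by (metis gr0_implies_Suc zero_less_nat_eq neg_0_less_iff_less not_le)
  have "(inv_into A f ^^ n) x \<in> A" for n
    using x by (induction n) (auto simp: inv_into_bij)
  then have "f (int_iterate A f a x) = (inv_into A f ^^ m) x" using False m by (simp add: int_iterate_def inv_into_bij)
  moreover have "int_iterate A f (a + 1) x = (inv_into A f ^^ m) x"
  proof (cases "a = -1")
    case True
    then show ?thesis using m by (simp add: int_iterate_def)
  next
    case False
    then have "\<not> 0 \<le> a + 1" "nat (- (a + 1)) = m" using \<open>\<not> 0 \<le> a\<close> m by auto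
    then show ?thesis by (simp add: int_iterate_def)
  qed
  ultimately show ?thesis by simp
qed

lemma int_iterate_0: "int_iterate A f 0 x = x"
  by (simp add: int_iterate_def)

text \<open>A two-sided orbit of \<open>f\<close> is determined by its value at 0; downward steps
  use injectivity. Additivity in the exponent and commutation with other maps follow by exhibiting
  suitable orbits.\<close>

lemma int_iterate_unique:
  assumes "\<And>a. F a \<in> A" "\<And>a. F (a + 1) = f (F a)"
  shows "F a = int_iterate A f a (F 0)"
proof (induction a rule: int_induct[where k = 0])
  case base
  then show ?case by (simp add: int_iterate_0)
next
  case (step1 i)
  then show ?case using assms by (simp add: int_iterate_step)
next
  case (step2 i)
  have "f (F (i - 1)) = f (int_iterate A f (i - 1) (F 0))"
    using assms(2)[of "i - 1"] int_iterate_step[OF assms(1)[of 0], of "i - 1"] step2 by simp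
  then show ?case using inv_into_bij(1) assms(1) int_iterate_mem by metis
qed

lemma int_iterate_add: "x \<in> A \<Longrightarrow> int_iterate A f (a + b) x = int_iterate A f a (int_iterate A f b x)"
  using int_iterate_unique[of "\<lambda>a. int_iterate A f (a + b) x" a]
  by (simp add: int_iterate_mem add.assoc add.commute[of 1] int_iterate_step flip: add.assoc)
    (metis add.commute add.left_commute int_iterate_mem int_iterate_step)

lemma int_iterate_commute:
  assumes g: "\<And>x. x \<in> A \<Longrightarrow> g x \<in> A" "\<And>x. x \<in> A \<Longrightarrow> f (g x) = g (f x)" and x: "x \<in> A"
  shows "int_iterate A f a (g x) = g (int_iterate A f a x)"
  using int_iterate_unique[of "\<lambda>a. g (int_iterate A f a x)" a] g x
  by (simp add: int_iterate_mem int_iterate_step int_iterate_0)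

end

section \<open>The balanced metric on the suspension\<close>

lemma holomorphic_automorphism_hol_auto:
  assumes "holomorphic_automorphism M f"
  shows "bij_betw f (topspace (mtop M)) (topspace (mtop M))" "hol_auto M f"
    "hol_auto M (inv_into (topspace (mtop M)) f)"
proof -
  show b: "bij_betw f (topspace (mtop M)) (topspace (mtop M))"
    using assms by (simp add: holomorphic_automorphism_def)
  have h: "holomorphic_map M M f" "holomorphic_map M M (inv_into (topspace (mtop M)) f)"
    using assms by (auto simp: holomorphic_automorphism_def)
  show "hol_auto M f"
    unfolding hol_auto_def using h inv_into_bij(1,2)[OF b] by blast
  show "hol_auto M (inv_into (topspace (mtop M)) f)"
    unfolding hol_auto_def using h inv_into_bij(1,2)[OF b] by blast
qed

lemma pullback_eqD:
  assumes "pullback_eq M N f \<beta> \<alpha>" and f: "holomorphic_map M N f"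
    and cdp: "c \<in> atlas M" "d \<in> atlas N" "p \<in> fst c" "f p \<in> fst d"
  shows "\<beta> d (snd d (f p)) (\<lambda>i. Dm c d f p *v v i) = \<alpha> c (snd c p) v"
  using assms(1)[unfolded pullback_eq_def, rule_format, OF cdp, of v] unfolding Dm_works(1)[OF f cdp] .

lemma pullback_eq_compose:
  assumes M: "complex_manifold M" and f: "hol_auto M f" "pullback_eq M M f V V"
    and g: "hol_auto M g" "pullback_eq M M g V V"
  shows "pullback_eq M M (g \<circ> f) V V"
  unfolding pullback_eq_def
proof (intro ballI impI allI)
  fix c e p v assume c: "c \<in> atlas M" and e: "e \<in> atlas M" and p: "p \<in> fst c" "(g \<circ> f) p \<in> fst e"
  obtain d where d: "d \<in> atlas M" "f p \<in> fst d"
    using complex_manifoldD(2)[OF M hol_auto_topspace[OF f(1) complex_manifoldD(3)[OF M c p(1)]]] by blast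
  have gp: "g (f p) \<in> fst e" using p(2) by simp
  note hf = hol_auto_map[OF f(1)] and hg = hol_auto_map[OF g(1)]
  have "V e (snd e ((g \<circ> f) p)) (\<lambda>i. frechet_derivative (local_rep c e (g \<circ> f)) (at (snd c p)) (v i)) =
      V e (snd e (g (f p))) (\<lambda>i. Dm d e g (f p) *v (Dm c d f p *v v i))"
    unfolding Dm_works(1)[OF holomorphic_map_compose[OF M M hf hg] c e p]
      Dm_compose[OF M M hf hg c d(1) e p(1) d(2) gp]
    by (simp add: matrix_vector_mul_assoc)
  also have "\<dots> = V d (snd d (f p)) (\<lambda>i. Dm c d f p *v v i)"
    by (rule pullback_eqD[OF g(2) hg d(1) e d(2) gp])
  also have "\<dots> = V c (snd c p) v"
    by (rule pullback_eqD[OF f(2) hf c d(1) p(1) d(2)])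
  finally show "V e (snd e ((g \<circ> f) p)) (\<lambda>i. frechet_derivative (local_rep c e (g \<circ> f)) (at (snd c p)) (v i)) =
      V c (snd c p) v" .
qed

text \<open>V at k p is compared with V at p through \<open>f\<close>, which leads back from k p to
  p; the two Jacobians cancel.\<close>

lemma pullback_eq_inverse:
  assumes M: "complex_manifold M" and f: "hol_auto M f" "pullback_eq M M f V V"
    and k: "hol_auto M k" and fk: "\<And>x. x \<in> topspace (mtop M) \<Longrightarrow> f (k x) = x"
  shows "pullback_eq M M k V V"
  unfolding pullback_eq_def
proof (intro ballI impI allI)
  fix c d p v assume c: "c \<in> atlas M" and d: "d \<in> atlas M" and p: "p \<in> fst c" "k p \<in> fst d"
  note hf = hol_auto_map[OF f(1)] and hk = hol_auto_map[OF k]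
  have fkp: "f (k p) = p" by (rule fk[OF complex_manifoldD(3)[OF M c p(1)]])
  then have fkc: "f (k p) \<in> fst c" using p by simp
  have "V d (snd d (k p)) (\<lambda>i. Dm c d k p *v v i) =
      V c (snd c (f (k p))) (\<lambda>i. Dm d c f (k p) *v (Dm c d k p *v v i))"
    by (rule pullback_eqD[OF f(2) hf d c p(2) fkc, symmetric])
  also have "\<dots> = V c (snd c p) v"
    using Dm_inverse[OF M M hk hf fk c d p] by (simp add: matrix_vector_mul_assoc fkp)
  finally show "V d (snd d (k p)) (\<lambda>i. frechet_derivative (local_rep c d k) (at (snd c p)) (v i)) = V c (snd c p) v"
    unfolding Dm_works(1)[OF hk c d p] .
qed

text \<open>\<open>s\<close> and \<open>t\<close> are real coordinates of the plane in the lattice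
  basis. A lattice translation adds integers to them, so all questions of local finiteness become
  questions about integers.\<close>

locale suspension =
  fixes M :: "('a, 'n::finite) cmanifold" and f1 f2 :: "'a \<Rightarrow> 'a" and V :: "('a, 'n) form_field"
    and \<xi>1 \<xi>2 :: complex and H :: "('a, 'n) matrix_field" and s t :: "complex \<Rightarrow> real"
  assumes M: "complex_manifold M"
    and f1: "holomorphic_automorphism M f1" and f2: "holomorphic_automorphism M f2"
    and commute: "\<And>p. p \<in> topspace (mtop M) \<Longrightarrow> f1 (f2 p) = f2 (f1 p)"
    and V: "volume_form M V" and V1: "pullback_eq M M f1 V V" and V2: "pullback_eq M M f2 V V"
    and H: "balanced_field M H"
    and s: "linear s" "s \<xi>1 = 1" "s \<xi>2 = 0" and t: "linear t" "t \<xi>1 = 0" "t \<xi>2 = 1"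
begin

abbreviation "X \<equiv> topspace (mtop M)"

definition G :: "int \<times> int \<Rightarrow> 'a \<Rightarrow> 'a" where
  "G g = int_iterate X f1 (fst g) \<circ> int_iterate X f2 (snd g)"

definition \<tau> :: "int \<times> int \<Rightarrow> complex" where
  "\<tau> g = of_int (fst g) * \<xi>1 + of_int (snd g) * \<xi>2"

definition act :: "int \<times> int \<Rightarrow> 'a \<times> complex \<Rightarrow> 'a \<times> complex" where
  "act g = shift_map (G g) (\<tau> g)"

definition q :: "'a \<times> complex \<Rightarrow> ('a \<times> complex) set" where
  "q x = range (\<lambda>g. act g x)"

lemma suspension_action_eq: "suspension_action X f1 f2 \<xi>1 \<xi>2 g x = act g x"
  by (cases g; cases x) (simp add: suspension_action_def act_def shift_map_def G_def \<tau>_def add.assoc)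

lemma toric_suspension_eq: "toric_suspension M f1 f2 \<xi>1 \<xi>2 = quotient_manifold (times_plane M) q"
  unfolding toric_suspension_def suspension_action_eq q_def ..

lemmas auto1 = holomorphic_automorphism_hol_auto[OF f1]
lemmas auto2 = holomorphic_automorphism_hol_auto[OF f2]

lemma good_iterate:
  assumes "hol_auto M f" "pullback_eq M M f V V" "hol_auto M (inv_into X f)" "bij_betw f X X"
  shows "hol_auto M (int_iterate X f a) \<and> pullback_eq M M (int_iterate X f a) V V"
proof -
  have id: "hol_auto M id \<and> pullback_eq M M id V V"
    using hol_auto_id[OF M] V by (simp add: volume_form_def differential_form_def)
  have pow: "hol_auto M (h ^^ n) \<and> pullback_eq M M (h ^^ n) V V"
    if "hol_auto M h" "pullback_eq M M h V V" for h n
  proof (induction n)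
    case 0
    then show ?case using id by (simp add: id_def)
  next
    case (Suc n)
    then show ?case
      using hol_auto_compose[OF M _ that(1), of "h ^^ n"] pullback_eq_compose[OF M _ _ that, of "h ^^ n"]
      unfolding funpow.simps(2) by blast
  qed
  have "pullback_eq M M (inv_into X f) V V"
    by (rule pullback_eq_inverse[OF M assms(1-3)]) (rule inv_into_bij(2)[OF assms(4)])
  then show ?thesis
    using pow[OF assms(1,2)] pow[OF assms(3)] by (simp add: int_iterate_def)
qed

lemma G_good: "hol_auto M (G g)" "pullback_eq M M (G g) V V"
  unfolding G_def
  using good_iterate[OF auto1(2) V1 auto1(3,1)] good_iterate[OF auto2(2) V2 auto2(3,1)]
  by (blast intro: hol_auto_compose[OF M] pullback_eq_compose[OF M])+

lemma G_topspace: "p \<in> X \<Longrightarrow> G g p \<in> X"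
  by (rule hol_auto_topspace[OF G_good(1)])

lemma G_0: "p \<in> X \<Longrightarrow> G 0 p = p"
  by (simp add: G_def int_iterate_def)

lemma G_add: "p \<in> X \<Longrightarrow> G (g + h) p = G g (G h p)"
proof -
  assume p: "p \<in> X"
  note m1 = int_iterate_mem[OF auto1(1)] and m2 = int_iterate_mem[OF auto2(1)]
  \<comment> \<open>Commutation of arbitrary iterates: \<open>int_iterate_commute\<close> is used
    for the powers of \<open>f2\<close>, then for those of \<open>f1\<close>.\<close>
  have c: "int_iterate X f1 a (int_iterate X f2 b x) = int_iterate X f2 b (int_iterate X f1 a x)" if "x \<in> X" for a b x
  proof (rule int_iterate_commute[OF auto1(1) m2 _ that])
    fix x assume x: "x \<in> X"
    show "f1 (int_iterate X f2 b x) = int_iterate X f2 b (f1 x)"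
      by (rule int_iterate_commute[where f = f2 and g = f1, symmetric])
        (use auto2(1) bij_betwE[OF auto1(1)] commute x in auto)
  qed
  show ?thesis
    using p by (simp add: G_def int_iterate_add[OF auto1(1)] int_iterate_add[OF auto2(1)] m1 m2 c)
qed

lemma \<tau>_add: "\<tau> (g + h) = \<tau> g + \<tau> h"
  by (simp add: \<tau>_def algebra_simps)

lemma s_\<tau>: "s (z + \<tau> g) = s z + of_int (fst g)" and t_\<tau>: "t (z + \<tau> g) = t z + of_int (snd g)"
proof -
  have "\<tau> g = of_int (fst g) *\<^sub>R \<xi>1 + of_int (snd g) *\<^sub>R \<xi>2" by (simp add: \<tau>_def scaleR_conv_of_real)
  then show "s (z + \<tau> g) = s z + of_int (fst g)" "t (z + \<tau> g) = t z + of_int (snd g)"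
    by (simp_all add: linear_add[OF s(1)] linear_scale[OF s(1)] s linear_add[OF t(1)] linear_scale[OF t(1)] t)
qed

lemma act_add: "x \<in> topspace (mtop (times_plane M)) \<Longrightarrow> act (g + h) x = act g (act h x)"
  by (auto simp: topspace_times_plane act_def shift_map_def G_add \<tau>_add)

lemma act_0: "x \<in> topspace (mtop (times_plane M)) \<Longrightarrow> act 0 x = x"
  by (auto simp: topspace_times_plane act_def shift_map_def G_0 \<tau>_def)

lemma act_auto: "hol_auto (times_plane M) (act g)"
  unfolding act_def by (rule hol_auto_shift_map[OF M G_good(1)])

section \<open>Freeness and proper discontinuity of the action\<close>

lemma finite_near: "finite {g :: int \<times> int. \<bar>a + of_int (fst g)\<bar> < r \<and> \<bar>b + of_int (snd g)\<bar> < (r :: real)}"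
proof (rule finite_subset)
  show "{g :: int \<times> int. \<bar>a + of_int (fst g)\<bar> < r \<and> \<bar>b + of_int (snd g)\<bar> < r}
      \<subseteq> {\<lfloor>- a - r\<rfloor>..\<lceil>r - a\<rceil>} \<times> {\<lfloor>- b - r\<rfloor>..\<lceil>r - b\<rceil>}"
    by (auto simp: abs_less_iff) linarith+
qed simp

text \<open>Only finitely many group elements can carry a bounded region of the plane into another
  one, and each of these with \<open>act g x\<close> different from \<open>y\<close> is handled by
  the Hausdorff property. For y = x, together with freeness, this also gives proper
  discontinuity.\<close>

lemma separation:
  assumes x: "x \<in> topspace (mtop (times_plane M))" and y: "y \<in> topspace (mtop (times_plane M))"
  shows "\<exists>U W. openin (mtop (times_plane M)) U \<and> openin (mtop (times_plane M)) W \<and> x \<in> U \<and> y \<in> W \<and>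
    (\<forall>g. \<forall>u\<in>U. act g u \<in> W \<longrightarrow> act g x = y)"
proof -
  let ?N = "mtop (times_plane M)"
  define B where "B w = {u \<in> topspace ?N. \<bar>s (snd u) - s w\<bar> < 1 \<and> \<bar>t (snd u) - t w\<bar> < 1}" for w
  have openB: "openin ?N (B w)" for w
  proof -
    have "continuous_on UNIV s" "continuous_on UNIV t"
      using s(1) t(1) by (simp_all add: linear_continuous_on linear_conv_bounded_linear[symmetric])
    then have "open {z. \<bar>s z - s w\<bar> < 1 \<and> \<bar>t z - t w\<bar> < 1}"
      by (intro open_Collect_conj open_Collect_less continuous_intros)
    then have "openin ?N (X \<times> {z. \<bar>s z - s w\<bar> < 1 \<and> \<bar>t z - t w\<bar> < 1})"
      unfolding times_plane_simps by (simp add: openin_prod_Times_iff)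
    moreover have "X \<times> {z. \<bar>s z - s w\<bar> < 1 \<and> \<bar>t z - t w\<bar> < 1} = B w"
      by (auto simp: B_def topspace_times_plane)
    ultimately show ?thesis by simp
  qed
  have xB: "x \<in> B (snd x)" "y \<in> B (snd y)" using x y by (auto simp: B_def)
  \<comment> \<open>If some point within 1 of \<open>snd x\<close> is moved to within 1 of
    \<open>snd y\<close>, then the coordinates of \<open>snd x\<close> are moved to within 2 of
    those of \<open>snd y\<close>.\<close>
  define F where "F = {g. \<bar>(s (snd x) - s (snd y)) + of_int (fst g)\<bar> < 2 \<and> \<bar>(t (snd x) - t (snd y)) + of_int (snd g)\<bar> < 2}"
  have finF: "finite F" unfolding F_def by (rule finite_near)
  have inF: "g \<in> F" if "u \<in> B (snd x)" "act g u \<in> B (snd y)" for g u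
  proof -
    have "snd (act g u) = snd u + \<tau> g" by (simp add: act_def shift_map_def split_def)
    then have "\<bar>s (snd u) + of_int (fst g) - s (snd y)\<bar> < 1" "\<bar>t (snd u) + of_int (snd g) - t (snd y)\<bar> < 1"
      using that(2) by (auto simp: B_def s_\<tau> t_\<tau>)
    moreover have "\<bar>s (snd u) - s (snd x)\<bar> < 1" "\<bar>t (snd u) - t (snd x)\<bar> < 1"
      using that(1) by (auto simp: B_def)
    ultimately show ?thesis unfolding F_def mem_Collect_eq by linarith
  qed
  have "\<exists>P Q. openin ?N P \<and> openin ?N Q \<and> x \<in> P \<and> y \<in> Q \<and> (\<forall>u\<in>P. act g u \<in> Q \<longrightarrow> act g x = y)" for g
  proof (cases "act g x = y")
    case True
    then show ?thesis using x y by (intro exI[of _ "topspace ?N"]) auto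
  next
    case False
    have "Hausdorff_space ?N" using complex_manifold_times_plane[OF M] by (simp add: complex_manifold_def)
    then obtain P Q where PQ: "openin ?N P" "openin ?N Q" "act g x \<in> P" "y \<in> Q" "disjnt P Q"
      unfolding Hausdorff_space_def using False y hol_auto_topspace[OF act_auto x, of g] by meson
    have "openin ?N {u \<in> topspace ?N. act g u \<in> P}"
      using hol_auto_map[OF act_auto[of g]] PQ(1) unfolding holomorphic_map_def continuous_map_def by blast
    then show ?thesis
      using PQ x by - (rule exI[of _ "{u \<in> topspace ?N. act g u \<in> P}"], rule exI[of _ Q], auto simp: disjnt_iff simp del: split_paired_All)
  qed
  then obtain P Q where PQ: "\<And>g. openin ?N (P g) \<and> openin ?N (Q g) \<and> x \<in> P g \<and> y \<in> Q g \<and>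
      (\<forall>u\<in>P g. act g u \<in> Q g \<longrightarrow> act g x = y)" by metis
  have "openin ?N (B (snd x) \<inter> ((\<Inter>g\<in>F. P g) \<inter> topspace ?N))" "openin ?N (B (snd y) \<inter> ((\<Inter>g\<in>F. Q g) \<inter> topspace ?N))"
    by (intro openin_Int openB openin_INT finF; simp add: PQ)+
  moreover have "x \<in> B (snd x) \<inter> ((\<Inter>g\<in>F. P g) \<inter> topspace ?N)" "y \<in> B (snd y) \<inter> ((\<Inter>g\<in>F. Q g) \<inter> topspace ?N)"
    using xB x y PQ by simp_all
  moreover have "\<forall>g. \<forall>u\<in>B (snd x) \<inter> ((\<Inter>g\<in>F. P g) \<inter> topspace ?N).
      act g u \<in> B (snd y) \<inter> ((\<Inter>g\<in>F. Q g) \<inter> topspace ?N) \<longrightarrow> act g x = y"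
  proof (intro allI ballI impI)
    fix g u assume u: "u \<in> B (snd x) \<inter> ((\<Inter>g\<in>F. P g) \<inter> topspace ?N)"
      "act g u \<in> B (snd y) \<inter> ((\<Inter>g\<in>F. Q g) \<inter> topspace ?N)"
    then have "g \<in> F" using inF by blast
    then have "u \<in> P g" "act g u \<in> Q g" using u by blast+
    then show "act g x = y" using PQ[of g] by blast
  qed
  ultimately show ?thesis
    by - (rule exI[of _ "B (snd x) \<inter> ((\<Inter>g\<in>F. P g) \<inter> topspace ?N)"],
        rule exI[of _ "B (snd y) \<inter> ((\<Inter>g\<in>F. Q g) \<inter> topspace ?N)"], intro conjI)
qed

lemma act_fixed: "x \<in> topspace (mtop (times_plane M)) \<Longrightarrow> act g x = x \<Longrightarrow> g = 0"
proof -
  assume "act g x = x"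
  then have "snd x + \<tau> g = snd x" by (auto simp: act_def shift_map_def split: prod.splits)
  then have "s (snd x) + of_int (fst g) = s (snd x)" "t (snd x) + of_int (snd g) = t (snd x)"
    using s_\<tau>[of "snd x" g] t_\<tau>[of "snd x" g] by simp_all
  then show ?thesis by (simp add: prod_eq_iff)
qed

lemma q_act: "x \<in> topspace (mtop (times_plane M)) \<Longrightarrow> q (act g x) = q x"
proof -
  assume x: "x \<in> topspace (mtop (times_plane M))"
  have "q (act g x) = range ((\<lambda>h. act h x) \<circ> (\<lambda>h. h + g))"
    by (simp add: q_def act_add[OF x])
  also have "\<dots> = q x"
    unfolding q_def image_comp[symmetric] by (simp add: surj_plus_right)
  finally show ?thesis .
qed

lemma quotient_action: "quotient_action (times_plane M) act q"
proof
  show "complex_manifold (times_plane M)" by (rule complex_manifold_times_plane[OF M])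
  show "hol_auto (times_plane M) (act g)" for g by (rule act_auto)
  show "q x = range (\<lambda>g. act g x)" for x by (rule q_def)
  show "q (act g x) = q x" if "x \<in> topspace (mtop (times_plane M))" for g x by (rule q_act[OF that])
  show "x \<in> q x" if "x \<in> topspace (mtop (times_plane M))" for x
    unfolding q_def using act_0[OF that] by (metis rangeI)
  show "\<exists>U V. openin (mtop (times_plane M)) U \<and> openin (mtop (times_plane M)) V \<and> x \<in> U \<and> y \<in> V \<and> (\<forall>g. \<forall>u\<in>U. act g u \<notin> V)"
    if xy: "x \<in> topspace (mtop (times_plane M))" "y \<in> topspace (mtop (times_plane M))" "q x \<noteq> q y" for x y
  proof -
    have "act g x \<noteq> y" for g using q_act[OF xy(1), of g] xy(3) by auto
    then show ?thesis using separation[OF xy(1,2)] by simp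
  qed
  show "\<exists>U. openin (mtop (times_plane M)) U \<and> x \<in> U \<and> (\<forall>g. \<forall>u\<in>U. act g u \<in> U \<longrightarrow> act g u = u)"
    if x: "x \<in> topspace (mtop (times_plane M))" for x
  proof -
    from separation[OF x x] obtain U W where UW: "openin (mtop (times_plane M)) U" "openin (mtop (times_plane M)) W"
      "x \<in> U" "x \<in> W" "\<forall>g. \<forall>u\<in>U. act g u \<in> W \<longrightarrow> act g x = x" by (elim exE conjE)
    have "act g u = u" if "u \<in> U \<inter> W" "act g u \<in> U \<inter> W" for g u
    proof -
      have "g = 0" by (rule act_fixed[OF x], rule UW(5)[rule_format, of u g]) (use that in auto)
      then show ?thesis using act_0[of u] that openin_subset[OF UW(1)] by auto
    qed
    then show ?thesis using UW(1-4) by (intro exI[of _ "U \<inter> W"]) (auto intro: openin_Int)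
  qed
qed

section \<open>The equivariant divergence free matrix field\<close>

definition dual :: "int \<times> int \<Rightarrow> ('a, 'n) matrix_field" where
  "dual g c x = ldual (pullback_field M (G g) H c x)"

text \<open>The absolute value removes the unknown orientation of \<open>V\<close>. Jacobian
  determinants of holomorphic maps are positive, so the transformation law survives.\<close>

definition vdens :: "('a, 'n) chart \<Rightarrow> complex ^ 'n \<Rightarrow> real" where
  "vdens c x = \<bar>V c x ref_list\<bar>"

definition cutoff :: "complex \<Rightarrow> real" where
  "cutoff z = bump (s z) * bump (t z)"

text \<open>The group elements with nonzero weight at \<open>z\<close>. This set is finite and
  nonempty, so the sum over the group is finite at every point and is strictly positive.\<close>

definition active :: "complex \<Rightarrow> (int \<times> int) set" where
  "active z = {g. \<bar>s z + of_int (fst g)\<bar> < 1 \<and> \<bar>t z + of_int (snd g)\<bar> < 1}"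

definition total_dual :: "('a, 'n) chart \<Rightarrow> complex ^ ('n option) \<Rightarrow> complex ^ ('n option) ^ ('n option)" where
  "total_dual c y = (\<Sum>g\<in>active (y $ None). cutoff (y $ None + \<tau> g) *\<^sub>R blk (dual g c (wpart y)) 0)
     + blk 0 (vdens c (wpart y))"

lemma balanced_pullback_G: "balanced_field M (pullback_field M (G g) H)"
  by (rule balanced_pullback_field[OF M H G_good(1)])

lemma hermitian_H: "hermitian_field M H"
  using H by (simp add: balanced_field_def)

lemma hpd_pullback_G: "c \<in> atlas M \<Longrightarrow> x \<in> snd c ` fst c \<Longrightarrow> hpd (pullback_field M (G g) H c x)"
  using balanced_pullback_G hermitian_fieldD(1) unfolding balanced_field_def by blast

lemma finite_active: "finite (active z)"
  unfolding active_def by (rule finite_near)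

lemma cutoff_active: "0 < cutoff (z + \<tau> g) \<longleftrightarrow> g \<in> active z" "g \<notin> active z \<Longrightarrow> cutoff (z + \<tau> g) = 0"
proof -
  have "0 < cutoff w \<longleftrightarrow> 0 < bump (s w) \<and> 0 < bump (t w)" for w
    unfolding cutoff_def using bump_nonneg[of "s w"] bump_nonneg[of "t w"] by (auto simp: zero_less_mult_iff)
  then show "0 < cutoff (z + \<tau> g) \<longleftrightarrow> g \<in> active z" by (simp add: active_def bump_pos_iff s_\<tau> t_\<tau>)
  show "g \<notin> active z \<Longrightarrow> cutoff (z + \<tau> g) = 0"
    by (auto simp: cutoff_def active_def s_\<tau> t_\<tau> bump_eq_0_iff)
qed

lemma active_nonempty: "active z \<noteq> {}"
proof -
  have "(- \<lfloor>s z\<rfloor>, - \<lfloor>t z\<rfloor>) \<in> active z"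
    unfolding active_def by (simp add: abs_less_iff) linarith
  then show ?thesis by blast
qed

lemma vdens_pos:
  assumes c: "c \<in> atlas M" and x: "x \<in> snd c ` fst c"
  shows "0 < vdens c x"
proof -
  have "alternating_form DIM(complex ^ 'n) (V c x)"
    using V c x unfolding volume_form_def differential_form_def dim_complex_vec by blast
  moreover obtain v where "V c x v \<noteq> 0" using V c x unfolding volume_form_def by blast
  ultimately have "V c x ref_list \<noteq> 0" using top_form_eq_vol[of "V c x" v] by auto
  then show ?thesis by (simp add: vdens_def)
qed

lemma vdens_law:
  assumes c: "c \<in> atlas M" and d: "d \<in> atlas M" and p: "p \<in> fst c" "G g p \<in> fst d"
  shows "vdens c (snd c p) = form_det ((*v) (Dm c d (G g) p)) * vdens d (snd d (G g p))"
proof -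
  have "alternating_form DIM(complex ^ 'n) (V d (snd d (G g p)))"
    using V d p unfolding volume_form_def differential_form_def dim_complex_vec by blast
  from form_det[OF linear_matrix_vector this]
  have "V d (snd d (G g p)) (\<lambda>i. Dm c d (G g) p *v ref_list i) =
      form_det ((*v) (Dm c d (G g) p)) * V d (snd d (G g p)) ref_list" .
  moreover have "V d (snd d (G g p)) (\<lambda>i. Dm c d (G g) p *v ref_list i) = V c (snd c p) ref_list"
    by (rule pullback_eqD[OF G_good(2) hol_auto_map[OF G_good(1)] c d p])
  moreover have "0 < form_det ((*v) (Dm c d (G g) p))"
    by (rule form_det_pos[OF hol_auto_invertible[OF M G_good(1) c d p]])
  ultimately show ?thesis by (simp add: vdens_def abs_mult)
qed

text \<open>Pulling back by \<open>G (g + h)\<close> is pulling back by \<open>G g\<close> and then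
  by \<open>G h\<close>, so \<open>ldual_pullback\<close> applies with the Jacobian of
  \<open>G h\<close>.\<close>

lemma dual_law:
  assumes c: "c \<in> atlas M" and d: "d \<in> atlas M" and p: "p \<in> fst c" "G h p \<in> fst d"
  shows "Dm c d (G h) p ** dual (g + h) c (snd c p) ** adj (Dm c d (G h) p) =
    form_det ((*v) (Dm c d (G h) p)) *\<^sub>R dual g d (snd d (G h p))"
proof -
  note pX = complex_manifoldD(3)[OF M c p(1)]
  obtain e where e: "e \<in> atlas M" "G (g + h) p \<in> fst e" using complex_manifoldD(2)[OF M G_topspace[OF pX]] by blast
  have co: "hol_auto M (G g \<circ> G h)" by (rule hol_auto_compose[OF M G_good(1) G_good(1)])
  have gh: "(G g \<circ> G h) p = G (g + h) p" using G_add[OF pX] by simp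
  have "Dm c e (G (g + h)) p = Dm c e (G g \<circ> G h) p"
    by (rule Dm_cong[OF M c openin_topspace pX p(1)]) (simp add: G_add)
  then have "pullback_field M (G (g + h)) H c (snd c p) = pullback_field M (G g \<circ> G h) H c (snd c p)"
    using pullback_field_eq[OF M hermitian_H G_good(1) c e(1) p(1) e(2)]
      pullback_field_eq[OF M hermitian_H co c e(1) p(1)] e(2) gh by simp
  also have "\<dots> = adj (Dm c d (G h) p) ** pullback_field M (G g) H d (snd d (G h p)) ** Dm c d (G h) p"
    by (rule pullback_field_compose[OF M hermitian_H G_good(1) G_good(1) c d p])
  finally show ?thesis
    unfolding dual_def
    by (simp only:) (rule ldual_pullback[OF hpd_invertible[OF hpd_pullback_G[OF d]] hol_auto_invertible[OF M G_good(1) c d p]],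
        use p in blast)
qed

lemma blk_pullback: "blk D 1 ** blk A r ** adj (blk D 1) = blk (D ** A ** adj D) r"
  by (simp add: adj_blk blk_mult)

lemma matrix_sandwich_linear: "linear (\<lambda>A :: complex ^ 'k::finite ^ 'k. D ** A ** E)"
  by (rule linearI) (simp_all add: vec_eq_iff matrix_matrix_mult_def sum.distrib algebra_simps flip: scaleR_sum_right)

text \<open>The weight of g at z equals the weight of g - h at z + \<tau> h, so moving by h merely
  reindexes the sum. Both blocks acquire the same factor, because extending \<open>D\<close> by 1
  does not change its determinant.\<close>

lemma total_dual_law:
  assumes c: "c \<in> atlas M" and d: "d \<in> atlas M" and p: "p \<in> fst c" "G h p \<in> fst d"
  shows "blk (Dm c d (G h) p) 1 ** total_dual c (mkv (snd c p) z) ** adj (blk (Dm c d (G h) p) 1) =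
    form_det ((*v) (blk (Dm c d (G h) p) 1)) *\<^sub>R total_dual d (mkv (snd d (G h p)) (z + \<tau> h))"
proof -
  define D where "D = Dm c d (G h) p"
  define J where "J = form_det ((*v) D)"
  note lin = matrix_sandwich_linear[of "blk D 1" "adj (blk D 1)"]
  have "blk D 1 ** total_dual c (mkv (snd c p) z) ** adj (blk D 1) =
     (\<Sum>g\<in>active z. cutoff (z + \<tau> g) *\<^sub>R blk (D ** dual g c (snd c p) ** adj D) 0) + blk 0 (vdens c (snd c p))"
    unfolding total_dual_def mkv_nth wpart_mkv
    by (simp add: linear_add[OF lin] linear_sum[OF lin] linear_scale[OF lin] blk_pullback)
  also have "(\<Sum>g\<in>active z. cutoff (z + \<tau> g) *\<^sub>R blk (D ** dual g c (snd c p) ** adj D) 0) =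
     (\<Sum>g\<in>active (z + \<tau> h). cutoff (z + \<tau> h + \<tau> g) *\<^sub>R blk (J *\<^sub>R dual g d (snd d (G h p))) 0)"
  \<comment> \<open>Membership in \<open>active\<close> only involves z + \<tau> g, which the shift
    of indices preserves.\<close>
  proof (rule sum.reindex_bij_witness[where i = "\<lambda>g. g + h" and j = "\<lambda>g. g - h"])
    fix g assume "g \<in> active z"
    have g: "g = (g - h) + h" by simp
    have "D ** dual g c (snd c p) ** adj D = J *\<^sub>R dual (g - h) d (snd d (G h p))"
      using dual_law[OF c d p, of "g - h"] by (simp add: D_def J_def)
    moreover have "z + \<tau> h + \<tau> (g - h) = z + \<tau> g" using \<tau>_add[of "g - h" h] by simp
    ultimately show "cutoff (z + \<tau> h + \<tau> (g - h)) *\<^sub>R blk (J *\<^sub>R dual (g - h) d (snd d (G h p))) 0 =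
        cutoff (z + \<tau> g) *\<^sub>R blk (D ** dual g c (snd c p) ** adj D) 0" by (simp only:)
  qed (auto simp: active_def s_\<tau> t_\<tau>)
  also have "blk 0 (vdens c (snd c p)) = J *\<^sub>R blk 0 (vdens d (snd d (G h p)))"
    using vdens_law[OF c d p] by (simp add: blk_scaleR J_def D_def)
  finally show ?thesis
    unfolding D_def[symmetric] form_det_blk J_def[symmetric] total_dual_def mkv_nth wpart_mkv
    by (simp add: scaleR_sum_right blk_scaleR scaleR_add_right mult.commute)
qed

lemma hpd_total_dual:
  assumes c: "c \<in> atlas M" and y: "wpart y \<in> snd c ` fst c"
  shows "hpd (total_dual c y)"
proof -
  have hpd_sum: "hpd (\<Sum>g\<in>I. A g)" if "finite I" "I \<noteq> {}" "\<And>g. g \<in> I \<Longrightarrow> hpd (A g)" for I and A :: "int \<times> int \<Rightarrow> complex ^ 'n ^ 'n"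
    using that by (induction I rule: finite_ne_induct) (auto intro: hpd_add)
  define L where "L = (\<Sum>g\<in>active (y $ None). cutoff (y $ None + \<tau> g) *\<^sub>R dual g c (wpart y))"
  have "hpd L"
    unfolding L_def
    by (rule hpd_sum[OF finite_active active_nonempty])
      (auto simp: dual_def cutoff_active intro!: hpd_scaleR hpd_ldual hpd_pullback_G c y)
  moreover have "total_dual c y = blk L 0 + blk 0 (vdens c (wpart y))"
    unfolding total_dual_def L_def by (simp add: linear_sum[OF linear_blk(1)] linear_scale[OF linear_blk(1)])
  then have "total_dual c y = blk L (vdens c (wpart y))" by (simp add: blk_add)
  ultimately show ?thesis using hpd_blk vdens_pos[OF c y] by simp
qed

text \<open>\<open>active\<close> varies with the point, but near \<open>z0\<close> it stays inside
  one finite set, and the added terms have weight 0. This allows differentiation term by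
  term.\<close>

lemma total_dual_local:
  "\<exists>Q F. open Q \<and> z0 \<in> Q \<and> finite F \<and> (\<forall>y. y $ None \<in> Q \<longrightarrow> total_dual c y =
     (\<Sum>g\<in>F. cutoff (y $ None + \<tau> g) *\<^sub>R blk (dual g c (wpart y)) 0) + blk 0 (vdens c (wpart y)))"
proof -
  define P' where "P' = {z. \<bar>s z - s z0\<bar> < 1 \<and> \<bar>t z - t z0\<bar> < 1}"
  define F where "F = {g :: int \<times> int. \<bar>s z0 + of_int (fst g)\<bar> < 2 \<and> \<bar>t z0 + of_int (snd g)\<bar> < 2}"
  have "continuous_on UNIV s" "continuous_on UNIV t"
    using s(1) t(1) by (simp_all add: linear_continuous_on linear_conv_bounded_linear[symmetric])
  then have "open P'"
    unfolding P'_def by (intro open_Collect_conj open_Collect_less continuous_intros)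
  moreover have "z0 \<in> P'" by (simp add: P'_def)
  moreover have finF: "finite F" unfolding F_def by (rule finite_near)
  moreover have "total_dual c y =
     (\<Sum>g\<in>F. cutoff (y $ None + \<tau> g) *\<^sub>R blk (dual g c (wpart y)) 0) + blk 0 (vdens c (wpart y))"
    if y: "y $ None \<in> P'" for y
  proof -
    have "active (y $ None) \<subseteq> F" using y by (auto simp: active_def F_def P'_def)
    then show ?thesis
      unfolding total_dual_def using finF cutoff_active(2)
      by (intro arg_cong2[where f = "(+)"] refl sum.mono_neutral_left) auto
  qed
  ultimately show ?thesis by blast
qed

lemma smooth_on_cutoff: "smooth_on UNIV (\<lambda>z. cutoff (z + \<tau> g))"
proof -
  have lin: "smooth_on UNIV (\<lambda>z. l (z + \<tau> g))" if "linear l" for l :: "complex \<Rightarrow> real"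
    unfolding linear_add[OF that]
    by (intro smooth_on_add smooth_on_linear smooth_on_const open_UNIV linear_conv_bounded_linear[THEN iffD1] that)
  have b: "smooth_on UNIV (\<lambda>z. bump (l (z + \<tau> g)))" if "linear l" for l :: "complex \<Rightarrow> real"
    by (rule smooth_on_compose[OF _ _ _ smooth_on_bump lin[OF that]]) auto
  show ?thesis unfolding cutoff_def by (intro smooth_on_mult open_UNIV b s t)
qed

lemma open_chart: "c \<in> atlas M \<Longrightarrow> open (snd c ` fst c)"
  using complex_manifoldD(1)[OF M] chart_onD(1,3) by blast

lemma smooth_on_dual:
  assumes c: "c \<in> atlas M"
  shows "smooth_on (snd c ` fst c) (dual g c)"
proof -
  have "smooth_on (snd c ` fst c) (pullback_field M (G g) H c)"
    using balanced_pullback_G c hermitian_fieldD(2) unfolding balanced_field_def by blast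
  then have "smooth_on (snd c ` fst c) (\<lambda>x. ldual (pullback_field M (G g) H c x))"
    by (rule smooth_on_ldual[OF open_chart[OF c]]) (rule hpd_pullback_G[OF c])
  then show ?thesis by (simp add: dual_def[abs_def])
qed

lemma smooth_on_vdens:
  assumes c: "c \<in> atlas M"
  shows "smooth_on (snd c ` fst c) (vdens c)"
proof -
  have "smooth_on (snd c ` fst c) (\<lambda>x. V c x ref_list)"
    using V c unfolding volume_form_def differential_form_def by blast
  moreover have "(\<lambda>x. V c x ref_list) ` (snd c ` fst c) \<subseteq> - {0}"
    using vdens_pos[OF c] by (force simp: vdens_def)
  ultimately have "smooth_on (snd c ` fst c) (\<lambda>x. \<bar>V c x ref_list\<bar>)"
    by (intro smooth_on_compose[OF open_chart[OF c] _ _ smooth_on_abs]) auto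
  then show ?thesis by (simp add: vdens_def[abs_def])
qed

lemma smooth_on_total_dual:
  assumes c: "c \<in> atlas M" and Q: "open Q" "\<And>y. y \<in> Q \<Longrightarrow> wpart y \<in> snd c ` fst c"
  shows "smooth_on Q (total_dual c)"
proof (rule smooth_on_local)
  fix y0 assume "y0 \<in> Q"
  obtain P F where P: "open P" "y0 $ None \<in> P" "finite F" "\<And>y. y $ None \<in> P \<Longrightarrow> total_dual c y =
     (\<Sum>g\<in>F. cutoff (y $ None + \<tau> g) *\<^sub>R blk (dual g c (wpart y)) 0) + blk 0 (vdens c (wpart y))"
    using total_dual_local[of "y0 $ None" c] by blast
  define U where "U = Q \<inter> {y. wpart y \<in> UNIV \<and> y $ None \<in> P}"
  have U: "open U" unfolding U_def by (intro open_Int Q(1) open_parts open_UNIV P(1))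
  have w: "smooth_on U wpart" "smooth_on U (\<lambda>y. y $ None)"
    by (intro smooth_on_linear U bounded_linear_wpart bounded_linear_vec_nth)+
  have wU: "wpart ` U \<subseteq> snd c ` fst c" using Q(2) by (auto simp: U_def)
  have 1: "smooth_on U (\<lambda>y. cutoff (y $ None + \<tau> g))" for g
    by (rule smooth_on_compose[OF U open_UNIV _ smooth_on_cutoff w(2)]) simp
  have 2: "smooth_on U (\<lambda>y. blk (dual g c (wpart y)) 0)" for g
    by (rule smooth_on_linear_compose[OF U linear_conv_bounded_linear[THEN iffD1, OF linear_blk(1)]
          smooth_on_compose[OF U open_chart[OF c] wU smooth_on_dual[OF c] w(1)]])
  have 3: "smooth_on U (\<lambda>y. blk (0 :: complex ^ 'n ^ 'n) (vdens c (wpart y)))"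
    by (rule smooth_on_linear_compose[OF U linear_conv_bounded_linear[THEN iffD1, OF linear_blk(2)]
          smooth_on_compose[OF U open_chart[OF c] wU smooth_on_vdens[OF c] w(1)]])
  have "smooth_on U (\<lambda>y. (\<Sum>g\<in>F. cutoff (y $ None + \<tau> g) *\<^sub>R blk (dual g c (wpart y)) 0) + blk 0 (vdens c (wpart y)))"
    by (rule smooth_on_add[OF U smooth_on_sum[OF U smooth_on_scaleR[OF U 1 2]] 3])
  then have "smooth_on U (total_dual c)"
    by (rule smooth_on_cong[OF U, rotated]) (simp add: P(4) U_def)
  then show "\<exists>U. open U \<and> y0 \<in> U \<and> smooth_on (Q \<inter> U) (total_dual c)"
    using U P(2) \<open>y0 \<in> Q\<close> by (intro exI[of _ U]) (auto simp: U_def Int_absorb1 intro: smooth_on_subset)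
qed

lemma divfree_total_dual:
  assumes c: "c \<in> atlas M" and y: "wpart y \<in> snd c ` fst c"
  shows "divfree (total_dual c) y"
proof -
  obtain P F where P: "open P" "y $ None \<in> P" "finite F" "\<And>y. y $ None \<in> P \<Longrightarrow> total_dual c y =
     (\<Sum>g\<in>F. cutoff (y $ None + \<tau> g) *\<^sub>R blk (dual g c (wpart y)) 0) + blk 0 (vdens c (wpart y))"
    using total_dual_local[of "y $ None" c] by blast
  have "divfree (dual g c) (wpart y)" for g
    using balanced_pullback_G[of g] c y unfolding balanced_field_def dual_def[abs_def] by blast
  then have "divfree (\<lambda>y. cutoff (y $ None + \<tau> g) *\<^sub>R blk (dual g c (wpart y)) 0) y" for g
    by (rule divfree_blk_left[OF _ smooth_on_has_derivative[OF smooth_on_cutoff UNIV_I]])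
  moreover have "divfree (\<lambda>y. blk 0 (vdens c (wpart y))) y"
    by (rule divfree_blk_right[OF smooth_on_has_derivative[OF smooth_on_vdens[OF c] y]])
  ultimately have "divfree (\<lambda>y. (\<Sum>g\<in>F. cutoff (y $ None + \<tau> g) *\<^sub>R blk (dual g c (wpart y)) 0) + blk 0 (vdens c (wpart y))) y"
    by (intro divfree_add divfree_sum)
  then show ?thesis
    by (rule divfree_cong[rotated 3]) (use open_parts[OF open_UNIV P(1)] P(2,4) in auto)
qed

section \<open>The invariant balanced metric on the product and its descent\<close>

text \<open>Fields are indexed by charts, so the chart of M must be recovered from a product chart.
  The value 0 of the plane coordinate is arbitrary, since \<open>wpart\<close> discards it.\<close>

definition base_chart :: "('a \<times> complex, 'n option) chart \<Rightarrow> ('a, 'n) chart" where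
  "base_chart k = (fst ` fst k, \<lambda>p. wpart (snd k (p, 0)))"

lemma base_chart_plane_chart [simp]: "base_chart (plane_chart c) = c"
  by (simp add: base_chart_def prod_eq_iff)

definition total_metric :: "('a \<times> complex, 'n option) matrix_field" where
  "total_metric k y = hroot (total_dual (base_chart k) y)"

text \<open>\<open>total_dual_law\<close> is the hypothesis of \<open>hroot_pullback\<close>; the
  extra plane coordinate guarantees dimension at least 2, as the root requires.\<close>

lemma total_metric_invariant:
  assumes k: "k \<in> atlas (times_plane M)" and l: "l \<in> atlas (times_plane M)"
    and x: "x \<in> fst k" "act h x \<in> fst l"
  shows "total_metric k (snd k x) = adj (Dm k l (act h) x) ** total_metric l (snd l (act h x)) ** Dm k l (act h) x"
proof -
  obtain c d where cd: "c \<in> atlas M" "d \<in> atlas M" "k = plane_chart c" "l = plane_chart d"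
    using k l unfolding times_plane_simps by blast
  obtain p z where x': "x = (p, z)" by (cases x)
  have p: "p \<in> fst c" "G h p \<in> fst d" using x unfolding x' cd(3,4) by (auto simp: act_def shift_map_def)
  obtain m where N: "CARD('n) = Suc m" using gr0_implies_Suc[OF zero_less_card_finite[where 'a = 'n]] by blast
  have N': "CARD('n option) = Suc (Suc m)" by (simp add: N)
  have D: "Dm k l (act h) x = blk (Dm c d (G h) p) 1"
    unfolding x' cd(3,4) act_def by (rule Dm_shift_map[OF M hol_auto_map[OF G_good(1)] cd(1,2) p])
  have "hpd (total_dual d (mkv (snd d (G h p)) (z + \<tau> h)))"
    by (rule hpd_total_dual[OF cd(2)]) (use p in simp)
  from hroot_pullback[OF this invertible_blk_1[OF hol_auto_invertible[OF M G_good(1) cd(1,2) p]] N' total_dual_law[OF cd(1,2) p]]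
  show ?thesis
    unfolding D unfolding total_metric_def x' cd(3,4) by (simp add: act_def shift_map_def)
qed

lemma balanced_total_metric: "balanced_field (times_plane M) total_metric"
  unfolding balanced_field_def hermitian_field_def
proof (intro conjI ballI)
  fix k assume k: "k \<in> atlas (times_plane M)"
  then obtain c where c: "c \<in> atlas M" "k = plane_chart c" unfolding times_plane_simps by blast
  have o: "open (snd k ` fst k)"
    using complex_manifoldD(1)[OF complex_manifold_times_plane[OF M] k] chart_onD(1,3) by blast
  have w: "wpart y \<in> snd c ` fst c" if "y \<in> snd k ` fst k" for y using that c(2) by auto
  have hp: "hpd (total_dual (base_chart k) y)" if "y \<in> snd k ` fst k" for y
    unfolding c(2) base_chart_plane_chart by (rule hpd_total_dual[OF c(1) w[OF that]])
  show "hpd (total_metric k y)" if "y \<in> snd k ` fst k" for y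
    unfolding total_metric_def by (rule hpd_hroot[OF hp[OF that]])
  have "smooth_on (snd k ` fst k) (total_dual (base_chart k))"
    unfolding c(2) base_chart_plane_chart
    by (rule smooth_on_total_dual[OF c(1) o[unfolded c(2)]]) (rule w[unfolded c(2)])
  then show "smooth_on (snd k ` fst k) (total_metric k)"
    unfolding total_metric_def[abs_def] by (rule smooth_on_hroot[OF o _ hp])
  show "divfree (\<lambda>y. ldual (total_metric k y)) y" if y: "y \<in> snd k ` fst k" for y
  proof -
    obtain m where N: "CARD('n) = Suc m" using gr0_implies_Suc[OF zero_less_card_finite[where 'a = 'n]] by blast
    have N': "CARD('n option) = Suc (Suc m)" by (simp add: N)
    have "divfree (total_dual (base_chart k)) y"
      unfolding c(2) base_chart_plane_chart by (rule divfree_total_dual[OF c(1) w[OF y]])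
    then show ?thesis
      by (rule divfree_cong[OF o y, rotated]) (simp add: total_metric_def ldual_hroot[OF hp N'])
  qed
next
  fix k l x assume kl: "k \<in> atlas (times_plane M)" "l \<in> atlas (times_plane M)" and x: "x \<in> fst k \<inter> fst l"
  have xN: "x \<in> topspace (mtop (times_plane M))"
    using complex_manifoldD(3)[OF complex_manifold_times_plane[OF M] kl(1)] x by blast
  \<comment> \<open>Compatibility with chart changes is invariance under the neutral element.
    \<open>act 0\<close> is known to be the identity only on points of the manifold, so the
    Jacobians are compared through \<open>Dm_cong\<close>.\<close>
  have "Dm k l (act 0) x = Dm k l id x"
    by (rule Dm_cong[OF complex_manifold_times_plane[OF M] kl(1) openin_topspace xN]) (use x act_0 in auto)
  then show "total_metric k (snd k x) = adj (Dm k l id x) ** total_metric l (snd l x) ** Dm k l id x"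
    using total_metric_invariant[OF kl, of x 0] act_0[OF xN] x by simp
qed

lemma balanced_toric_suspension: "balanced_manifold (toric_suspension M f1 f2 \<xi>1 \<xi>2)"
  unfolding toric_suspension_eq
  by (rule quotient_action.balanced_S[OF quotient_action balanced_total_metric total_metric_invariant])

end

theorem theorem4p2:
  fixes M :: "('a, 'n::finite) cmanifold"
    and f1 f2 :: "'a \<Rightarrow> 'a"
    and V :: "('a, 'n) form_field"
    and \<xi>1 \<xi>2 :: complex
  assumes "complex_manifold M"
    and "compact_space (mtop M)"
    and "balanced_manifold M"
    and "holomorphic_automorphism M f1"
    and "holomorphic_automorphism M f2"
    and "\<And>p. p \<in> topspace (mtop M) \<Longrightarrow> f1 (f2 p) = f2 (f1 p)"
    and "volume_form M V"
    and "pullback_eq M M f1 V V"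
    and "pullback_eq M M f2 V V"
    and "\<xi>1 \<noteq> \<xi>2" and "independent {\<xi>1, \<xi>2}"
  shows "balanced_manifold (toric_suspension M f1 f2 \<xi>1 \<xi>2)"
proof -
  obtain h where "balanced_metric M h" using assms(3) by (auto simp: balanced_manifold_def)
  then obtain H where H: "balanced_field M H" using balanced_metric_imp_field[OF assms(1)] by blast
  \<comment> \<open>Independence over the reals provides the coordinate functionals of the lattice
    basis; distinctness of the generators makes the prescribed values consistent.\<close>
  have ex: "\<exists>l :: complex \<Rightarrow> real. linear l \<and> (\<forall>x\<in>{\<xi>1, \<xi>2}. l x = k x)" for k
    by (rule linear_independent_extend[OF assms(11)])
  obtain s :: "complex \<Rightarrow> real" where s': "linear s" "\<forall>x\<in>{\<xi>1, \<xi>2}. s x = (if x = \<xi>1 then 1 else 0)"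
    using ex[of "\<lambda>x. if x = \<xi>1 then 1 else 0"] by (elim exE conjE)
  have s: "linear s" "s \<xi>1 = 1" "s \<xi>2 = 0" using s' assms(10) by auto
  obtain t :: "complex \<Rightarrow> real" where t': "linear t" "\<forall>x\<in>{\<xi>1, \<xi>2}. t x = (if x = \<xi>1 then 0 else 1)"
    using ex[of "\<lambda>x. if x = \<xi>1 then 0 else 1"] by (elim exE conjE)
  have t: "linear t" "t \<xi>1 = 0" "t \<xi>2 = 1" using t' assms(10) by auto
  interpret suspension M f1 f2 V \<xi>1 \<xi>2 H s t
    by (rule suspension.intro) (fact assms H s t)+
  show ?thesis by (rule balanced_toric_suspension)
qed

end
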